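(* Let $\mathbf{T}=(T_1,\dots,T_d)$ be a commuting $d$-tuple of bounded operators on $\mathcal{H}$. For $0<t<1$, $r(\mathbf{T})=\lim_{n\to\infty}\|\Delta_t^{(n)}(\mathbf{T})\|_2$.
   Context: $\mathcal{H}$ is a complex infinite-dimensional Hilbert space. For a commuting $d$-tuple $\mathbf{T}=(T_1,\dots,T_d)$ of bounded operators on $\mathcal{H}$, put $P:=\sqrt{T_1^*T_1+\cdots+T_d^*T_d}$ and $\|\mathbf{T}\|_2:=\|P\|$. Let $T_i=V_iP$ $(i=1,\dots,d)$ be the canonical (spherical) polar decomposition: the column $(V_1,\dots,V_d)^{\mathsf T}:\mathcal{H}\to\mathcal{H}\oplus\cdots\oplus\mathcal{H}$ is the partial isometry in the polar decomposition of the column operator $(T_1,\dots,T_d)^{\mathsf T}$, so that $\bigcap_i\ker T_i=\bigcap_i\ker V_i=\ker P$. For $0\le t\le 1$ the generalized spherical Aluthge transform is $\Delta_t(\mathbf{T}):=(P^tV_1P^{1-t},\dots,P^tV_dP^{1-t})$, with the convention $P^0=I$; it is again a commuting $d$-tuple. $\Delta_t^{(n)}$ denotes the $n$-th iterate of $\Delta_t$. The Koszul complex $K(\mathbf{T},\mathcal{H})$ is the cochain complex $0\to\mathcal{H}\otimes\Lambda^0\to\cdots\to\mathcal{H}\otimes\Lambda^d\to 0$, where $\Lambda^k$ is the $k$-th exterior power of $\mathbb{C}^d$ with basis vectors $e_1,\dots,e_d$, with boundary maps $x\otimes\xi\mapsto\sum_{i=1}^d T_ix\otimes(e_i\wedge\xi)$.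 The Taylor spectrum $\sigma_T(\mathbf{T})$ is the set of $\boldsymbol{\lambda}\in\mathbb{C}^d$ such that the Koszul complex of $(T_1-\lambda_1,\dots,T_d-\lambda_d)$ is not exact. The joint spectral radius is $r(\mathbf{T}):=\sup\{\sqrt{|\lambda_1|^2+\cdots+|\lambda_d|^2}:(\lambda_1,\dots,\lambda_d)\in\sigma_T(\mathbf{T})\}$. *)

theory Defs
  imports "HOL-Analysis.Analysis" "HOL-Computational_Algebra.Polynomial"
begin

section \<open>Complex Hilbert spaces\<close>

text \<open>A complex inner product space, presented on top of its underlying real inner product
  space, so that norm, topology and operator norm are those of the library.  The complex inner
  product is linear in its first argument.\<close>

class complex_inner = real_inner +
  fixes scaleC :: "complex \<Rightarrow> 'a \<Rightarrow> 'a" (infixr "*\<^sub>C" 75)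
    and cinner :: "'a \<Rightarrow> 'a \<Rightarrow> complex"
  assumes scaleC_add_right: "c *\<^sub>C (x + y) = c *\<^sub>C x + c *\<^sub>C y"
    and scaleC_add_left: "(b + c) *\<^sub>C x = b *\<^sub>C x + c *\<^sub>C x"
    and scaleC_scaleC: "b *\<^sub>C c *\<^sub>C x = (b * c) *\<^sub>C x"
    and scaleR_scaleC: "r *\<^sub>R x = complex_of_real r *\<^sub>C x"
    and cinner_commute: "cinner x y = cnj (cinner y x)"
    and cinner_add_left: "cinner (x + y) z = cinner x z + cinner y z"
    and cinner_scaleC_left: "cinner (c *\<^sub>C x) y = c * cinner x y"
    and inner_eq_Re_cinner: "inner x y = Re (cinner x y)"

class chilbert_space = complex_inner + complete_space
begin
subclass banach ..
end

global_interpretation complex_vector: vector_space "scaleC :: complex \<Rightarrow> 'a \<Rightarrow> 'a::complex_inner"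
  defines cspan = complex_vector.span
proof
  fix x :: 'a
  show "1 *\<^sub>C x = x"
    using scaleR_scaleC[of 1 x] by simp
qed (simp_all add: scaleC_add_right scaleC_add_left scaleC_scaleC)

section \<open>Bounded operators\<close>

text \<open>The library type of bounded operators consists of real-linear maps; the operators meant
  here are the complex-linear ones among them.  The operator norm is the same.\<close>

definition complex_linear :: "('a::complex_inner \<Rightarrow>\<^sub>L 'a) \<Rightarrow> bool" where
  "complex_linear A \<longleftrightarrow> (\<forall>c x. A (c *\<^sub>C x) = c *\<^sub>C A x)"

definition adj :: "('a::chilbert_space \<Rightarrow>\<^sub>L 'a) \<Rightarrow> ('a \<Rightarrow>\<^sub>L 'a)" where
  "adj A = (THE B :: 'a \<Rightarrow>\<^sub>L 'a. \<forall>x y. cinner (A x) y = cinner x (B y))"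

definition positive_op :: "('a::chilbert_space \<Rightarrow>\<^sub>L 'a) \<Rightarrow> bool" where
  "positive_op A \<longleftrightarrow> complex_linear A \<and> (\<forall>x. cinner (A x) x \<in> \<real>\<^sub>\<ge>\<^sub>0)"

definition sqrt_op :: "('a::chilbert_space \<Rightarrow>\<^sub>L 'a) \<Rightarrow> ('a \<Rightarrow>\<^sub>L 'a)" where
  "sqrt_op A = (THE B. positive_op B \<and> B o\<^sub>L B = A)"

definition poly_op :: "real poly \<Rightarrow> ('a::chilbert_space \<Rightarrow>\<^sub>L 'a) \<Rightarrow> ('a \<Rightarrow>\<^sub>L 'a)" where
  "poly_op p A = (\<Sum>k\<le>degree p. coeff p k *\<^sub>R (((o\<^sub>L) A ^^ k) id_blinfun))"

text \<open>Real powers of a positive operator \<open>A\<close>, by the continuous functional calculus: \<open>A\<^sup>s\<close> is the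
  norm limit of \<open>p\<^sub>n(A)\<close> whenever \<open>p\<^sub>n(x) \<rightarrow> x\<^sup>s\<close> uniformly on \<open>[0, \<parallel>A\<parallel>]\<close>, which contains the
  spectrum of \<open>A\<close>.  The case \<open>s = 0\<close> is separate because \<open>0 powr 0 = 0\<close>, whereas \<open>A\<^sup>0 = I\<close>.\<close>

definition power_op :: "('a::chilbert_space \<Rightarrow>\<^sub>L 'a) \<Rightarrow> real \<Rightarrow> ('a \<Rightarrow>\<^sub>L 'a)" where
  "power_op A s =
    (if s = 0 then id_blinfun
     else (THE B. \<forall>p :: nat \<Rightarrow> real poly.
            uniform_limit {0..norm A} (\<lambda>n x. poly (p n) x) (\<lambda>x. x powr s) sequentially
              \<longrightarrow> (\<lambda>n. poly_op (p n) A) \<longlonglongrightarrow> B))"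

section \<open>Operator tuples and the spherical Aluthge transform\<close>

text \<open>A \<open>d\<close>-tuple is a family indexed by a finite type with \<open>d\<close> elements.  The linear order on
  the index type is used only for the signs in the Koszul complex.\<close>

type_synonym ('a, 'd) op_tuple = "'d \<Rightarrow> ('a \<Rightarrow>\<^sub>L 'a)"

definition commuting_tuple :: "('a::chilbert_space, 'd) op_tuple \<Rightarrow> bool" where
  "commuting_tuple T \<longleftrightarrow>
    (\<forall>i. complex_linear (T i)) \<and> (\<forall>i j. T i o\<^sub>L T j = T j o\<^sub>L T i)"

definition modulus :: "('a::chilbert_space, 'd::finite) op_tuple \<Rightarrow> ('a \<Rightarrow>\<^sub>L 'a)" where
  "modulus T = sqrt_op (\<Sum>i\<in>UNIV. adj (T i) o\<^sub>L T i)"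

definition tuple_norm :: "('a::chilbert_space, 'd::finite) op_tuple \<Rightarrow> real" where
  "tuple_norm T = norm (modulus T)"

text \<open>The column operator from \<open>H\<close> to the Hilbert space direct sum of \<open>d\<close> copies of \<open>H\<close>.\<close>

definition column_op :: "('a::chilbert_space, 'd::finite) op_tuple \<Rightarrow> 'a \<Rightarrow> 'a ^ 'd" where
  "column_op V x = (\<chi> i. V i x)"

text \<open>The first factor of the polar decomposition \<open>T\<^sub>i = V\<^sub>i P\<close>: the column of \<open>V\<close> is isometric on
  the orthogonal complement of its kernel, and its kernel is that of \<open>P\<close>.\<close>

definition polar_part :: "('a::chilbert_space, 'd::finite) op_tuple \<Rightarrow> ('a, 'd) op_tuple" where
  "polar_part T = (THE V.
     (\<forall>i. complex_linear (V i)) \<and>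
     (\<forall>x. (\<forall>y. column_op V y = 0 \<longrightarrow> cinner x y = 0) \<longrightarrow> norm (column_op V x) = norm x) \<and>
     {x. column_op V x = 0} = {x. modulus T x = 0} \<and>
     (\<forall>i. T i = V i o\<^sub>L modulus T))"

definition aluthge :: "real \<Rightarrow> ('a::chilbert_space, 'd::finite) op_tuple \<Rightarrow> ('a, 'd) op_tuple" where
  "aluthge t T =
    (\<lambda>i. power_op (modulus T) t o\<^sub>L polar_part T i o\<^sub>L power_op (modulus T) (1 - t))"

section \<open>Koszul complex and Taylor spectrum\<close>

text \<open>An element \<open>\<Sum>\<^sub>I x\<^sub>I \<otimes> e\<^sub>I\<close> of \<open>H \<otimes> \<Lambda>\<^sup>k\<close>, where \<open>I\<close> runs over the \<open>k\<close>-element index sets and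
  \<open>e\<^sub>I\<close> is the wedge of the \<open>e\<^sub>i\<close>, \<open>i \<in> I\<close>, in increasing order, is represented by its coefficient
  function \<open>I \<mapsto> x\<^sub>I\<close>.\<close>

definition koszul_space :: "nat \<Rightarrow> ('d::finite set \<Rightarrow> 'a::chilbert_space) set" where
  "koszul_space k = {x. \<forall>I. card I \<noteq> k \<longrightarrow> x I = 0}"

text \<open>The coefficient at \<open>e\<^sub>J\<close> of \<open>\<Sum>\<^sub>i S\<^sub>i x \<otimes> (e\<^sub>i \<and> \<xi>)\<close>: for \<open>i \<in> J\<close>, moving \<open>e\<^sub>i\<close> to its place
  in \<open>e\<^sub>i \<and> e\<^bsub>J - {i}\<^esub>\<close> passes the \<open>e\<^sub>j\<close> with \<open>j \<in> J\<close>, \<open>j < i\<close>.\<close>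

definition koszul_boundary ::
    "('d::{finite,linorder} \<Rightarrow> 'a \<Rightarrow> 'a) \<Rightarrow> ('d set \<Rightarrow> 'a::chilbert_space) \<Rightarrow> ('d set \<Rightarrow> 'a)" where
  "koszul_boundary S x J = (\<Sum>i\<in>J. (- 1) ^ card {j\<in>J. j < i} *\<^sub>R S i (x (J - {i})))"

definition koszul_exact :: "('d::{finite,linorder} \<Rightarrow> 'a::chilbert_space \<Rightarrow> 'a) \<Rightarrow> bool" where
  "koszul_exact S \<longleftrightarrow>
    (\<forall>k\<le>CARD('d).
      {x \<in> koszul_space k. koszul_boundary S x = (\<lambda>_. 0)} =
      koszul_boundary S ` (if k = 0 then {\<lambda>_. 0} else koszul_space (k - 1)))"

definition taylor_spectrum ::
    "('a::chilbert_space, 'd::{finite,linorder}) op_tuple \<Rightarrow> (complex ^ 'd::{finite,linorder}) set" where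
  "taylor_spectrum T = {l. \<not> koszul_exact (\<lambda>i x. T i x - (l $ i) *\<^sub>C x)}"

definition joint_spectral_radius ::
    "('a::chilbert_space, 'd::{finite,linorder}) op_tuple \<Rightarrow> real" where
  "joint_spectral_radius T = (SUP l\<in>taylor_spectrum T. norm l)"

end

theory Submission
  imports Defs "HOL-Computational_Algebra.Fundamental_Theorem_Algebra"
begin

text \<open>Write \<open>T\<^sub>w\<close> for the product of the \<open>T\<^sub>i\<close> along a word \<open>w\<close>, let \<open>c\<^sub>k(T)\<close> be the norm of the
  column of all \<open>T\<^sub>w\<close> with \<open>|w| = k\<close>, and \<open>\<rho>(T) = lim c\<^sub>k(T)\<^bsup>1/k\<^esup>\<close>.  Both sides of the theorem equal
  \<open>\<rho>(T)\<close>.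

  Norms: \<open>\<Delta>(T)\<^bsub>wi\<^esub> = P\<^sup>t T\<^sub>w V\<^sub>i P\<^bsup>1-t\<^esup>\<close>, and \<open>(a, b) \<mapsto> \<parallel>P\<^sup>a (T\<^sub>w V\<^sub>i)\<^bsub>w,i\<^esub> P\<^sup>b\<parallel>\<close> is logarithmically
  convex (Heinz), which gives \<open>c\<^sub>k(\<Delta> T) \<le> c\<^sub>k(T)\<close> and
  \<open>c\<^sub>k(\<Delta> T) \<le> (c\<^bsub>k-1\<^esub>(T) c\<^bsub>k+1\<^esub>(T))\<^sup>\<tau> c\<^sub>k(T)\<^bsup>1-2\<tau>\<^esup>\<close> for \<open>\<tau> = min t (1 - t)\<close>.  Hence the limits \<open>s\<^sub>k\<close> of
  \<open>c\<^sub>k(\<Delta>\<^sup>n T)\<close> satisfy \<open>s\<^sub>k\<^sup>2 \<le> s\<^bsub>k-1\<^esub> s\<^bsub>k+1\<^esub>\<close>, so \<open>s\<^sub>1\<^sup>k \<le> s\<^sub>k \<le> c\<^sub>k(T)\<close> and \<open>s\<^sub>1 \<le> \<rho>(T)\<close>.  Conversely \<open>\<rho>\<close> does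
  not decrease under \<open>\<Delta>\<close>, since \<open>T\<^sub>i T\<^sub>w = V\<^sub>i P\<^bsup>1-t\<^esup> \<Delta>(T)\<^sub>w P\<^sup>t\<close>.

  Spectrum: if \<open>|\<lambda>| > \<rho>(T)\<close>, then \<open>|\<lambda>|\<^sup>2 - \<Sum>\<^sub>i cnj \<lambda>\<^sub>i T\<^sub>i\<close> is invertible by a Neumann series, and its
  inverse yields a contracting homotopy of the Koszul complex of \<open>T - \<lambda>\<close>.  To find a point of the
  spectrum with \<open>|\<lambda>| \<ge> \<rho>(T)\<close>, consider the commuting maps \<open>Q(X) = \<Sum>\<^sub>i T\<^sub>i\<^sup>* X T\<^sub>i\<close> and \<open>L\<^sub>i(X) = T\<^sub>i\<^sup>* X\<close>
  on operators.  The spectral radius of \<open>Q\<close> is \<open>\<rho>(T)\<^sup>2\<close>, so there are joint approximate eigenvectors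
  with \<open>Q(W) \<approx> \<mu> W\<close>, \<open>|\<mu>| = \<rho>(T)\<^sup>2\<close>, and \<open>L\<^sub>i(W) \<approx> b\<^sub>i W\<close>; these force \<open>|b| \<ge> \<rho>(T)\<close>, and since the \<open>T\<^sub>i\<^sup>*\<close>
  have joint approximate eigenvalue \<open>b\<close>, the Koszul complex of \<open>T - cnj b\<close> is not exact in top degree.\<close>

section \<open>Approximate roots for submultiplicative seminorms on polynomials\<close>

text \<open>The sums run over words, not multi-indices: concatenation then makes c_k
  submultiplicative, and the sum of T_w^* T_w over |w| = k is Q^k(I). This explains the passage to
  maps on operators: \<rho>(T) is a joint quantity, but its square is the spectral radius of the
  single map Q. Approximate eigenvalues are then required for the left factors only; the right
  factors T_i are absorbed by Cauchy-Schwarz over words, which turns |\<mu>| = \<rho>^2 into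
  \<rho>^2 \<le> |b| \<rho>. A point of the approximate spectrum on the extremal circle usually
  comes from analyticity of the resolvent. Here it comes from finite averages of truncated geometric
  sums, so that only norms of polynomials in a map enter. The argument is therefore stated for
  seminorms on polynomials and serves twice: for Q on all operators, and for each L_i on the
  limiting joint kernel of the maps already treated. In the norm part, T and its transform stand on
  different sides of the interpolation inequality; along the iteration both sides have the same
  limits s_k, the power s_k^(1 - 2 \<tau>) cancels, and \<tau> > 0 allows the remaining root to be
  taken.\<close>

lemma power_le_const_mult_power:
  fixes x R C :: real
  assumes "0 \<le> R" and bound: "\<And>n. x ^ n \<le> C * R ^ n"
  shows "x \<le> R"
proof (rule ccontr)
  assume "\<not> x \<le> R"
  then have xR: "R < x" by simp
  then have x0: "x > 0" using assms(1) by simp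
  show False
  proof (cases "R = 0")
    case True
    then show False using bound[of 1] x0 by simp
  next
    case False
    then have R0: "R > 0" using assms(1) by simp
    then have "x / R > 1" using xR by simp
    then obtain n where "C < (x / R) ^ n" using real_arch_pow by blast
    then have "C * R ^ n < x ^ n" using R0 by (simp add: power_divide field_simps)
    then show False using bound[of n] by simp
  qed
qed

text \<open>With the infimum in place of the limit of n-th roots, no convergence has to be shown:
  lower bounds on the sequence are immediate, and \<open>growth_rate_bound\<close> supplies the
  upper ones. Index 0 is left out because \<open>root 0 x = 0\<close>.\<close>

definition growth_rate :: "(nat \<Rightarrow> real) \<Rightarrow> real" where
  "growth_rate a = (INF n\<in>{1..}. root n (a n))"

lemma
  fixes a :: "nat \<Rightarrow> real"
  assumes nonneg: "\<And>n. 0 \<le> a n"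
  shows growth_rate_nonneg: "0 \<le> growth_rate a"
    and growth_rate_power_le: "n \<ge> 1 \<Longrightarrow> growth_rate a ^ n \<le> a n"
    and growth_rate_greatest: "\<lbrakk>\<And>n. n \<ge> 1 \<Longrightarrow> s ^ n \<le> a n; 0 \<le> s\<rbrakk> \<Longrightarrow> s \<le> growth_rate a"
proof -
  have bdd: "bdd_below ((\<lambda>n. root n (a n)) ` {1..})"
    by (rule bdd_belowI[of _ 0]) (use nonneg in auto)
  show nn: "0 \<le> growth_rate a"
    unfolding growth_rate_def by (rule cINF_greatest) (use nonneg in auto)
  show "growth_rate a ^ n \<le> a n" if "n \<ge> 1" for n
  proof -
    have "growth_rate a \<le> root n (a n)"
      unfolding growth_rate_def by (rule cINF_lower[OF bdd]) (use that in auto)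
    then have "growth_rate a ^ n \<le> root n (a n) ^ n" by (rule power_mono) (rule nn)
    also have "\<dots> = a n" using that nonneg by (intro real_root_pow_pos2) auto
    finally show ?thesis .
  qed
  show "s \<le> growth_rate a" if s: "\<And>n. n \<ge> 1 \<Longrightarrow> s ^ n \<le> a n" "0 \<le> s"
    unfolding growth_rate_def
  proof (rule cINF_greatest)
    fix n :: nat assume n: "n \<in> {1..}"
    have "s = root n (s ^ n)" using n s(2) by (simp add: real_root_power_cancel)
    also have "\<dots> \<le> root n (a n)" using n s(1)[of n] by simp
    finally show "s \<le> root n (a n)" .
  qed auto
qed

text \<open>One m with \<open>a m \<le> R ^ m\<close> suffices: split off blocks of length m, and
  let C cover the remaining lengths below m.\<close>

lemma growth_rate_bound:
  fixes a :: "nat \<Rightarrow> real"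
  assumes nonneg: "\<And>n. 0 \<le> a n" and submult: "\<And>m n. a (m + n) \<le> a m * a n"
    and R: "growth_rate a < R"
  shows "\<exists>C. \<forall>n. a n \<le> C * R ^ n"
proof -
  have "\<exists>m\<ge>1. root m (a m) < R"
  proof (rule ccontr)
    assume "\<not> (\<exists>m\<ge>1. root m (a m) < R)"
    then have "R \<le> growth_rate a"
      unfolding growth_rate_def by (intro cINF_greatest) auto
    with R show False by simp
  qed
  then obtain m where m: "m \<ge> 1" "root m (a m) < R" by blast
  have R0: "R > 0" using growth_rate_nonneg[OF nonneg] R by (meson le_less_trans)
  have "a m = root m (a m) ^ m" using m nonneg by (intro real_root_pow_pos2[symmetric]) auto
  also have "\<dots> \<le> R ^ m" using m nonneg by (intro power_mono) auto
  finally have am: "a m \<le> R ^ m" .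
  define C where "C = (\<Sum>r<m. a r / R ^ r)"
  have "a n \<le> C * R ^ n" for n
  proof (induction n rule: less_induct)
    case (less n)
    show ?case
    proof (cases "n < m")
      case True
      have "a n / R ^ n \<le> C"
        unfolding C_def by (rule member_le_sum) (use True nonneg R0 in auto)
      then show ?thesis using R0 by (simp add: field_simps)
    next
      case False
      have "a n \<le> a m * a (n - m)" using submult[of m "n - m"] False by simp
      also have "\<dots> \<le> R ^ m * (C * R ^ (n - m))"
        using less.IH[of "n - m"] m False nonneg am R0 by (intro mult_mono) auto
      also have "\<dots> = C * R ^ n" using False by (simp add: power_add[symmetric])
      finally show ?thesis .
    qed
  qed
  then show ?thesis by blast
qed

section \<open>Seminorms on polynomials and averages over roots of unity\<close>

lemma sum_roots_of_unity:
  fixes n i :: nat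
  assumes "n \<ge> 1"
  shows "(\<Sum>k<n. (cis (2 * pi / n) ^ k) ^ i) = (if n dvd i then of_nat n else 0)"
proof -
  define \<zeta> where "\<zeta> = cis (2 * pi / n) ^ i"
  have \<zeta>: "\<zeta> = exp (2 * of_real pi * \<i> * of_nat i / of_nat n)"
    unfolding \<zeta>_def by (simp add: Complex.DeMoivre cis_conv_exp exp_of_nat_mult[symmetric] mult_ac del: exp_divide_power_eq)
  have iff: "\<zeta> = 1 \<longleftrightarrow> n dvd i" unfolding \<zeta> by (rule complex_root_unity_eq_1) (use assms in auto)
  have "\<zeta> ^ n = (cis (2 * pi / n) ^ n) ^ i" unfolding \<zeta>_def by (metis power_mult mult.commute)
  also have "cis (2 * pi / n) ^ n = 1" unfolding Complex.DeMoivre using assms by simp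
  finally have "\<zeta> ^ n = 1" by simp
  moreover have "(\<Sum>k<n. (cis (2 * pi / n) ^ k) ^ i) = (\<Sum>k<n. \<zeta> ^ k)"
    unfolding \<zeta>_def by (intro sum.cong) (auto simp: power_mult[symmetric] mult.commute)
  ultimately show ?thesis using iff
    by (cases "n dvd i") (auto simp: sum_gp_strict)
qed

text \<open>The model is the norm of p(S) for a map S, possibly on a limiting joint kernel. Only
  polynomials in S are measured, so resolvents enter through their truncations.\<close>

locale poly_seminorm =
  fixes \<nu> :: "complex poly \<Rightarrow> real"
  assumes nonneg: "0 \<le> \<nu> p"
    and add: "\<nu> (p + q) \<le> \<nu> p + \<nu> q"
    and smult: "\<nu> (smult c p) \<le> cmod c * \<nu> p"
    and mult: "\<nu> (p * q) \<le> \<nu> p * \<nu> q"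
    and one: "\<nu> 1 = 1"
begin

lemma minus: "\<nu> (- p) = \<nu> p"
proof (rule antisym)
  show "\<nu> (- p) \<le> \<nu> p" using smult[of "-1" p] by simp
  show "\<nu> p \<le> \<nu> (- p)" using smult[of "-1" "-p"] by simp
qed

lemma diff: "\<nu> (p - q) \<le> \<nu> p + \<nu> q"
  using add[of p "-q"] minus[of q] by simp

lemma zero: "\<nu> 0 = 0"
  using smult[of 0 0] nonneg[of 0] by simp

lemma sum: "finite I \<Longrightarrow> \<nu> (sum f I) \<le> (\<Sum>i\<in>I. \<nu> (f i))"
proof (induction I rule: finite_induct)
  case (insert x F)
  then show ?case using add[of "f x" "sum f F"] by simp
qed (simp add: zero)

lemma power: "\<nu> (p ^ n) \<le> \<nu> p ^ n"
proof (induction n)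
  case (Suc n)
  have "\<nu> (p ^ Suc n) \<le> \<nu> p * \<nu> (p ^ n)" using mult[of p "p ^ n"] by simp
  also have "\<dots> \<le> \<nu> p * \<nu> p ^ n" using Suc nonneg by (intro mult_left_mono) auto
  finally show ?case by simp
qed (simp add: one)

definition X :: "complex poly" where "X = [:0, 1:]"

definition geo :: "complex \<Rightarrow> nat \<Rightarrow> complex poly" where
  "geo z m = (\<Sum>i<m. smult z X ^ i)"

lemma geo_mult: "(1 - smult z X) * geo z m = 1 - smult z X ^ m"
  unfolding geo_def by (rule one_diff_power_eq[symmetric])

text \<open>Averaging over the n-th roots of unity keeps only the exponents divisible by n, so the
  average of truncated resolvents of X is a truncated resolvent of \<open>X ^ n\<close>.\<close>

lemma geo_average:
  fixes n :: nat and r :: complex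
  assumes "n \<ge> 1"
  shows "smult (1 / of_nat n) (\<Sum>k<n. geo (cis (2 * pi / n) ^ k * r) (n * L)) = (\<Sum>j<L. (smult r X ^ n) ^ j)"
proof -
  let ?\<omega> = "cis (2 * pi / n)"
  have "(\<Sum>k<n. geo (?\<omega> ^ k * r) (n * L)) = (\<Sum>k<n. \<Sum>i<n * L. smult ((?\<omega> ^ k) ^ i * r ^ i) (X ^ i))"
    unfolding geo_def by (simp add: smult_power power_mult_distrib)
  also have "\<dots> = (\<Sum>i<n * L. \<Sum>k<n. smult ((?\<omega> ^ k) ^ i * r ^ i) (X ^ i))"
    by (rule sum.swap)
  also have "\<dots> = (\<Sum>i<n * L. smult ((\<Sum>k<n. (?\<omega> ^ k) ^ i) * r ^ i) (X ^ i))"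
    by (simp add: smult_sum sum_distrib_right)
  also have "\<dots> = (\<Sum>i<n * L. if n dvd i then smult (of_nat n * r ^ i) (X ^ i) else 0)"
    by (intro sum.cong) (auto simp: sum_roots_of_unity[OF assms])
  also have "\<dots> = (\<Sum>i\<in>{i. i < n * L \<and> n dvd i}. smult (of_nat n * r ^ i) (X ^ i))"
    by (simp add: sum.If_cases Int_def conj_commute)
  also have "\<dots> = (\<Sum>j<L. smult (of_nat n * r ^ (n * j)) (X ^ (n * j)))"
    by (rule sum.reindex_bij_witness[of _ "\<lambda>j. n * j" "\<lambda>i. i div n"]) (use assms in \<open>auto simp: less_mult_imp_div_less mult.commute\<close>)
  finally have eq: "(\<Sum>k<n. geo (?\<omega> ^ k * r) (n * L)) = (\<Sum>j<L. smult (of_nat n * r ^ (n * j)) (X ^ (n * j)))" .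
  have hom_sum: "smult c (\<Sum>j<L. f j) = (\<Sum>j<L. smult c (f j))" for c :: complex and f
    by (induction L) (simp_all add: smult_add_right)
  have "smult (1 / of_nat n) (\<Sum>k<n. geo (?\<omega> ^ k * r) (n * L))
     = (\<Sum>j<L. smult (1 / of_nat n) (smult (of_nat n * r ^ (n * j)) (X ^ (n * j))))"
    unfolding eq by (rule hom_sum)
  also have "\<dots> = (\<Sum>j<L. (smult r X ^ n) ^ j)"
    using assms by (intro sum.cong) (auto simp: smult_power power_mult)
  finally show ?thesis .
qed


text \<open>Rickart's argument: averaging the truncated resolvents over the \<open>n\<close>-th roots of unity turns
  a lower bound for \<open>X - \<mu>\<close> on the whole circle into a bound, uniform in \<open>n\<close>, which forces the
  powers of \<open>X\<close> to decay too fast.\<close>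

lemma no_uniform_lower_bound:
  assumes \<rho>0: "0 \<le> \<rho>" and low: "\<And>n. \<rho> ^ n \<le> \<nu> (X ^ n)"
    and growth: "\<And>R. \<rho> < R \<Longrightarrow> \<exists>C. \<forall>n. \<nu> (X ^ n) \<le> C * R ^ n"
    and \<delta>: "0 < \<delta>"
    and lb: "\<And>\<mu> p. cmod \<mu> = \<rho> \<Longrightarrow> \<delta> * \<nu> p \<le> \<nu> ([:- \<mu>, 1:] * p)"
  shows False
proof (cases "\<rho> = 0")
  case True
  \<comment> \<open>The circle is the single point 0, where dividing by \<mu> is impossible; the
    lower bound at 0 contradicts the decay of the powers directly.\<close>
  have lower: "\<delta> ^ n \<le> \<nu> (X ^ n)" for n
  proof (induction n)
    case (Suc n)
    have "\<delta> ^ Suc n \<le> \<delta> * \<nu> (X ^ n)" using Suc \<delta> by simp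
    also have "\<dots> \<le> \<nu> ([:- 0, 1:] * X ^ n)" using lb[of 0 "X ^ n"] True by simp
    also have "\<dots> = \<nu> (X ^ Suc n)" by (simp add: X_def)
    finally show ?case .
  qed (simp add: one)
  have "\<exists>C. \<forall>n. \<nu> (X ^ n) \<le> C * (\<delta> / 2) ^ n"
    by (rule growth) (use True \<delta> in simp)
  then obtain C where C: "\<And>n. \<nu> (X ^ n) \<le> C * (\<delta> / 2) ^ n" by blast
  have "\<delta> \<le> \<delta> / 2"
    by (rule power_le_const_mult_power[OF _ order_trans[OF lower C]]) (use \<delta> in simp)
  then show False using \<delta> by simp
next
  case False
  then have \<rho>: "\<rho> > 0" using \<rho>0 by simp
  define a where "a = \<delta> / 2"
  have a: "a > 0" using \<delta> by (simp add: a_def)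
  define \<kappa> where "\<kappa> = (\<rho> + a) / a"
  have \<kappa>0: "\<kappa> > 0" using \<rho> a by (simp add: \<kappa>_def)
  \<comment> \<open>Replacing \<mu> by its radial projection onto the circle costs at most
    \<open>a\<close>, half of \<delta>. The annulus is needed because the truncation errors vanish
    only strictly outside the circle.\<close>
  have lb_a: "a * \<nu> p \<le> \<nu> ([:- \<mu>, 1:] * p)" if \<mu>: "\<rho> \<le> cmod \<mu>" "cmod \<mu> \<le> \<rho> + a" for \<mu> p
  proof -
    have m0: "\<mu> \<noteq> 0" using \<mu> \<rho> by auto
    define \<mu>' where "\<mu>' = (\<rho> / cmod \<mu>) *\<^sub>R \<mu>"
    have n1: "cmod \<mu>' = \<rho>" using m0 \<rho> by (simp add: \<mu>'_def)
    have "\<mu>' - \<mu> = (\<rho> / cmod \<mu> - 1) *\<^sub>R \<mu>" by (simp add: \<mu>'_def algebra_simps)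
    then have "cmod (\<mu>' - \<mu>) = \<bar>\<rho> / cmod \<mu> - 1\<bar> * cmod \<mu>" by simp
    also have "\<dots> = cmod \<mu> - \<rho>" using \<mu> \<rho> m0 by (simp add: abs_if field_simps)
    finally have n2: "cmod (\<mu>' - \<mu>) \<le> a" using \<mu> by simp
    have "2 * a * \<nu> p \<le> \<nu> ([:- \<mu>', 1:] * p)" using lb[OF n1, of p] by (simp add: a_def)
    also have "[:- \<mu>', 1:] * p = [:- \<mu>, 1:] * p - smult (\<mu>' - \<mu>) p"
      by (simp add: algebra_simps smult_diff_left)
    also have "\<nu> \<dots> \<le> \<nu> ([:- \<mu>, 1:] * p) + cmod (\<mu>' - \<mu>) * \<nu> p"
      using diff[of "[:- \<mu>, 1:] * p" "smult (\<mu>' - \<mu>) p"] smult[of "\<mu>' - \<mu>" p] by linarith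
    also have "\<dots> \<le> \<nu> ([:- \<mu>, 1:] * p) + a * \<nu> p"
      using n2 nonneg[of p] by (intro add_left_mono mult_right_mono)
    finally show ?thesis by (simp add: algebra_simps)
  qed
  have lbz: "\<nu> p \<le> \<kappa> * \<nu> ((1 - smult z X) * p)"
    if z: "z \<noteq> 0" "\<rho> \<le> 1 / cmod z" "1 / cmod z \<le> \<rho> + a" for z p
  proof -
    have e: "[:- (1 / z), 1:] = smult (- 1 / z) (1 - smult z X)"
      using z by (simp add: X_def one_pCons)
    have "a * \<nu> p \<le> \<nu> ([:- (1 / z), 1:] * p)"
      using z by (intro lb_a) (auto simp: norm_divide)
    also have "\<dots> = \<nu> (smult (- 1 / z) ((1 - smult z X) * p))"
      by (subst e) simp
    also have "\<dots> \<le> (1 / cmod z) * \<nu> ((1 - smult z X) * p)"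
      using smult[of "- 1 / z"] by (simp add: norm_divide)
    also have "\<dots> \<le> (\<rho> + a) * \<nu> ((1 - smult z X) * p)"
      using z nonneg by (intro mult_right_mono) auto
    finally show ?thesis using a by (simp add: \<kappa>_def field_simps)
  qed
  \<comment> \<open>Bound for the truncation error of \<open>geo z m\<close> with
    \<open>cmod z = r\<close>.\<close>
  define e where "e m r = r ^ m * \<nu> (X ^ m)" for m :: nat and r :: real
  have e_le: "\<nu> (smult z X ^ m) \<le> e m (cmod z)" for z m
    using smult[of "z ^ m" "X ^ m"] by (simp add: e_def smult_power norm_power)
  have e0: "(\<lambda>m. e m (1 / R)) \<longlonglongrightarrow> 0" if R: "\<rho> < R" for R
  proof -
    obtain C where C: "\<And>n. \<nu> (X ^ n) \<le> C * ((\<rho> + R) / 2) ^ n"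
      using growth[of "(\<rho> + R) / 2"] R by auto
    have C0: "0 \<le> C" using C[of 0] one by simp
    show ?thesis
    proof (rule tendsto_sandwich[of "\<lambda>_. 0" _ _ "\<lambda>m. C * (((\<rho> + R) / 2) / R) ^ m"])
      show "\<forall>\<^sub>F m in sequentially. 0 \<le> e m (1 / R)"
        using R \<rho> nonneg by (simp add: e_def)
      show "\<forall>\<^sub>F m in sequentially. e m (1 / R) \<le> C * (((\<rho> + R) / 2) / R) ^ m"
      proof (intro always_eventually allI)
        fix m
        have "e m (1 / R) \<le> (1 / R) ^ m * (C * ((\<rho> + R) / 2) ^ m)"
          unfolding e_def using C R \<rho> by (intro mult_left_mono) auto
        then show "e m (1 / R) \<le> C * (((\<rho> + R) / 2) / R) ^ m"
          by (simp add: power_divide mult_ac)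
      qed
      have "(\<lambda>m. (((\<rho> + R) / 2) / R) ^ m) \<longlonglongrightarrow> 0"
        using R \<rho> by (intro LIMSEQ_power_zero) auto
      then show "(\<lambda>m. C * (((\<rho> + R) / 2) / R) ^ m) \<longlonglongrightarrow> 0"
        by (intro tendsto_mult_right_zero)
    qed simp
  qed
  \<comment> \<open>Resolvent identity: after multiplication by both factors
    \<open>1 - smult z X\<close> and \<open>1 - smult z' X\<close>, only
    \<open>smult (z - z') X\<close> and truncation errors remain. Removing each factor costs
    \<kappa>.\<close>
  have geo_diff: "\<nu> (geo z m - geo z' m) \<le>
      \<kappa>\<^sup>2 * (cmod (z - z') * \<nu> X + (1 + cmod z' * \<nu> X) * e m (cmod z) + (1 + cmod z * \<nu> X) * e m (cmod z'))"
    if z: "z \<noteq> 0" "\<rho> \<le> 1 / cmod z" "1 / cmod z \<le> \<rho> + a"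
      and z': "z' \<noteq> 0" "\<rho> \<le> 1 / cmod z'" "1 / cmod z' \<le> \<rho> + a" for z z' m
  proof -
    let ?S = "\<lambda>z. smult z X"
    have bd: "\<nu> (1 - ?S z) \<le> 1 + cmod z * \<nu> X" for z
      using diff[of 1 "?S z"] smult[of z X] one by simp
    have "(1 - ?S z) * ((1 - ?S z') * (geo z m - geo z' m))
        = (1 - ?S z') * ((1 - ?S z) * geo z m) - (1 - ?S z) * ((1 - ?S z') * geo z' m)"
      by (simp only: right_diff_distrib mult.left_commute)
    also have "\<dots> = (1 - ?S z') * (1 - ?S z ^ m) - (1 - ?S z) * (1 - ?S z' ^ m)"
      by (simp only: geo_mult)
    also have "\<dots> = (?S (z - z') - (1 - ?S z') * ?S z ^ m) + (1 - ?S z) * ?S z' ^ m"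
      unfolding smult_diff_left by algebra
    finally have eq: "(1 - ?S z) * ((1 - ?S z') * (geo z m - geo z' m)) = \<dots>" .
    have "\<nu> (geo z m - geo z' m) \<le> \<kappa> * \<nu> ((1 - ?S z') * (geo z m - geo z' m))"
      using z' by (rule lbz)
    also have "\<dots> \<le> \<kappa> * (\<kappa> * \<nu> ((1 - ?S z) * ((1 - ?S z') * (geo z m - geo z' m))))"
      using lbz[OF z] \<kappa>0 by (intro mult_left_mono) auto
    also have "\<dots> = \<kappa>\<^sup>2 * \<nu> ((?S (z - z') - (1 - ?S z') * ?S z ^ m) + (1 - ?S z) * ?S z' ^ m)"
      by (simp add: eq power2_eq_square)
    also have "\<dots> \<le> \<kappa>\<^sup>2 * (cmod (z - z') * \<nu> X + (1 + cmod z' * \<nu> X) * e m (cmod z)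
        + (1 + cmod z * \<nu> X) * e m (cmod z'))"
    proof (rule mult_left_mono)
      have "\<nu> ((1 - ?S z') * ?S z ^ m) \<le> (1 + cmod z' * \<nu> X) * e m (cmod z)"
        using nonneg by (intro order_trans[OF mult] mult_mono bd e_le add_nonneg_nonneg mult_nonneg_nonneg) auto
      moreover have "\<nu> ((1 - ?S z) * ?S z' ^ m) \<le> (1 + cmod z * \<nu> X) * e m (cmod z')"
        using nonneg by (intro order_trans[OF mult] mult_mono bd e_le add_nonneg_nonneg mult_nonneg_nonneg) auto
      ultimately show "\<nu> ((?S (z - z') - (1 - ?S z') * ?S z ^ m) + (1 - ?S z) * ?S z' ^ m)
        \<le> cmod (z - z') * \<nu> X + (1 + cmod z' * \<nu> X) * e m (cmod z) + (1 + cmod z * \<nu> X) * e m (cmod z')"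
        using add[of "?S (z - z') - (1 - ?S z') * ?S z ^ m" "(1 - ?S z) * ?S z' ^ m"]
          diff[of "?S (z - z')" "(1 - ?S z') * ?S z ^ m"] smult[of "z - z'" X] by linarith
    qed simp
    finally show ?thesis .
  qed
  define H where "H n L r = (\<Sum>j<L. (smult (of_real r) X ^ n) ^ j)" for n L :: nat and r :: real
  \<comment> \<open>The Lipschitz bound passes through the average unchanged; its first term does
    not depend on n, and the others vanish as L grows.\<close>
  have H_diff: "\<nu> (H n L (1 / R) - H n L (1 / R')) \<le>
      \<kappa>\<^sup>2 * (\<bar>1 / R - 1 / R'\<bar> * \<nu> X + (1 + 1 / R' * \<nu> X) * e (n * L) (1 / R) + (1 + 1 / R * \<nu> X) * e (n * L) (1 / R'))"
    (is "_ \<le> ?B")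
    if n: "n \<ge> 1" and R: "\<rho> < R" "R \<le> \<rho> + a" and R': "\<rho> < R'" "R' \<le> \<rho> + a" for n L R R'
  proof -
    let ?w = "\<lambda>k. cis (2 * pi / n) ^ k"
    have cw: "cmod (?w k * of_real r) = \<bar>r\<bar>" for k r by (simp add: norm_mult norm_power)
    have RR: "R > 0" "R' > 0" using R R' \<rho> by auto
    have "H n L (1 / R) - H n L (1 / R') = smult (1 / of_nat n)
        (\<Sum>k<n. geo (?w k * of_real (1 / R)) (n * L) - geo (?w k * of_real (1 / R')) (n * L))"
      unfolding H_def geo_average[OF n, symmetric] by (simp add: smult_diff_right sum_subtractf)
    then have "\<nu> (H n L (1 / R) - H n L (1 / R')) \<le> (1 / n) *
        \<nu> (\<Sum>k<n. geo (?w k * of_real (1 / R)) (n * L) - geo (?w k * of_real (1 / R')) (n * L))"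
      using smult[of "1 / of_nat n"] by (simp add: norm_divide)
    also have "\<dots> \<le> (1 / n) * (\<Sum>k<n. ?B)"
    proof (intro mult_left_mono order_trans[OF sum] sum_mono)
      fix k
      have "?w k * of_real (1 / R) - ?w k * of_real (1 / R') = ?w k * of_real (1 / R - 1 / R')"
        by (simp add: algebra_simps)
      then have "cmod (?w k * of_real (1 / R) - ?w k * of_real (1 / R')) = \<bar>1 / R - 1 / R'\<bar>"
        by (simp only: cw)
      then show "\<nu> (geo (?w k * of_real (1 / R)) (n * L) - geo (?w k * of_real (1 / R')) (n * L)) \<le> ?B"
        using geo_diff[of "?w k * of_real (1 / R)" "?w k * of_real (1 / R')" "n * L"] R R' RR
        by (simp add: cw del: of_real_divide)
    qed auto
    also have "\<dots> = ?B" using n by simp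
    finally show ?thesis .
  qed
  \<comment> \<open>R is fixed before n, so close to \<rho> that the Lipschitz term stays below 1/8
    for every n. Then n is chosen with \<open>(X / R) ^ n\<close> below 1/9, and the geometric
    series leaves H within 1/8 of 1.\<close>
  obtain R where R: "\<rho> < R" "R \<le> \<rho> + a" and R_small: "\<kappa>\<^sup>2 * ((R - \<rho>) / \<rho>\<^sup>2) * \<nu> X \<le> 1 / 8"
  proof
    define h where "h = min a (1 / (8 * (\<kappa>\<^sup>2 * \<nu> X + 1)) * \<rho>\<^sup>2)"
    have k: "\<kappa>\<^sup>2 * \<nu> X \<ge> 0" using nonneg by simp
    have h0: "h > 0" unfolding h_def using a \<rho> k by (auto intro!: mult_pos_pos divide_pos_pos)
    then show "\<rho> < \<rho> + h" by simp
    show "\<rho> + h \<le> \<rho> + a" by (simp add: h_def)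
    have "h / \<rho>\<^sup>2 \<le> 1 / (8 * (\<kappa>\<^sup>2 * \<nu> X + 1))" using \<rho> by (simp add: h_def divide_le_eq)
    then have "\<kappa>\<^sup>2 * \<nu> X * (h / \<rho>\<^sup>2) \<le> \<kappa>\<^sup>2 * \<nu> X * (1 / (8 * (\<kappa>\<^sup>2 * \<nu> X + 1)))"
      using k by (intro mult_left_mono)
    also have "\<dots> \<le> 1 / 8" using k by (simp add: divide_simps)
    finally show "\<kappa>\<^sup>2 * ((\<rho> + h - \<rho>) / \<rho>\<^sup>2) * \<nu> X \<le> 1 / 8" by (simp add: algebra_simps)
  qed
  have "eventually (\<lambda>n. e n (1 / R) < 1 / 9) sequentially"
    using e0[OF R(1)] by (rule order_tendstoD) simp
  moreover have "eventually (\<lambda>n. n \<ge> (1::nat)) sequentially" by (rule eventually_ge_at_top)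
  ultimately have "eventually (\<lambda>n. e n (1 / R) < 1 / 9 \<and> n \<ge> 1) sequentially"
    by (rule eventually_conj)
  then obtain n where n: "e n (1 / R) < 1 / 9" "n \<ge> 1"
    using eventually_happens'[OF sequentially_bot] by blast
  have R0: "R > 0" using R \<rho> by simp
  have HR: "\<nu> (H n L (1 / R) - 1) \<le> 1 / 8" if L: "L \<ge> 1" for L
  proof -
    let ?Y = "smult (of_real (1 / R)) X ^ n"
    have "\<nu> ?Y \<le> e n (1 / R)" using e_le[of "of_real (1 / R)" n] R0 by (simp add: norm_divide)
    then have Y: "\<nu> ?Y \<le> 1 / 9" using n by simp
    have "H n L (1 / R) - 1 = (\<Sum>j<L - 1. ?Y ^ Suc j)"
      unfolding H_def using L by (cases L) (auto simp: sum.lessThan_Suc_shift simp del: sum.lessThan_Suc)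
    then have "\<nu> (H n L (1 / R) - 1) \<le> (\<Sum>j<L - 1. \<nu> (?Y ^ Suc j))" by (simp only: sum finite_lessThan)
    also have "\<dots> \<le> (\<Sum>j<L - 1. (1 / 9) ^ Suc j)"
      by (rule sum_mono) (rule order_trans[OF power power_mono[OF Y nonneg]])
    also have "\<dots> = (1 / 9) * (\<Sum>j<L - 1. (1 / 9) ^ j)" by (simp add: sum_distrib_left)
    also have "\<dots> \<le> (1 / 9) * (9 / 8)" by (intro mult_left_mono) (auto simp: sum_gp_strict)
    finally show ?thesis by simp
  qed
  \<comment> \<open>R and n are already fixed; only the truncation length L depends on R'. This is
    what allows R' to tend to \<rho> afterwards with n unchanged.\<close>
  have claim: "\<nu> (X ^ n) \<le> 4 / 5 * R' ^ n" if R': "\<rho> < R'" "R' \<le> R" for R'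
  proof -
    have R'0: "R' > 0" using R' \<rho> by simp
    have sub: "strict_mono (\<lambda>L. n * L)" using n by (auto simp: strict_mono_def)
    have t1: "(\<lambda>L. e (n * L) (1 / R)) \<longlonglongrightarrow> 0"
      using LIMSEQ_subseq_LIMSEQ[OF e0[OF R(1)] sub] by (simp add: o_def)
    have t2: "(\<lambda>L. e (n * L) (1 / R')) \<longlonglongrightarrow> 0"
      using LIMSEQ_subseq_LIMSEQ[OF e0[OF R'(1)] sub] by (simp add: o_def)
    have "(\<lambda>L. \<kappa>\<^sup>2 * ((1 + 1 / R' * \<nu> X) * e (n * L) (1 / R) + (1 + 1 / R * \<nu> X) * e (n * L) (1 / R')))
        \<longlonglongrightarrow> \<kappa>\<^sup>2 * ((1 + 1 / R' * \<nu> X) * 0 + (1 + 1 / R * \<nu> X) * 0)"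
      by (intro tendsto_intros t1 t2)
    then have "eventually (\<lambda>L. \<kappa>\<^sup>2 * ((1 + 1 / R' * \<nu> X) * e (n * L) (1 / R)
        + (1 + 1 / R * \<nu> X) * e (n * L) (1 / R')) < 1 / 8) sequentially"
      by (intro order_tendstoD) auto
    moreover have "eventually (\<lambda>L. e (n * L) (1 / R') < 1 / 8) sequentially"
      using t2 by (rule order_tendstoD) simp
    moreover have "eventually (\<lambda>L. L \<ge> (1::nat)) sequentially" by (rule eventually_ge_at_top)
    ultimately have "eventually (\<lambda>L. \<kappa>\<^sup>2 * ((1 + 1 / R' * \<nu> X) * e (n * L) (1 / R)
        + (1 + 1 / R * \<nu> X) * e (n * L) (1 / R')) < 1 / 8 \<and> e (n * L) (1 / R') < 1 / 8 \<and> L \<ge> 1) sequentially"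
      by (intro eventually_conj)
    then obtain L where L: "\<kappa>\<^sup>2 * ((1 + 1 / R' * \<nu> X) * e (n * L) (1 / R)
        + (1 + 1 / R * \<nu> X) * e (n * L) (1 / R')) < 1 / 8" "e (n * L) (1 / R') < 1 / 8" "L \<ge> 1"
      using eventually_happens'[OF sequentially_bot] by blast
    have "\<bar>1 / R - 1 / R'\<bar> = (R - R') / (R * R')" using R0 R'0 R' by (simp add: abs_if field_simps)
    also have "\<dots> \<le> (R - \<rho>) / \<rho>\<^sup>2"
      unfolding power2_eq_square using R R' \<rho> by (intro frac_le mult_mono) auto
    finally have "\<kappa>\<^sup>2 * (\<bar>1 / R - 1 / R'\<bar> * \<nu> X) \<le> \<kappa>\<^sup>2 * ((R - \<rho>) / \<rho>\<^sup>2 * \<nu> X)"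
      using nonneg by (intro mult_left_mono mult_right_mono) auto
    then have small: "\<kappa>\<^sup>2 * (\<bar>1 / R - 1 / R'\<bar> * \<nu> X) \<le> 1 / 8" using R_small by (simp only: mult.assoc)
    have "\<nu> (H n L (1 / R) - H n L (1 / R')) \<le> \<kappa>\<^sup>2 * (\<bar>1 / R - 1 / R'\<bar> * \<nu> X)
        + \<kappa>\<^sup>2 * ((1 + 1 / R' * \<nu> X) * e (n * L) (1 / R) + (1 + 1 / R * \<nu> X) * e (n * L) (1 / R'))"
      using H_diff[OF n(2) R R'(1), of L] R' R by (simp only: distrib_left add.assoc)
    then have "\<nu> (H n L (1 / R) - H n L (1 / R')) \<le> 1 / 4" using small L by linarith
    then have HH: "\<nu> (H n L (1 / R') - 1) \<le> 3 / 8"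
      using HR[OF L(3)] diff[of "H n L (1 / R) - 1" "H n L (1 / R) - H n L (1 / R')"] by simp
    define Y where "Y = smult (of_real (1 / R')) X ^ n"
    have "(1 - Y) * H n L (1 / R') = 1 - Y ^ L"
      unfolding H_def Y_def[symmetric] by (rule one_diff_power_eq[symmetric])
    \<comment> \<open>Writing D for \<open>H n L (1 / R') - 1\<close>, this is Y = D + Y^L - Y D.
      The bounds 3/8 for D and 1/8 for Y^L give \<nu> Y \<le> 1/2 + 3/8 \<nu> Y, hence 4/5.\<close>
    then have "Y = (H n L (1 / R') - 1 + Y ^ L) - Y * (H n L (1 / R') - 1)"
      by (simp add: algebra_simps)
    then have "\<nu> Y \<le> \<nu> (H n L (1 / R') - 1 + Y ^ L) + \<nu> (Y * (H n L (1 / R') - 1))"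
      by (metis diff)
    also have "\<dots> \<le> \<nu> (H n L (1 / R') - 1) + \<nu> (Y ^ L) + \<nu> Y * \<nu> (H n L (1 / R') - 1)"
      by (intro add_mono add mult)
    also have "\<dots> \<le> 3 / 8 + 1 / 8 + \<nu> Y * (3 / 8)"
    proof (intro add_mono mult_left_mono HH nonneg)
      have "\<nu> (Y ^ L) \<le> e (n * L) (1 / R')"
        using e_le[of "of_real (1 / R')" "n * L"] R'0 by (simp add: Y_def power_mult norm_divide)
      then show "\<nu> (Y ^ L) \<le> 1 / 8" using L by simp
    qed
    finally have Y: "\<nu> Y \<le> 4 / 5" by simp
    have "X ^ n = smult (of_real (R' ^ n)) Y"
      using R'0 by (simp add: Y_def smult_power power_divide)
    then have "\<nu> (X ^ n) \<le> R' ^ n * \<nu> Y" using smult[of "of_real (R' ^ n)" Y] R'0 by (simp add: norm_power)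
    also have "\<dots> \<le> R' ^ n * (4 / 5)" using Y R'0 by (intro mult_left_mono) auto
    finally show ?thesis by simp
  qed
  have "\<nu> (X ^ n) \<le> 4 / 5 * \<rho> ^ n"
  proof (rule tendsto_lowerbound[of "\<lambda>r. 4 / 5 * r ^ n" _ "at_right \<rho>"])
    show "((\<lambda>r. 4 / 5 * r ^ n) \<longlongrightarrow> 4 / 5 * \<rho> ^ n) (at_right \<rho>)" by (intro tendsto_intros)
    show "eventually (\<lambda>r. \<nu> (X ^ n) \<le> 4 / 5 * r ^ n) (at_right \<rho>)"
      unfolding eventually_at_right_field by (intro exI[of _ R]) (use R claim in auto)
  qed simp
  moreover have "\<rho> ^ n > 0" using \<rho> by simp
  ultimately show False using low[of n] by simp
qed

text \<open>The preceding lemma gives a \<mu> for each \<delta>; compactness of the circle makes one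
  \<mu> serve all of them, since moving \<mu> changes the factor only by a small multiple of
  p.\<close>

lemma exists_approx_root:
  assumes \<rho>0: "0 \<le> \<rho>" and low: "\<And>n. \<rho> ^ n \<le> \<nu> (X ^ n)"
    and growth: "\<And>R. \<rho> < R \<Longrightarrow> \<exists>C. \<forall>n. \<nu> (X ^ n) \<le> C * R ^ n"
  shows "\<exists>\<mu>. cmod \<mu> = \<rho> \<and> (\<forall>\<delta>>0. \<exists>p. \<nu> ([:- \<mu>, 1:] * p) < \<delta> * \<nu> p)"
proof -
  have "\<exists>\<mu> p. cmod \<mu> = \<rho> \<and> \<nu> ([:- \<mu>, 1:] * p) < \<delta> * \<nu> p" if "\<delta> > 0" for \<delta>
    using no_uniform_lower_bound[OF \<rho>0 low growth that] by (meson not_le)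
  then have "\<exists>\<mu> p. cmod \<mu> = \<rho> \<and> \<nu> ([:- \<mu>, 1:] * p) < 1 / real (Suc n) * \<nu> p" for n
    by (metis divide_pos_pos of_nat_0_less_iff zero_less_Suc zero_less_one)
  then obtain \<mu> p where \<mu>: "\<And>n. cmod (\<mu> n) = \<rho>"
    and p: "\<And>n. \<nu> ([:- \<mu> n, 1:] * p n) < 1 / real (Suc n) * \<nu> (p n)" by metis
  have "compact (sphere 0 \<rho> :: complex set)" by simp
  then obtain l s where l: "l \<in> sphere 0 \<rho>" and s: "strict_mono s" "(\<mu> \<circ> s) \<longlonglongrightarrow> l"
    using \<mu> unfolding compact_def by (metis mem_sphere_0)
  show ?thesis
  proof (intro exI[of _ l] conjI allI impI)
    show "cmod l = \<rho>" using l by simp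
    fix \<delta> :: real assume \<delta>: "\<delta> > 0"
    have "eventually (\<lambda>n. dist ((\<mu> \<circ> s) n) l < \<delta> / 2) sequentially"
      using tendstoD[OF s(2), of "\<delta> / 2"] \<delta> by simp
    moreover have "(\<lambda>n. 1 / real (Suc (s n))) \<longlonglongrightarrow> 0"
      using LIMSEQ_subseq_LIMSEQ[OF LIMSEQ_Suc[OF lim_1_over_n] s(1)] by (simp add: o_def)
    then have "eventually (\<lambda>n. 1 / real (Suc (s n)) < \<delta> / 2) sequentially"
      by (rule order_tendstoD) (use \<delta> in simp)
    ultimately have "eventually (\<lambda>n. dist ((\<mu> \<circ> s) n) l < \<delta> / 2 \<and> 1 / real (Suc (s n)) < \<delta> / 2) sequentially"
      by (rule eventually_conj)
    then obtain n where n: "cmod (\<mu> (s n) - l) < \<delta> / 2" "1 / real (Suc (s n)) < \<delta> / 2"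
      using eventually_happens'[OF sequentially_bot] unfolding dist_norm o_def by blast
    let ?p = "p (s n)"
    have "[:- l, 1:] * ?p = [:- \<mu> (s n), 1:] * ?p + smult (\<mu> (s n) - l) ?p"
      by (simp add: algebra_simps smult_diff_left)
    then have "\<nu> ([:- l, 1:] * ?p) \<le> \<nu> ([:- \<mu> (s n), 1:] * ?p) + cmod (\<mu> (s n) - l) * \<nu> ?p"
      using add[of "[:- \<mu> (s n), 1:] * ?p" "smult (\<mu> (s n) - l) ?p"] smult[of "\<mu> (s n) - l" ?p]
      by (simp del: mult_pCons_left)
    also have "\<dots> < 1 / real (Suc (s n)) * \<nu> ?p + cmod (\<mu> (s n) - l) * \<nu> ?p"
      using p[of "s n"] by (simp del: mult_pCons_left)
    also have "\<dots> \<le> \<delta> / 2 * \<nu> ?p + \<delta> / 2 * \<nu> ?p"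
      using n nonneg by (intro add_mono mult_right_mono) auto
    finally show "\<exists>p. \<nu> ([:- l, 1:] * p) < \<delta> * \<nu> p" by (auto intro!: exI[of _ ?p])
  qed
qed

end

section \<open>Hilbert space preliminaries\<close>

lemma cinner_scaleC_right: "cinner x (c *\<^sub>C y) = cnj c * cinner x (y :: 'a::complex_inner)"
  using cinner_commute[of x "c *\<^sub>C y"] cinner_commute[of x y] by (simp add: cinner_scaleC_left)

lemma Im_cinner: "Im (cinner x y) = inner x (\<i> *\<^sub>C (y :: 'a::complex_inner))"
  by (simp add: inner_eq_Re_cinner cinner_scaleC_right)

lemma cinner_eq_inner: "cinner x y = Complex (inner x y) (inner x (\<i> *\<^sub>C (y :: 'a::complex_inner)))"
  by (simp add: complex_eq_iff Im_cinner inner_eq_Re_cinner)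

lemma inner_scaleC_left: "inner (c *\<^sub>C x) y = inner x (cnj c *\<^sub>C (y :: 'a::complex_inner))"
  by (simp add: inner_eq_Re_cinner cinner_scaleC_right cinner_scaleC_left)

lemma norm_scaleC: "norm (c *\<^sub>C x) = cmod c * norm (x :: 'a::complex_inner)"
proof -
  have "(norm (c *\<^sub>C x))\<^sup>2 = inner x ((cnj c * c) *\<^sub>C x)"
    unfolding power2_norm_eq_inner inner_scaleC_left scaleC_scaleC ..
  also have "cnj c * c = complex_of_real ((cmod c)\<^sup>2)"
    by (metis complex_norm_square mult.commute)
  also have "inner x (complex_of_real ((cmod c)\<^sup>2) *\<^sub>C x) = (cmod c * norm x)\<^sup>2"
    by (simp flip: scaleR_scaleC add: power2_norm_eq_inner power_mult_distrib)
  finally show ?thesis by (rule power2_eq_imp_eq) auto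
qed

lemma scaleC_scaleR: "c *\<^sub>C (r *\<^sub>R x) = r *\<^sub>R (c *\<^sub>C (x :: 'a::complex_inner))"
  by (simp add: scaleR_scaleC scaleC_scaleC mult.commute)

lemma bounded_linear_scaleC: "bounded_linear (\<lambda>x :: 'a::complex_inner. c *\<^sub>C x)"
  by (rule bounded_linear_intro[of _ "cmod c"])
    (simp_all add: scaleC_add_right scaleC_scaleR norm_scaleC mult.commute)

section \<open>Orthogonal projection, Riesz representation and adjoints\<close>

lemma orthogonal_projection_exists:
  fixes S :: "'a::{real_inner, complete_space} set"
  assumes S: "subspace S" and "closed S"
  shows "\<exists>p\<in>S. \<forall>s\<in>S. inner (x - p) s = 0"
proof -
  define d where "d = (INF s\<in>S. (norm (x - s))\<^sup>2)"
  have bdd: "bdd_below ((\<lambda>s. (norm (x - s))\<^sup>2) ` S)" by (rule bdd_belowI[of _ 0]) auto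
  have d_le: "d \<le> (norm (x - s))\<^sup>2" if "s \<in> S" for s
    unfolding d_def by (rule cINF_lower[OF bdd that])
  have ne: "S \<noteq> {}" using subspace_0[OF S] by auto
  have "\<exists>s\<in>S. (norm (x - s))\<^sup>2 < d + 1 / real (Suc n)" for n
    using cINF_less_iff[OF ne bdd, of "d + 1 / real (Suc n)"] unfolding d_def[symmetric] by simp
  then obtain s where sS: "\<And>n. s n \<in> S" and s: "\<And>n. (norm (x - s n))\<^sup>2 < d + 1 / real (Suc n)" by metis
  have est: "(norm (s m - s n))\<^sup>2 \<le> 2 / real (Suc m) + 2 / real (Suc n)" for m n
  proof -
    have mid: "(1/2) *\<^sub>R (s m + s n) \<in> S"
      using sS S by (intro subspace_scale subspace_add)
    have "(norm (s m - s n))\<^sup>2 = 2 * (norm (x - s m))\<^sup>2 + 2 * (norm (x - s n))\<^sup>2 - 4 * (norm (x - (1/2) *\<^sub>R (s m + s n)))\<^sup>2"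
      by (simp add: power2_norm_eq_inner inner_simps inner_commute algebra_simps)
    also have "\<dots> \<le> 2 * (d + 1 / real (Suc m)) + 2 * (d + 1 / real (Suc n)) - 4 * d"
      by (intro diff_mono add_mono mult_left_mono less_imp_le[OF s] d_le[OF mid]) auto
    finally show ?thesis by simp
  qed
  have "Cauchy s"
  proof (rule metric_CauchyI)
    fix e :: real assume e: "e > 0"
    obtain N where N: "1 / real (Suc N) < e\<^sup>2 / 4" using reals_Archimedean[of "e\<^sup>2 / 4"] e
      by (auto simp: inverse_eq_divide)
    have "dist (s m) (s n) < e" if mn: "m \<ge> N" "n \<ge> N" for m n
    proof -
      have "1 / real (Suc m) \<le> 1 / real (Suc N)" "1 / real (Suc n) \<le> 1 / real (Suc N)"
        using mn by (auto intro!: divide_left_mono)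
      then have "(norm (s m - s n))\<^sup>2 < e\<^sup>2" using est[of m n] N by simp
      then show ?thesis using e by (simp add: dist_norm power_less_imp_less_base)
    qed
    then show "\<exists>M. \<forall>m\<ge>M. \<forall>n\<ge>M. dist (s m) (s n) < e" by blast
  qed
  then obtain p where p: "s \<longlonglongrightarrow> p" using Cauchy_convergent convergent_def by blast
  have pS: "p \<in> S" using closed_sequentially[OF \<open>closed S\<close> _ p] sS by blast
  have "(\<lambda>n. (norm (x - s n))\<^sup>2) \<longlonglongrightarrow> (norm (x - p))\<^sup>2" by (intro tendsto_intros p)
  moreover have "(\<lambda>n. d + 1 / real (Suc n)) \<longlonglongrightarrow> d + 0"
    by (intro tendsto_intros LIMSEQ_Suc[OF lim_1_over_n])
  ultimately have pd: "(norm (x - p))\<^sup>2 \<le> d + 0"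
    using s by (intro LIMSEQ_le[of _ _ _ "d + 0"]) (auto intro: less_imp_le)
  have "inner (x - p) v = 0" if v: "v \<in> S" for v
  proof (cases "v = 0")
    case False
    define t where "t = inner (x - p) v / (norm v)\<^sup>2"
    have "p + t *\<^sub>R v \<in> S" using pS v S by (intro subspace_add subspace_scale)
    then have "(norm (x - p))\<^sup>2 \<le> (norm (x - (p + t *\<^sub>R v)))\<^sup>2" by (rule order_trans[OF pd[simplified] d_le])
    also have "\<dots> = (norm (x - p))\<^sup>2 - 2 * t * inner (x - p) v + t\<^sup>2 * (norm v)\<^sup>2"
      unfolding power2_norm_eq_inner
      by (simp add: inner_simps inner_commute algebra_simps power2_eq_square)
    also have "\<dots> = (norm (x - p))\<^sup>2 - (inner (x - p) v)\<^sup>2 / (norm v)\<^sup>2"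
      using False by (simp add: t_def power2_eq_square)
    finally have "(inner (x - p) v)\<^sup>2 / (norm v)\<^sup>2 \<le> 0" by simp
    then show ?thesis using False by (simp add: divide_le_0_iff)
  qed simp
  then show ?thesis using pS by blast
qed

lemma riesz_representation:
  fixes f :: "'a::{real_inner, complete_space} \<Rightarrow> real"
  assumes f: "bounded_linear f"
  shows "\<exists>y. \<forall>x. f x = inner x y"
proof (cases "\<forall>x. f x = 0")
  case True
  then show ?thesis by (auto intro: exI[of _ 0])
next
  case False
  interpret bounded_linear f by (rule f)
  obtain z where z: "f z \<noteq> 0" using False by blast
  let ?S = "{x. f x = 0}"
  have "subspace ?S" by (auto simp: subspace_def add scaleR zero)
  moreover have "closed ?S"
    by (intro closed_Collect_eq continuous_intros linear_continuous_on f)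
  ultimately obtain p where p: "f p = 0" "\<And>s. f s = 0 \<Longrightarrow> inner (z - p) s = 0"
    using orthogonal_projection_exists[of ?S z] by auto
  define w where "w = z - p"
  have fw: "f w \<noteq> 0" using z p by (simp add: w_def diff)
  then have w0: "w \<noteq> 0" using zero by auto
  have "f x = inner x ((f w / (norm w)\<^sup>2) *\<^sub>R w)" for x
  proof -
    have "f (x - (f x / f w) *\<^sub>R w) = 0" using fw by (simp add: diff scaleR)
    then have "inner w (x - (f x / f w) *\<^sub>R w) = 0" unfolding w_def by (rule p(2))
    then have "inner x w = f x / f w * (norm w)\<^sup>2"
      by (simp add: inner_simps inner_commute power2_norm_eq_inner)
    then show ?thesis using fw w0 by simp
  qed
  then show ?thesis by blast
qed

lemma real_adjoint_exists:
  fixes A :: "'a::{real_inner, complete_space} \<Rightarrow>\<^sub>L 'a"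
  shows "\<exists>B :: 'a \<Rightarrow>\<^sub>L 'a. \<forall>x y. inner (A x) y = inner x (B y)"
proof -
  have "\<exists>z. \<forall>x. inner (A x) y = inner x z" for y
    by (rule riesz_representation) (intro bounded_linear_intros)
  then obtain g where g: "\<And>x y. inner (A x) y = inner x (g y)" by metis
  have eqI: "u = v" if "\<And>x. inner x u = inner x v" for u v :: 'a
  proof -
    have "inner (u - v) (u - v) = 0" using that[of "u - v"] by (subst inner_diff_right) simp
    then show ?thesis by simp
  qed
  have "bounded_linear g"
  proof (rule bounded_linear_intro[of _ "norm A"])
    show "g (u + v) = g u + g v" for u v
      by (rule eqI) (simp add: g[symmetric] inner_add_right)
    show "g (r *\<^sub>R u) = r *\<^sub>R g u" for r u
      by (rule eqI) (simp add: g[symmetric])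
    show "norm (g u) \<le> norm u * norm A" for u
    proof (cases "g u = 0")
      case False
      have "norm (g u) * norm (g u) = inner (A (g u)) u"
        by (simp add: g power2_norm_eq_inner[symmetric] power2_eq_square)
      also have "\<dots> \<le> norm (A (g u)) * norm u" by (rule norm_cauchy_schwarz)
      also have "\<dots> \<le> norm A * norm (g u) * norm u" by (intro mult_right_mono norm_blinfun) auto
      finally have "norm (g u) * norm (g u) \<le> norm (g u) * (norm u * norm A)" by (simp add: mult_ac)
      then show ?thesis using False by (simp add: mult_le_cancel_left)
    qed simp
  qed
  then show ?thesis using g by (intro exI[of _ "Blinfun g"]) (simp add: bounded_linear_Blinfun_apply)
qed

lemma complex_linearD: "complex_linear A \<Longrightarrow> blinfun_apply A (c *\<^sub>C x) = c *\<^sub>C blinfun_apply A x"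
  by (simp add: complex_linear_def)

lemma cinner_ext:
  fixes u v :: "'a::complex_inner"
  assumes "\<And>x. cinner x u = cinner x v"
  shows "u = v"
proof -
  have "inner (u - v) (u - v) = 0" using assms[of "u - v"]
    by (subst inner_diff_right) (simp add: inner_eq_Re_cinner)
  then show ?thesis by simp
qed

text \<open>The real adjoint is already the complex one: complex linearity moves \<i> across the
  real inner product, and the imaginary part of \<open>cinner x y\<close> is the real inner product
  of x with \<open>\<i> *\<^sub>C y\<close>.\<close>

lemma
  fixes A :: "'a::chilbert_space \<Rightarrow>\<^sub>L 'a"
  assumes A: "complex_linear A"
  shows cinner_adj: "cinner (A x) y = cinner x (adj A y)"
    and inner_adj: "inner (A x) y = inner x (adj A y)"
    and complex_linear_adj: "complex_linear (adj A)"
proof -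
  obtain B :: "'a \<Rightarrow>\<^sub>L 'a" where B: "\<And>x y. inner (A x) y = inner x (B y)"
    using real_adjoint_exists by blast
  have cB: "cinner (A x) y = cinner x (B y)" for x y
  proof -
    have "inner (A x) (\<i> *\<^sub>C y) = inner (A (cnj \<i> *\<^sub>C x)) y"
      by (simp only: complex_linearD[OF A] inner_scaleC_left complex_cnj_cnj)
    also have "\<dots> = inner x (\<i> *\<^sub>C B y)" by (simp only: B inner_scaleC_left complex_cnj_cnj)
    finally show ?thesis by (simp add: cinner_eq_inner B)
  qed
  have adjB: "adj A = B"
    unfolding adj_def
  proof (rule the_equality)
    fix C :: "'a \<Rightarrow>\<^sub>L 'a" assume C: "\<forall>x y. cinner (A x) y = cinner x (C y)"
    show "C = B" by (rule blinfun_eqI, rule cinner_ext) (use C cB in auto)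
  qed (use cB in auto)
  show c: "cinner (A x) y = cinner x (adj A y)" for x y unfolding adjB by (rule cB)
  show "inner (A x) y = inner x (adj A y)" unfolding adjB by (rule B)
  show "complex_linear (adj A)"
    unfolding complex_linear_def
  proof (intro allI, rule cinner_ext)
    fix k x z
    show "cinner z (adj A (k *\<^sub>C x)) = cinner z (k *\<^sub>C adj A x)"
      by (simp add: c[symmetric] cinner_scaleC_right)
  qed
qed

lemma inner_adj_left: "complex_linear A \<Longrightarrow> inner (adj A x) y = inner x (blinfun_apply A y)"
  using inner_adj[of A y x] by (simp add: inner_commute)

lemma complex_linear_id [simp]: "complex_linear id_blinfun"
  by (simp add: complex_linear_def)

lemma complex_linear_zero [simp]: "complex_linear 0"
  by (simp add: complex_linear_def)

lemma complex_linear_compose: "complex_linear A \<Longrightarrow> complex_linear B \<Longrightarrow> complex_linear (A o\<^sub>L B)"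
  by (simp add: complex_linear_def)

lemma complex_linear_add: "complex_linear A \<Longrightarrow> complex_linear B \<Longrightarrow> complex_linear (A + B)"
  by (simp add: complex_linear_def blinfun.add_left scaleC_add_right)

lemma complex_linear_scaleR: "complex_linear A \<Longrightarrow> complex_linear (r *\<^sub>R A)"
  by (simp add: complex_linear_def blinfun.scaleR_left scaleC_scaleR)

lemma complex_linear_sum: "(\<And>i. i \<in> I \<Longrightarrow> complex_linear (A i)) \<Longrightarrow> complex_linear (\<Sum>i\<in>I. A i)"
  by (induction I rule: infinite_finite_induct) (auto intro: complex_linear_add)

lemma complex_linear_lim:
  assumes "\<And>n. complex_linear (A n)" and lim: "A \<longlonglongrightarrow> B"
  shows "complex_linear B"
  unfolding complex_linear_def
proof (intro allI)
  fix c x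
  have t: "(\<lambda>n. A n y) \<longlonglongrightarrow> B y" for y by (intro tendsto_intros lim)
  have "(\<lambda>n. A n (c *\<^sub>C x)) \<longlonglongrightarrow> c *\<^sub>C B x"
    using bounded_linear.tendsto[OF bounded_linear_scaleC t[of x], of c] assms(1)
    by (simp add: complex_linear_def)
  then show "B (c *\<^sub>C x) = c *\<^sub>C B x" using LIMSEQ_unique t by blast
qed

text \<open>Uniform boundedness, by a gliding hump: steps of length \<open>3\<^sup>-\<^sup>k\<close> are chosen so
  that the later ones cannot cancel the contribution of an earlier one.\<close>

lemma weakly_bounded_imp_bounded:
  fixes z :: "nat \<Rightarrow> 'a::{real_inner, complete_space}"
  assumes weak: "\<And>x. \<exists>C. \<forall>n. \<bar>inner x (z n)\<bar> \<le> C"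
  shows "\<exists>C. \<forall>n. norm (z n) \<le> C"
proof (rule ccontr)
  assume "\<nexists>C. \<forall>n. norm (z n) \<le> C"
  then have "\<exists>n. norm (z n) > 2 * 3 ^ k * real k" for k :: nat by (meson not_le)
  then obtain m where m: "\<And>k. norm (z (m k)) > 2 * 3 ^ k * real k" by metis
  define u where "u k = (1 / (3 ^ k * norm (z (m k)))) *\<^sub>R z (m k)" for k
  have zpos: "norm (z (m k)) > 0" for k
    by (rule le_less_trans[OF _ m[of k]]) simp
  have nu: "norm (u k) = 1 / 3 ^ k" for k using zpos[of k] by (simp add: u_def)
  have uz: "inner (u k) (z (m k)) = norm (z (m k)) / 3 ^ k" for k
    using zpos[of k] by (simp add: u_def power2_norm_eq_inner[symmetric] power2_eq_square)
  \<comment> \<open>The inner products of \<open>v + u k\<close> and \<open>v - u k\<close> with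
    \<open>z (m k)\<close> differ by 2 norm / 3^k, so one of them is at least norm / 3^k in absolute
    value.\<close>
  define y where "y = rec_nat 0 (\<lambda>k v. if \<bar>inner (v + u k) (z (m k))\<bar> \<ge> norm (z (m k)) / 3 ^ k then v + u k else v - u k)"
  have y_Suc: "y (Suc k) = (if \<bar>inner (y k + u k) (z (m k))\<bar> \<ge> norm (z (m k)) / 3 ^ k then y k + u k else y k - u k)" for k
    by (simp add: y_def)
  have big: "\<bar>inner (y (Suc k)) (z (m k))\<bar> \<ge> norm (z (m k)) / 3 ^ k" for k
  proof (cases "\<bar>inner (y k + u k) (z (m k))\<bar> \<ge> norm (z (m k)) / 3 ^ k")
    case False
    then have "\<bar>inner (y k) (z (m k)) - inner (u k) (z (m k))\<bar> \<ge> norm (z (m k)) / 3 ^ k"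
      using uz[of k] by (simp add: inner_simps)
    then show ?thesis using False by (simp add: y_Suc inner_diff_left)
  qed (simp add: y_Suc)
  have step: "norm (y (Suc k) - y k) = 1 / 3 ^ k" for k using nu[of k] by (simp add: y_Suc)
  have dist_le: "norm (y (k + j) - y k) \<le> 3 / 2 * (1 / 3 ^ k - 1 / 3 ^ (k + j))" for k j
  proof (induction j)
    case (Suc j)
    have "norm (y (k + Suc j) - y k) \<le> norm (y (Suc (k + j)) - y (k + j)) + norm (y (k + j) - y k)"
      using norm_triangle_ineq[of "y (Suc (k + j)) - y (k + j)" "y (k + j) - y k"] by simp
    also have "\<dots> \<le> 1 / 3 ^ (k + j) + 3 / 2 * (1 / 3 ^ k - 1 / 3 ^ (k + j))"
      using Suc step[of "k + j"] by simp
    also have "\<dots> = 3 / 2 * (1 / 3 ^ k - 1 / 3 ^ (k + Suc j))" by (simp add: field_simps)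
    finally show ?case .
  qed simp
  have dist_le': "norm (y (k + j) - y k) \<le> 3 / 2 * (1 / 3 ^ k)" for k j
    by (rule order_trans[OF dist_le]) (simp add: mult_le_cancel_left)
  have "Cauchy y"
  proof (rule metric_CauchyI)
    fix e :: real assume e: "e > 0"
    have "(\<lambda>k. 3 * (1 / 3) ^ k :: real) \<longlonglongrightarrow> 3 * 0" by (intro tendsto_intros LIMSEQ_power_zero) simp
    then have "eventually (\<lambda>k. 3 * (1 / 3) ^ k < e) sequentially" using e by (intro order_tendstoD) auto
    then obtain N where N: "3 * (1 / 3) ^ N < e" by (auto simp: eventually_sequentially)
    have "dist (y i) (y j) < e" if "i \<ge> N" "j \<ge> N" for i j
    proof -
      have "norm (y i - y N) \<le> 3 / 2 * (1 / 3 ^ N)" "norm (y j - y N) \<le> 3 / 2 * (1 / 3 ^ N)"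
        using dist_le'[of N "i - N"] dist_le'[of N "j - N"] that by auto
      then have "norm (y i - y j) \<le> 3 * (1 / 3) ^ N"
        using norm_triangle_ineq4[of "y i - y N" "y j - y N"] by (simp add: power_divide)
      then show ?thesis using N by (simp add: dist_norm)
    qed
    then show "\<exists>M. \<forall>m\<ge>M. \<forall>n\<ge>M. dist (y m) (y n) < e" by blast
  qed
  then obtain x where x: "y \<longlonglongrightarrow> x" using Cauchy_convergent convergent_def by blast
  have x_dist: "norm (x - y k) \<le> 3 / 2 * (1 / 3 ^ k)" for k
  proof (rule LIMSEQ_le_const2)
    show "(\<lambda>j. norm (y (j + k) - y k)) \<longlonglongrightarrow> norm (x - y k)"
      by (intro tendsto_intros LIMSEQ_ignore_initial_segment x)
  qed (use dist_le'[of k] in \<open>auto simp: add.commute\<close>)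
  obtain C where C: "\<And>n. \<bar>inner x (z n)\<bar> \<le> C" using weak by blast
  have "real k \<le> C" for k
  proof -
    let ?z = "z (m k)"
    \<comment> \<open>The steps after the k-th have total length at most 3/2 * 3^-(k+1), half of
      3^-k. Half of the contribution survives, which explains the factor 2 in the choice of
      m.\<close>
    have "\<bar>inner (x - y (Suc k)) ?z\<bar> \<le> norm (x - y (Suc k)) * norm ?z" by (rule Cauchy_Schwarz_ineq2)
    also have "\<dots> \<le> 3 / 2 * (1 / 3 ^ Suc k) * norm ?z" by (intro mult_right_mono x_dist) auto
    finally have "\<bar>inner (x - y (Suc k)) ?z\<bar> \<le> norm ?z / 3 ^ k / 2" by simp
    then have "\<bar>inner x ?z\<bar> \<ge> norm ?z / 3 ^ k / 2"
      using big[of k] by (simp add: inner_diff_left)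
    moreover have "norm ?z / 3 ^ k / 2 > real k" using m[of k] by (simp add: divide_simps mult_ac)
    ultimately show ?thesis using C[of "m k"] by linarith
  qed
  then show False by (meson not_le reals_Archimedean2)
qed

section \<open>Functional calculus for positive operators\<close>

definition sym_op :: "('a::chilbert_space \<Rightarrow>\<^sub>L 'a) \<Rightarrow> bool" where
  "sym_op A \<longleftrightarrow> (\<forall>x y. inner (A x) y = inner x (A y))"

text \<open>Positivity for the real inner product. Symmetry has to be demanded, since a nonnegative
  real quadratic form does not imply it; for complex linear operators the notion agrees with
  \<open>positive_op\<close>.\<close>

definition pos_op :: "('a::chilbert_space \<Rightarrow>\<^sub>L 'a) \<Rightarrow> bool" where
  "pos_op A \<longleftrightarrow> sym_op A \<and> (\<forall>x. 0 \<le> inner (A x) x)"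

lemma sym_opD: "sym_op A \<Longrightarrow> inner (blinfun_apply A x) y = inner x (blinfun_apply A y)"
  by (simp add: sym_op_def)

lemma pos_op_sym: "pos_op A \<Longrightarrow> sym_op A"
  by (simp add: pos_op_def)

lemma sym_op_lim:
  assumes "\<And>n. sym_op (A n)" and "A \<longlonglongrightarrow> B"
  shows "sym_op B"
  unfolding sym_op_def
proof (intro allI)
  fix x y
  have "(\<lambda>n. inner (A n x) y) \<longlonglongrightarrow> inner (B x) y" "(\<lambda>n. inner x (A n y)) \<longlonglongrightarrow> inner x (B y)"
    by (intro tendsto_intros assms)+
  then show "inner (B x) y = inner x (B y)"
    using assms(1) LIMSEQ_unique by (simp add: sym_op_def)
qed

section \<open>Polynomials of an operator\<close>

lemma blinfun_compose_assoc: "(A o\<^sub>L B) o\<^sub>L C = A o\<^sub>L (B o\<^sub>L C)"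
  by (rule blinfun_eqI) simp

lemma blinfun_compose_id [simp]: "A o\<^sub>L id_blinfun = A" "id_blinfun o\<^sub>L A = A"
  by (rule blinfun_eqI; simp)+

lemmas blinfun_compose_add_left = bounded_bilinear.add_left[OF bounded_bilinear_blinfun_compose]
  and blinfun_compose_add_right = bounded_bilinear.add_right[OF bounded_bilinear_blinfun_compose]
  and blinfun_compose_scaleR_left = bounded_bilinear.scaleR_left[OF bounded_bilinear_blinfun_compose]
  and blinfun_compose_scaleR_right = bounded_bilinear.scaleR_right[OF bounded_bilinear_blinfun_compose]
  and blinfun_compose_sum_right = bounded_bilinear.sum_right[OF bounded_bilinear_blinfun_compose]

lemma poly_op_0 [simp]: "poly_op 0 A = 0"
  by (simp add: poly_op_def)

lemma poly_op_pCons: "poly_op (pCons a p) A = a *\<^sub>R id_blinfun + (A o\<^sub>L poly_op p A)"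
proof (cases "p = 0")
  case False
  then have "poly_op (pCons a p) A = a *\<^sub>R id_blinfun
      + (\<Sum>k\<le>degree p. coeff p k *\<^sub>R (A o\<^sub>L (((o\<^sub>L) A ^^ k) id_blinfun)))"
    by (simp add: poly_op_def sum.atMost_Suc_shift del: sum.atMost_Suc)
  then show ?thesis
    by (simp add: poly_op_def blinfun_compose_sum_right blinfun_compose_scaleR_right)
qed (simp add: poly_op_def)

lemma poly_op_const [simp]: "poly_op [:a:] A = a *\<^sub>R id_blinfun"
  by (simp add: poly_op_pCons)

lemma poly_op_1 [simp]: "poly_op 1 A = id_blinfun"
  by (simp add: one_pCons)

lemma poly_op_X [simp]: "poly_op [:0, 1:] A = A"
  by (simp add: poly_op_pCons)

lemma poly_op_add: "poly_op (p + q) A = poly_op p A + poly_op q A"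
  by (induction p q rule: poly_induct2)
    (simp_all add: poly_op_pCons scaleR_add_left blinfun_compose_add_right)

lemma poly_op_smult: "poly_op (smult c p) A = c *\<^sub>R poly_op p A"
  by (induction p)
    (simp_all add: poly_op_pCons scaleR_add_right blinfun_compose_scaleR_right)

lemma poly_op_minus: "poly_op (- p) A = - poly_op p A"
  using poly_op_smult[of "-1" p A] by simp

lemma poly_op_diff: "poly_op (p - q) A = poly_op p A - poly_op q A"
  using poly_op_add[of p "- q" A] by (simp add: poly_op_minus)

lemma poly_op_mult: "poly_op (p * q) A = poly_op p A o\<^sub>L poly_op q A"
  by (induction p)
    (simp_all add: poly_op_pCons poly_op_add poly_op_smult blinfun_compose_add_left
      blinfun_compose_scaleR_left blinfun_compose_assoc)

lemma poly_op_pcompose: "poly_op (pcompose p q) A = poly_op p (poly_op q A)"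
  by (induction p) (simp_all add: pcompose_pCons poly_op_pCons poly_op_add poly_op_mult)

lemma poly_op_comm: "poly_op p A o\<^sub>L A = A o\<^sub>L poly_op p A"
  using poly_op_mult[of p "[:0, 1:]" A] poly_op_mult[of "[:0, 1:]" p A] by (simp add: mult.commute)

lemma sym_op_poly_op: "sym_op A \<Longrightarrow> sym_op (poly_op p A)"
proof (induction p)
  case (pCons a p)
  then have IH: "sym_op (poly_op p A)" by simp
  have comm: "poly_op p A (A y) = A (poly_op p A y)" for y
    using poly_op_comm[of p A] by (metis blinfun_apply_blinfun_compose)
  show ?case
    unfolding sym_op_def
    by (simp add: poly_op_pCons blinfun.bilinear_simps inner_simps sym_opD[OF IH]
        sym_opD[OF pCons.prems] comm)
qed (simp add: sym_op_def)

lemma complex_linear_poly_op: "complex_linear A \<Longrightarrow> complex_linear (poly_op p A)"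
  by (induction p)
    (auto simp: poly_op_pCons intro!: complex_linear_add complex_linear_scaleR complex_linear_compose)

section \<open>Positivity of p(A) for polynomials nonnegative on an interval\<close>

lemma poly_nonneg_at_limit:
  fixes s :: "real poly"
  assumes "a < b" "c \<in> {a..b}" and nn: "\<And>x. x \<in> {a..b} \<Longrightarrow> x \<noteq> c \<Longrightarrow> 0 \<le> poly s x"
  shows "0 \<le> poly s c"
proof (rule tendsto_lowerbound)
  show "(poly s \<longlongrightarrow> poly s c) (at c within {a..b})"
    by (intro tendsto_intros)
  show "eventually (\<lambda>x. 0 \<le> poly s x) (at c within {a..b})"
    using nn by (auto simp: eventually_at_filter)
  show "at c within {a..b} \<noteq> bot"
    using assms(1,2) by (simp add: trivial_limit_within islimpt_Icc)
qed

lemma real_poly_nonreal_root_dvd: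
  fixes q :: "real poly"
  assumes z: "poly (map_poly of_real q) z = (0 :: complex)" and im: "Im z \<noteq> 0"
  shows "[:(cmod z)\<^sup>2, - 2 * Re z, 1:] dvd q"
proof -
  define m where "m = [:(cmod z)\<^sup>2, - 2 * Re z, 1:]"
  have mz: "poly (map_poly of_real m) z = 0"
    using cmod_power2[of z] by (simp add: m_def map_poly_pCons complex_eq_iff power2_eq_square algebra_simps)
  have deg: "degree (q mod m) < 2"
    using degree_mod_less[of m q] by (cases "q mod m = 0") (auto simp: m_def)
  have hom: "map_poly complex_of_real (a * b + c) = map_poly of_real a * map_poly of_real b + map_poly of_real c" for a b c
    by (simp add: poly_eq_iff coeff_map_poly coeff_mult)
  have "q = q div m * m + q mod m" by simp
  then have "map_poly complex_of_real q = map_poly of_real (q div m) * map_poly of_real m + map_poly of_real (q mod m)"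
    by (metis hom)
  then have r0: "poly (map_poly of_real (q mod m)) z = 0" using z mz by simp
  obtain a b where ab: "q mod m = [:a, b:]"
    using deg by (cases "q mod m" rule: pCons_cases; metis One_nat_def Suc_1 degree_eq_zeroE degree_pCons_eq_if less_Suc_eq less_one pCons_0_0 Suc_less_eq)
  have "of_real a + z * of_real b = 0" using r0 by (simp add: ab map_poly_pCons)
  then have "b = 0" "a = 0" using im by (auto simp: complex_eq_iff)
  then have "q mod m = 0" using ab by simp
  then show ?thesis unfolding m_def by (simp add: mod_eq_0_iff_dvd)
qed

context
  fixes A :: "'a::chilbert_space \<Rightarrow>\<^sub>L 'a" and M :: real
  assumes A: "pos_op A" and M: "norm A \<le> M" "0 < M"
begin

private definition quad :: "real poly \<Rightarrow> 'a \<Rightarrow> real" where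
  "quad p x = inner (poly_op p A x) x"

private lemma quad_add: "quad (p + q) x = quad p x + quad q x"
  by (simp add: quad_def poly_op_add blinfun.add_left inner_add_left)

private lemma quad_smult: "quad (smult c p) x = c * quad p x"
  by (simp add: quad_def poly_op_smult blinfun.scaleR_left)

private lemma quad_square: "quad (l * (l * p)) x = quad p (poly_op l A x)"
proof -
  have "quad (l * (l * p)) x = inner (poly_op (l * (p * l)) A x) x"
    by (simp add: quad_def mult.commute)
  also have "\<dots> = quad p (poly_op l A x)"
    using sym_op_poly_op[OF pos_op_sym[OF A], of l]
    by (simp add: quad_def poly_op_mult sym_op_def)
  finally show ?thesis .
qed

private definition weights :: "real poly set" where
  "weights = {1, [:0, 1:], [:M, -1:], [:0, 1:] * [:M, -1:]}"

private lemma quad_weights: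
  assumes "w \<in> weights"
  shows "0 \<le> quad w x"
proof -
  have 1: "0 \<le> quad 1 x" for x by (simp add: quad_def)
  have X: "0 \<le> quad [:0, 1:] x" for x using A by (simp add: quad_def pos_op_def)
  have MX: "0 \<le> quad [:M, -1:] x" for x
  proof -
    have "inner (A x) x \<le> norm (A x) * norm x" by (rule norm_cauchy_schwarz)
    also have "\<dots> \<le> M * norm x * norm x"
      by (intro mult_right_mono order_trans[OF norm_blinfun] M) auto
    also have "\<dots> = M * inner x x" by (simp add: power2_norm_eq_inner[symmetric] power2_eq_square)
    finally show ?thesis
      by (simp add: quad_def poly_op_pCons blinfun.bilinear_simps inner_simps)
  qed
  \<comment> \<open>The identity x^2 (M - x) + (M - x)^2 x = M x (M - x) reduces the product weight
    to single weights times squares, and a square is absorbed into the vector.\<close>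
  have "[:0, 1:] * ([:0, 1:] * [:M, -1:]) + [:M, -1:] * ([:M, -1:] * [:0, 1:]) = smult M ([:0, 1:] * [:M, -1:])"
    by (simp add: algebra_simps)
  then have "M * quad ([:0, 1:] * [:M, -1:]) x =
      quad [:M, -1:] (poly_op [:0, 1:] A x) + quad [:0, 1:] (poly_op [:M, -1:] A x)"
    by (metis quad_square quad_add quad_smult)
  then have "0 \<le> M * quad ([:0, 1:] * [:M, -1:]) x" using MX X by simp
  then have "0 \<le> quad ([:0, 1:] * [:M, -1:]) x" using M by (simp add: zero_le_mult_iff)
  then show ?thesis using assms 1 X MX by (auto simp: weights_def simp del: mult_pCons_left mult_pCons_right)
qed

text \<open>The weights make the statement stable under splitting off a linear factor \<open>x - c\<close> or
  \<open>c - x\<close> with \<open>c\<close> outside \<open>(0, M)\<close>; interior real roots are double, and pairs of complex roots give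
  a sum of two squares.\<close>

private lemma quad_nonneg_weighted:
  assumes "\<And>x. x \<in> {0..M} \<Longrightarrow> 0 \<le> poly q x" and "w \<in> weights"
  shows "0 \<le> quad (q * w) x"
  using assms
proof (induction "degree q" arbitrary: q w x rule: less_induct)
  case (less q w x)
  let ?X = "[:0, 1:] :: real poly" and ?Y = "[:M, -1:]"
  have IH: "0 \<le> quad (s * w) x"
    if "degree s < degree q" "\<And>x. x \<in> {0..M} \<Longrightarrow> 0 \<le> poly s x" "w \<in> weights" for s w x
    using less.hyps[of s w x] that by blast
  \<comment> \<open>A further factor x either completes w to another weight or makes a square, which
    is absorbed by evaluating at A x.\<close>
  have IHX: "0 \<le> quad (?X * (s * w)) x"
    if s: "degree s < degree q" "\<And>x. x \<in> {0..M} \<Longrightarrow> 0 \<le> poly s x" for s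
  proof -
    consider "w = 1" | "w = ?X" | "w = ?Y" | "w = ?X * ?Y"
      using less.prems(2) unfolding weights_def by blast
    then show ?thesis
    proof cases
      case 1
      then have "?X * (s * w) = s * ?X" by (simp only: mult_ac mult_1_left mult_1_right)
      then show ?thesis using IH[OF s, of ?X x] by (simp only: weights_def insert_iff) auto
    next
      case 2
      then have "?X * (s * w) = ?X * (?X * (s * 1))" by (simp only: mult_ac mult_1_left mult_1_right)
      then show ?thesis using IH[OF s, of 1] by (simp only: quad_square weights_def insert_iff) auto
    next
      case 3
      then have "?X * (s * w) = s * (?X * ?Y)" by (simp only: mult_ac)
      then show ?thesis using IH[OF s, of "?X * ?Y" x] by (simp only: weights_def insert_iff) auto
    next
      case 4
      then have "?X * (s * w) = ?X * (?X * (s * ?Y))" by (simp only: mult_ac)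
      then show ?thesis using IH[OF s, of ?Y] by (simp only: quad_square weights_def insert_iff) auto
    qed
  qed
  have IHY: "0 \<le> quad (?Y * (s * w)) x"
    if s: "degree s < degree q" "\<And>x. x \<in> {0..M} \<Longrightarrow> 0 \<le> poly s x" for s
  proof -
    consider "w = 1" | "w = ?X" | "w = ?Y" | "w = ?X * ?Y"
      using less.prems(2) unfolding weights_def by blast
    then show ?thesis
    proof cases
      case 1
      then have "?Y * (s * w) = s * ?Y" by (simp only: mult_ac mult_1_left mult_1_right)
      then show ?thesis using IH[OF s, of ?Y x] by (simp only: weights_def insert_iff) auto
    next
      case 2
      then have "?Y * (s * w) = s * (?X * ?Y)" by (simp only: mult_ac)
      then show ?thesis using IH[OF s, of "?X * ?Y" x] by (simp only: weights_def insert_iff) auto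
    next
      case 3
      then have "?Y * (s * w) = ?Y * (?Y * (s * 1))" by (simp only: mult_ac mult_1_left mult_1_right)
      then show ?thesis using IH[OF s, of 1] by (simp only: quad_square weights_def insert_iff) auto
    next
      case 4
      then have "?Y * (s * w) = ?Y * (?Y * (s * ?X))" by (simp only: mult_ac)
      then show ?thesis using IH[OF s, of ?X] by (simp only: quad_square weights_def insert_iff) auto
    qed
  qed
  show ?case
  proof (cases "degree q = 0")
    case True
    then obtain c where q: "q = [:c:]" by (rule degree_eq_zeroE)
    then have "0 \<le> c" using less.prems(1)[of 0] M by simp
    then show ?thesis using quad_weights[OF less.prems(2), of x] by (simp add: q quad_smult)
  next
    case False
    have q0: "q \<noteq> 0" using False by auto
    have "degree (map_poly complex_of_real q) = degree q" by (rule degree_map_poly) simp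
    then have "\<not> constant (poly (map_poly complex_of_real q))" using False by (simp add: constant_degree)
    then obtain z where z: "poly (map_poly complex_of_real q) z = 0"
      using fundamental_theorem_of_algebra by blast
    show ?thesis
    proof (cases "Im z = 0")
      case False
      then obtain s where qs: "q = [:(cmod z)\<^sup>2, - 2 * Re z, 1:] * s"
        using real_poly_nonreal_root_dvd[OF z] by (auto elim: dvdE)
      let ?l = "[:- Re z, 1:]"
      have m: "[:(cmod z)\<^sup>2, - 2 * Re z, 1:] = ?l * ?l + [:(Im z)\<^sup>2:]"
        using cmod_power2[of z] by (simp add: power2_eq_square)
      have s0: "s \<noteq> 0" using q0 qs by auto
      have ds: "degree s < degree q" unfolding qs using s0 by (subst degree_mult_eq) auto
      have sn: "0 \<le> poly s x" if "x \<in> {0..M}" for x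
      proof -
        have "poly q x = ((x - Re z)\<^sup>2 + (Im z)\<^sup>2) * poly s x"
          unfolding qs m by (simp add: power2_eq_square algebra_simps)
        moreover have "(x - Re z)\<^sup>2 + (Im z)\<^sup>2 > 0" using False by (simp add: add_nonneg_pos)
        ultimately show ?thesis using less.prems(1)[OF that] by (simp add: zero_le_mult_iff)
      qed
      have "q * w = ?l * (?l * (s * w)) + smult ((Im z)\<^sup>2) (s * w)"
        unfolding qs m by (simp only: distrib_right mult.assoc) simp
      then have "quad (q * w) x = quad (s * w) (poly_op ?l A x) + (Im z)\<^sup>2 * quad (s * w) x"
        by (simp only: quad_add quad_square quad_smult)
      then show ?thesis using IH[OF ds sn less.prems(2)] by simp
    next
      case True
      define c where "c = Re z"
      have "z = of_real c" using True by (simp add: c_def complex_eq_iff)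
      then have "complex_of_real (poly q c) = 0"
        using z by (simp add: poly_altdef coeff_map_poly degree_map_poly)
      then have "poly q c = 0" by simp
      then obtain s where qs: "q = [:- c, 1:] * s" by (auto simp: poly_eq_0_iff_dvd elim: dvdE)
      have s0: "s \<noteq> 0" using q0 qs by auto
      have ds: "degree s < degree q" unfolding qs using s0 by (subst degree_mult_eq) auto
      have pq: "poly q y = (y - c) * poly s y" for y by (simp add: qs algebra_simps)
      consider "c \<le> 0" | "c \<ge> M" | "0 < c" "c < M" by linarith
      then show ?thesis
      proof cases
        case 1
        have off: "0 \<le> poly s y" if "y \<in> {0..M}" "y \<noteq> c" for y
          using less.prems(1)[OF that(1)] that 1 by (simp add: pq zero_le_mult_iff)
        have sn: "0 \<le> poly s y" if "y \<in> {0..M}" for y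
          using poly_nonneg_at_limit[OF M(2), of y s] off that by (cases "y = c") auto
        have "q * w = ?X * (s * w) + smult (- c) (s * w)"
          unfolding qs by (simp add: algebra_simps)
        then have "quad (q * w) x = quad (?X * (s * w)) x + (- c) * quad (s * w) x"
          by (simp only: quad_add quad_smult)
        moreover have "0 \<le> quad (?X * (s * w)) x" by (rule IHX[OF ds sn])
        moreover have "0 \<le> (- c) * quad (s * w) x"
          using IH[OF ds sn less.prems(2)] 1 by (intro mult_nonneg_nonneg) auto
        ultimately show ?thesis by linarith
      next
        case 2
        have off: "0 \<le> poly (- s) y" if "y \<in> {0..M}" "y \<noteq> c" for y
          using less.prems(1)[OF that(1)] that 2 by (simp add: pq zero_le_mult_iff)
        have sn: "0 \<le> poly (- s) y" if "y \<in> {0..M}" for y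
          using poly_nonneg_at_limit[OF M(2), of y "- s"] off that by (cases "y = c") auto
        have dms: "degree (- s) < degree q" using ds by simp
        have "q * w = ?Y * (- s * w) + smult (c - M) (- s * w)"
          unfolding qs by (simp add: algebra_simps smult_diff_left)
        then have "quad (q * w) x = quad (?Y * (- s * w)) x + (c - M) * quad (- s * w) x"
          by (simp only: quad_add quad_smult)
        moreover have "0 \<le> quad (?Y * (- s * w)) x" by (rule IHY[OF dms sn])
        moreover have "0 \<le> quad (- s * w) x" by (rule IH[OF dms sn less.prems(2)])
        ultimately show ?thesis using 2 by simp
      next
        case 3
        have up: "0 \<le> poly s y" if "y \<in> {c..M}" "y \<noteq> c" for y
          using less.prems(1)[of y] that 3 by (simp add: pq zero_le_mult_iff)
        have dn: "0 \<le> poly (- s) y" if "y \<in> {0..c}" "y \<noteq> c" for y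
          using less.prems(1)[of y] that 3 by (simp add: pq zero_le_mult_iff)
        have "0 \<le> poly s c" "0 \<le> poly (- s) c"
          using poly_nonneg_at_limit[of c M c s] poly_nonneg_at_limit[of 0 c c "- s"] up dn 3 by auto
        then have "poly s c = 0" by simp
        then obtain u where su: "s = [:- c, 1:] * u" by (auto simp: poly_eq_0_iff_dvd elim: dvdE)
        have u0: "u \<noteq> 0" using s0 su by auto
        have "degree u < degree s" unfolding su using u0 by (subst degree_mult_eq) auto
        then have du: "degree u < degree q" using ds by simp
        have off: "0 \<le> poly u y" if "y \<in> {0..M}" "y \<noteq> c" for y
        proof -
          have "poly q y = (y - c)\<^sup>2 * poly u y" by (simp add: pq su power2_eq_square algebra_simps)
          then show ?thesis using less.prems(1)[OF that(1)] that by (simp add: zero_le_mult_iff)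
        qed
        have un: "0 \<le> poly u y" if "y \<in> {0..M}" for y
          using poly_nonneg_at_limit[OF M(2), of y u] off that by (cases "y = c") auto
        have "q * w = [:- c, 1:] * ([:- c, 1:] * (u * w))" unfolding qs su by (simp only: mult.assoc)
        then show ?thesis using IH[OF du un less.prems(2)] by (simp only: quad_square)
      qed
    qed
  qed
qed

lemma poly_op_nonneg:
  assumes "\<And>x. x \<in> {0..M} \<Longrightarrow> 0 \<le> poly q x"
  shows "0 \<le> inner (poly_op q A x) x"
proof -
  have "0 \<le> quad (q * 1) x"
    by (rule quad_nonneg_weighted) (use assms in \<open>auto simp: weights_def\<close>)
  then show ?thesis by (simp add: quad_def)
qed

end

text \<open>The spectral estimate, from positivity of c^2 - p^2 on the interval. The zero operator
  is separate because the positivity lemma requires an interval of positive length.\<close>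

lemma norm_poly_op_le:
  fixes A :: "'a::chilbert_space \<Rightarrow>\<^sub>L 'a"
  assumes A: "pos_op A" and c: "\<And>x. x \<in> {0..norm A} \<Longrightarrow> \<bar>poly p x\<bar> \<le> c"
  shows "norm (poly_op p A) \<le> c"
proof (cases "A = 0")
  case True
  have "poly_op p 0 = poly p 0 *\<^sub>R (id_blinfun :: 'a \<Rightarrow>\<^sub>L 'a)"
    by (cases p rule: pCons_cases) (simp add: poly_op_pCons)
  then have "norm (poly_op p A) \<le> \<bar>poly p 0\<bar> * 1"
    unfolding True norm_scaleR[symmetric] by (metis True norm_scaleR mult_left_mono abs_ge_zero norm_blinfun_id_le)
  then show ?thesis using c[of 0] by simp
next
  case False
  have c0: "0 \<le> c" using c[of 0] by simp
  show ?thesis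
  proof (rule norm_blinfun_bound[OF c0])
    fix x
    have "0 \<le> inner (poly_op ([:c\<^sup>2:] - p * p) A x) x"
    proof (rule poly_op_nonneg[OF A order_refl])
      fix y assume "y \<in> {0..norm A}"
      then have "\<bar>poly p y\<bar> \<le> \<bar>c\<bar>" using c c0 by simp
      then have "(poly p y)\<^sup>2 \<le> c\<^sup>2" by (simp only: abs_le_square_iff)
      then show "0 \<le> poly ([:c\<^sup>2:] - p * p) y" by (simp add: power2_eq_square)
    qed (use False in simp)
    also have "inner (poly_op ([:c\<^sup>2:] - p * p) A x) x = c\<^sup>2 * inner x x - inner (poly_op p A x) (poly_op p A x)"
      using sym_op_poly_op[OF pos_op_sym[OF A], of p]
      by (simp add: poly_op_diff poly_op_mult blinfun.bilinear_simps inner_simps sym_op_def)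
    finally have "(norm (poly_op p A x))\<^sup>2 \<le> (c * norm x)\<^sup>2"
      by (simp add: power2_norm_eq_inner power_mult_distrib)
    then show "norm (poly_op p A x) \<le> c * norm x"
      by (rule power2_le_imp_le) (use c0 in simp)
  qed
qed


section \<open>Real powers and square roots of positive operators\<close>

lemma poly_op_diff_tendsto:
  fixes A :: "'a::chilbert_space \<Rightarrow>\<^sub>L 'a"
  assumes A: "pos_op A"
    and p: "uniform_limit {0..norm A} (\<lambda>n. poly (p n)) f sequentially"
    and q: "uniform_limit {0..norm A} (\<lambda>n. poly (q n)) f sequentially"
  shows "(\<lambda>n. poly_op (p n) A - poly_op (q n) A) \<longlonglongrightarrow> 0"
proof (rule tendstoI)
  fix e :: real assume e: "e > 0"
  have "\<forall>\<^sub>F n in sequentially. \<forall>x\<in>{0..norm A}. dist (poly (p n) x) (f x) < e / 4"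
    "\<forall>\<^sub>F n in sequentially. \<forall>x\<in>{0..norm A}. dist (poly (q n) x) (f x) < e / 4"
    using uniform_limitD[OF p, of "e / 4"] uniform_limitD[OF q, of "e / 4"] e by auto
  then show "\<forall>\<^sub>F n in sequentially. dist (poly_op (p n) A - poly_op (q n) A) 0 < e"
  proof eventually_elim
    case (elim n)
    have "norm (poly_op (p n - q n) A) \<le> e / 2"
    proof (rule norm_poly_op_le[OF A])
      fix x assume "x \<in> {0..norm A}"
      then have "dist (poly (p n) x) (f x) < e / 4" "dist (poly (q n) x) (f x) < e / 4" using elim by auto
      then show "\<bar>poly (p n - q n) x\<bar> \<le> e / 2" unfolding dist_real_def poly_diff by linarith
    qed
    then show ?case using e by (simp add: poly_op_diff)
  qed
qed

lemma poly_op_convergent: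
  fixes A :: "'a::chilbert_space \<Rightarrow>\<^sub>L 'a"
  assumes A: "pos_op A"
    and p: "uniform_limit {0..norm A} (\<lambda>n. poly (p n)) f sequentially"
  shows "convergent (\<lambda>n. poly_op (p n) A)"
proof (rule Cauchy_convergent, rule metric_CauchyI)
  fix e :: real assume e: "e > 0"
  have "\<forall>\<^sub>F n in sequentially. \<forall>x\<in>{0..norm A}. dist (poly (p n) x) (f x) < e / 4"
    using uniform_limitD[OF p, of "e / 4"] e by auto
  then obtain N where N: "\<And>n x. n \<ge> N \<Longrightarrow> x \<in> {0..norm A} \<Longrightarrow> dist (poly (p n) x) (f x) < e / 4"
    unfolding eventually_sequentially by blast
  have "dist (poly_op (p m) A) (poly_op (p n) A) < e" if mn: "m \<ge> N" "n \<ge> N" for m n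
  proof -
    have "norm (poly_op (p m - p n) A) \<le> e / 2"
    proof (rule norm_poly_op_le[OF A])
      fix x assume "x \<in> {0..norm A}"
      then have "dist (poly (p m) x) (f x) < e / 4" "dist (poly (p n) x) (f x) < e / 4" using N mn by auto
      then show "\<bar>poly (p m - p n) x\<bar> \<le> e / 2" unfolding dist_real_def poly_diff by linarith
    qed
    then show ?thesis using e by (simp add: poly_op_diff dist_norm)
  qed
  then show "\<exists>M. \<forall>m\<ge>M. \<forall>n\<ge>M. dist (poly_op (p m) A) (poly_op (p n) A) < e" by blast
qed

lemma uniform_polynomial_approximation:
  fixes f :: "real \<Rightarrow> real"
  assumes "continuous_on {0..M} f"
  shows "\<exists>p. uniform_limit {0..M} (\<lambda>n. poly (p n)) f sequentially"
proof -
  have "\<forall>n. \<exists>p. \<forall>x\<in>{0..M}. \<bar>f x - poly p x\<bar> < 1 / real (Suc n)"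
  proof
    fix n
    obtain g where g: "real_polynomial_function g" "\<And>x. x \<in> {0..M} \<Longrightarrow> \<bar>f x - g x\<bar> < 1 / real (Suc n)"
      using Stone_Weierstrass_real_polynomial_function[of "{0..M}" f "1 / real (Suc n)"] assms by auto
    obtain a m where "g = (\<lambda>x. \<Sum>i\<le>m. a i * x ^ i)"
      using g(1) unfolding real_polynomial_function_iff_sum by blast
    then have "g x = poly (\<Sum>i\<le>m. monom (a i) i) x" for x by (simp add: poly_sum poly_monom)
    then show "\<exists>p. \<forall>x\<in>{0..M}. \<bar>f x - poly p x\<bar> < 1 / real (Suc n)"
      using g(2) by (intro exI[of _ "\<Sum>i\<le>m. monom (a i) i"]) auto
  qed
  from choice[OF this] obtain p
    where p: "\<And>n x. x \<in> {0..M} \<Longrightarrow> \<bar>f x - poly (p n) x\<bar> < 1 / real (Suc n)" by blast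
  have "uniform_limit {0..M} (\<lambda>n. poly (p n)) f sequentially"
  proof (rule uniform_limitI)
    fix e :: real assume "e > 0"
    then have "\<forall>\<^sub>F n in sequentially. 1 / real (Suc n) < e"
      by (intro order_tendstoD[OF LIMSEQ_Suc[OF lim_1_over_n]])
    then show "\<forall>\<^sub>F n in sequentially. \<forall>x\<in>{0..M}. dist (poly (p n) x) (f x) < e"
    proof eventually_elim
      case (elim n)
      show ?case
        unfolding dist_real_def abs_minus_commute[of "poly _ _"] using less_trans[OF p elim] by blast
    qed
  qed
  then show ?thesis by blast
qed

lemma continuous_on_powr_Icc: "0 < s \<Longrightarrow> continuous_on {0..M :: real} (\<lambda>x. x powr s)"
  by (intro continuous_on_powr' continuous_intros) auto

lemma power_op_tendsto:
  fixes A :: "'a::chilbert_space \<Rightarrow>\<^sub>L 'a"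
  assumes A: "pos_op A" and s: "0 < s"
    and q: "uniform_limit {0..norm A} (\<lambda>n. poly (q n)) (\<lambda>x. x powr s) sequentially"
  shows "(\<lambda>n. poly_op (q n) A) \<longlonglongrightarrow> power_op A s"
proof -
  obtain B where B: "(\<lambda>n. poly_op (q n) A) \<longlonglongrightarrow> B"
    using poly_op_convergent[OF A q] by (auto simp: convergent_def)
  have all: "(\<lambda>n. poly_op (p n) A) \<longlonglongrightarrow> B"
    if p: "uniform_limit {0..norm A} (\<lambda>n. poly (p n)) (\<lambda>x. x powr s) sequentially" for p
    using tendsto_add[OF poly_op_diff_tendsto[OF A p q] B] by simp
  have "power_op A s = (THE B. \<forall>p. uniform_limit {0..norm A} (\<lambda>n x. poly (p n) x) (\<lambda>x. x powr s) sequentially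
              \<longrightarrow> (\<lambda>n. poly_op (p n) A) \<longlonglongrightarrow> B)"
    using s by (simp add: power_op_def)
  also have "\<dots> = B"
  proof (rule the_equality)
    fix C assume "\<forall>p. uniform_limit {0..norm A} (\<lambda>n x. poly (p n) x) (\<lambda>x. x powr s) sequentially
              \<longrightarrow> (\<lambda>n. poly_op (p n) A) \<longlonglongrightarrow> C"
    then have "(\<lambda>n. poly_op (q n) A) \<longlonglongrightarrow> C" using q by blast
    then show "C = B" using B LIMSEQ_unique by blast
  qed (use all in blast)
  finally show ?thesis using B by simp
qed

lemma power_op_approx:
  fixes A :: "'a::chilbert_space \<Rightarrow>\<^sub>L 'a"
  assumes A: "pos_op A" and s: "0 < s"
  obtains p where "uniform_limit {0..norm A} (\<lambda>n. poly (p n)) (\<lambda>x. x powr s) sequentially"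
    and "(\<lambda>n. poly_op (p n) A) \<longlonglongrightarrow> power_op A s"
proof -
  obtain p where p: "uniform_limit {0..norm A} (\<lambda>n. poly (p n)) (\<lambda>x. x powr s) sequentially"
    using uniform_polynomial_approximation[OF continuous_on_powr_Icc[OF s]] by blast
  show thesis by (rule that[OF p power_op_tendsto[OF A s p]])
qed

lemma power_op_0 [simp]: "power_op A 0 = id_blinfun"
  by (simp add: power_op_def)

lemma power_op_1:
  fixes A :: "'a::chilbert_space \<Rightarrow>\<^sub>L 'a"
  assumes A: "pos_op A"
  shows "power_op A 1 = A"
proof -
  have "uniform_limit {0..norm A} (\<lambda>n. poly [:0, 1:]) (\<lambda>x. x powr 1) sequentially"
    by (rule uniform_limitI) (auto simp: eventually_sequentially)
  from power_op_tendsto[OF A _ this] show ?thesis by (simp add: LIMSEQ_const_iff)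
qed

lemma power_op_add:
  fixes A :: "'a::chilbert_space \<Rightarrow>\<^sub>L 'a"
  assumes A: "pos_op A" and "0 \<le> s" "0 \<le> r"
  shows "power_op A (s + r) = power_op A s o\<^sub>L power_op A r"
proof (cases "s = 0 \<or> r = 0")
  case False
  then have s: "0 < s" and r: "0 < r" using assms by auto
  obtain p where p: "uniform_limit {0..norm A} (\<lambda>n. poly (p n)) (\<lambda>x. x powr s) sequentially"
    "(\<lambda>n. poly_op (p n) A) \<longlonglongrightarrow> power_op A s" using power_op_approx[OF A s] .
  obtain q where q: "uniform_limit {0..norm A} (\<lambda>n. poly (q n)) (\<lambda>x. x powr r) sequentially"
    "(\<lambda>n. poly_op (q n) A) \<longlonglongrightarrow> power_op A r" using power_op_approx[OF A r] .
  have bd: "bounded ((\<lambda>x. x powr u) ` {0..norm A})" if "0 < u" for u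
    by (intro compact_imp_bounded compact_continuous_image continuous_on_powr_Icc that) simp
  have "uniform_limit {0..norm A} (\<lambda>n x. poly (p n) x * poly (q n) x) (\<lambda>x. x powr s * x powr r) sequentially"
    by (intro uniform_lim_mult p q bd s r)
  then have "uniform_limit {0..norm A} (\<lambda>n. poly (p n * q n)) (\<lambda>x. x powr (s + r)) sequentially"
    by (simp add: powr_add poly_mult[abs_def])
  then have "(\<lambda>n. poly_op (p n * q n) A) \<longlonglongrightarrow> power_op A (s + r)"
    using s r by (intro power_op_tendsto[OF A]) auto
  moreover have "(\<lambda>n. poly_op (p n * q n) A) \<longlonglongrightarrow> (power_op A s o\<^sub>L power_op A r)"
    unfolding poly_op_mult by (intro bounded_bilinear.tendsto[OF bounded_bilinear_blinfun_compose] p q)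
  ultimately show ?thesis by (rule LIMSEQ_unique)
qed auto

lemma sym_op_power_op:
  fixes A :: "'a::chilbert_space \<Rightarrow>\<^sub>L 'a"
  assumes A: "pos_op A" and "0 \<le> s"
  shows "sym_op (power_op A s)"
proof (cases "s = 0")
  case False
  then have s: "0 < s" using assms by simp
  obtain p where "(\<lambda>n. poly_op (p n) A) \<longlonglongrightarrow> power_op A s" using power_op_approx[OF A s] .
  then show ?thesis by (rule sym_op_lim[OF sym_op_poly_op[OF pos_op_sym[OF A]]])
qed (simp add: sym_op_def)

lemma complex_linear_power_op:
  fixes A :: "'a::chilbert_space \<Rightarrow>\<^sub>L 'a"
  assumes A: "pos_op A" "complex_linear A" and "0 \<le> s"
  shows "complex_linear (power_op A s)"
proof (cases "s = 0")
  case False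
  then have s: "0 < s" using assms by simp
  obtain p where "(\<lambda>n. poly_op (p n) A) \<longlonglongrightarrow> power_op A s" using power_op_approx[OF A(1) s] .
  then show ?thesis by (rule complex_linear_lim[OF complex_linear_poly_op[OF A(2)]])
qed simp

lemma pos_op_power_op:
  fixes A :: "'a::chilbert_space \<Rightarrow>\<^sub>L 'a"
  assumes A: "pos_op A" and s: "0 \<le> s"
  shows "pos_op (power_op A s)"
proof -
  have "power_op A (s / 2 + s / 2) = power_op A (s / 2) o\<^sub>L power_op A (s / 2)"
    by (rule power_op_add[OF A]) (use s in auto)
  then have "inner (power_op A s x) x = inner (power_op A (s / 2) x) (power_op A (s / 2) x)" for x
    using sym_opD[OF sym_op_power_op[OF A, of "s / 2"], of "power_op A (s / 2) x" x] s
    by (simp only: field_sum_of_halves blinfun_apply_blinfun_compose)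
  then show ?thesis using sym_op_power_op[OF A s] by (simp add: pos_op_def)
qed

text \<open>Crude, but uniform in the exponent, since x^s \<le> 1 + x. The interpolation argument
  requires no more than some uniform bound.\<close>

lemma norm_power_op_le:
  fixes A :: "'a::chilbert_space \<Rightarrow>\<^sub>L 'a"
  assumes A: "pos_op A" and s: "0 \<le> s" "s \<le> 1"
  shows "norm (power_op A s) \<le> 1 + norm A"
proof (cases "s = 0")
  case True
  then have "norm (power_op A s) \<le> 1" using norm_blinfun_id_le by (simp only: power_op_0)
  then show ?thesis using norm_ge_zero[of A] by linarith
next
  case False
  then have s0: "0 < s" using s by simp
  obtain p where p: "uniform_limit {0..norm A} (\<lambda>n. poly (p n)) (\<lambda>x. x powr s) sequentially"
    "(\<lambda>n. poly_op (p n) A) \<longlonglongrightarrow> power_op A s" using power_op_approx[OF A s0] .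
  show ?thesis
  proof (rule field_le_epsilon)
    fix e :: real assume e: "0 < e"
    have "\<forall>\<^sub>F n in sequentially. \<forall>x\<in>{0..norm A}. dist (poly (p n) x) (x powr s) < e"
      using uniform_limitD[OF p(1)] e by auto
    then have ev: "\<forall>\<^sub>F n in sequentially. norm (poly_op (p n) A) \<le> 1 + norm A + e"
    proof eventually_elim
      case (elim n)
      show ?case
      proof (rule norm_poly_op_le[OF A])
        fix x assume x: "x \<in> {0..norm A}"
        have "x powr s \<le> 1 + x"
        proof (cases "x \<le> 1")
          case True
          then have "x powr s \<le> 1" using x s by (intro powr_le1) auto
          then show ?thesis using x by simp
        next
          case False
          then have "x powr s \<le> x powr 1" using s by (intro powr_mono) auto
          then show ?thesis using False by simp
        qed
        moreover have "0 \<le> x powr s" by simp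
        moreover have "\<bar>poly (p n) x - x powr s\<bar> < e" using elim x by (auto simp: dist_real_def)
        ultimately show "\<bar>poly (p n) x\<bar> \<le> 1 + norm A + e"
          using x unfolding atLeastAtMost_iff by linarith
      qed
    qed
    show "norm (power_op A s) \<le> 1 + norm A + e"
      by (rule tendsto_upperbound[OF tendsto_norm[OF p(2)] ev]) simp
  qed
qed

text \<open>Polarisation: a real quadratic form makes the imaginary parts of the sesquilinear form
  cancel in pairs, and replacing y by -\<i> y turns this into symmetry of the real parts.\<close>

lemma positive_op_iff: "positive_op A \<longleftrightarrow> complex_linear A \<and> pos_op A"
proof (cases "complex_linear A")
  case A: True
  show ?thesis
  proof
    assume "positive_op A"
    then have pos: "cinner (A x) x \<in> \<real>\<^sub>\<ge>\<^sub>0" for x by (simp add: positive_op_def)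
    have "Im (cinner (A x) x) = 0" for x using pos[of x] by (auto simp: complex_nonneg_Reals_iff)
    then have I: "inner (A x) (\<i> *\<^sub>C x) = 0" for x by (simp add: Im_cinner)
    have I2: "inner (A x) (\<i> *\<^sub>C y) + inner (A y) (\<i> *\<^sub>C x) = 0" for x y
      using I[of "x + y"] I[of x] I[of y] by (simp add: blinfun.add_right scaleC_add_right inner_simps)
    have "inner (A x) y = inner x (A y)" for x y
    proof -
      have "y = \<i> *\<^sub>C ((- \<i>) *\<^sub>C y)" using scaleR_scaleC[of 1 y] by (simp only: scaleC_scaleC) simp
      then have "inner (A x) y = inner (A x) (\<i> *\<^sub>C ((- \<i>) *\<^sub>C y))" by (rule arg_cong)
      also have "\<dots> = - inner (A ((- \<i>) *\<^sub>C y)) (\<i> *\<^sub>C x)" using I2[of x "(- \<i>) *\<^sub>C y"] by linarith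
      also have "A ((- \<i>) *\<^sub>C y) = (- \<i>) *\<^sub>C A y" by (rule complex_linearD[OF A])
      also have "inner ((- \<i>) *\<^sub>C A y) (\<i> *\<^sub>C x) = inner (A y) (- x)"
        using scaleR_scaleC[of "-1" x] by (simp only: inner_scaleC_left scaleC_scaleC) simp
      finally show ?thesis by (simp add: inner_commute)
    qed
    moreover have "0 \<le> inner (A x) x" for x using pos[of x]
      by (auto simp: inner_eq_Re_cinner complex_nonneg_Reals_iff)
    ultimately show "complex_linear A \<and> pos_op A" using A by (simp add: pos_op_def sym_op_def)
  next
    assume "complex_linear A \<and> pos_op A"
    then have sym: "sym_op A" and pos: "\<And>x. 0 \<le> inner (A x) x" by (auto simp: pos_op_def)
    have "inner (A x) (\<i> *\<^sub>C x) = 0" for x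
    proof -
      have "inner (A x) (\<i> *\<^sub>C x) = inner x (\<i> *\<^sub>C A x)"
        by (simp only: sym_opD[OF sym] complex_linearD[OF A])
      also have "\<dots> = inner ((- \<i>) *\<^sub>C x) (A x)" by (simp only: inner_scaleC_left) simp
      also have "(- \<i>) *\<^sub>C x = - (\<i> *\<^sub>C x)" by simp
      finally show ?thesis by (simp add: inner_commute)
    qed
    then show "positive_op A" using A pos
      by (simp add: positive_op_def complex_nonneg_Reals_iff cinner_eq_inner)
  qed
qed (simp add: positive_op_def)

text \<open>Existence is the power 1/2. For uniqueness, let p_n approximate the square root on
  [0, ||A||]; then p_n(x^2) approximates x on [0, ||C||] for any positive root C, so p_n(A) =
  p_n(C^2) tends both to C and to the power 1/2.\<close>

lemma
  fixes A :: "'a::chilbert_space \<Rightarrow>\<^sub>L 'a"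
  assumes A: "pos_op A" "complex_linear A"
  shows sqrt_op_square: "sqrt_op A o\<^sub>L sqrt_op A = A"
    and pos_op_sqrt_op: "pos_op (sqrt_op A)"
    and complex_linear_sqrt_op: "complex_linear (sqrt_op A)"
proof -
  let ?R = "power_op A (1/2)"
  have R: "pos_op ?R" "complex_linear ?R" "?R o\<^sub>L ?R = A"
    using pos_op_power_op[OF A(1)] complex_linear_power_op[OF A] power_op_add[OF A(1), of "1/2" "1/2"]
      power_op_1[OF A(1)] by auto
  have "C = ?R" if C: "positive_op C" "C o\<^sub>L C = A" for C
  proof -
    have Cp: "pos_op C" using C positive_op_iff by blast
    \<comment> \<open>Ensures that x^2 lies in the interval of approximation whenever x is in
      [0, ||C||].\<close>
    have "(norm C)\<^sup>2 \<le> norm A"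
    proof -
      have "norm C \<le> sqrt (norm A)"
      proof (rule norm_blinfun_bound)
        fix x
        have "(norm (C x))\<^sup>2 = inner (A x) x"
          using sym_opD[OF pos_op_sym[OF Cp]] by (simp add: power2_norm_eq_inner C(2)[symmetric])
        also have "\<dots> \<le> norm (A x) * norm x" by (rule norm_cauchy_schwarz)
        also have "\<dots> \<le> norm A * norm x * norm x" by (intro mult_right_mono norm_blinfun) auto
        also have "\<dots> = (sqrt (norm A) * norm x)\<^sup>2" by (simp add: power2_eq_square)
        finally show "norm (C x) \<le> sqrt (norm A) * norm x" by (rule power2_le_imp_le) simp
      qed simp
      then show ?thesis using real_le_rsqrt sqrt_le_D by (metis norm_ge_zero power_mono real_sqrt_pow2)
    qed
    then have sq: "x\<^sup>2 \<in> {0..norm A}" if "x \<in> {0..norm C}" for x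
      using that by (auto intro: order_trans[OF power_mono])
    obtain p where p: "uniform_limit {0..norm A} (\<lambda>n. poly (p n)) (\<lambda>x. x powr (1/2)) sequentially"
      "(\<lambda>n. poly_op (p n) A) \<longlonglongrightarrow> ?R" using power_op_approx[OF A(1), of "1/2"] by auto
    define q where "q n = pcompose (p n) ([:0, 1:] * [:0, 1:])" for n
    have "uniform_limit {0..norm C} (\<lambda>n. poly (q n)) (\<lambda>x. x) sequentially"
    proof (rule uniform_limitI)
      fix e :: real assume "e > 0"
      then have "\<forall>\<^sub>F n in sequentially. \<forall>x\<in>{0..norm A}. dist (poly (p n) x) (x powr (1/2)) < e"
        using uniform_limitD[OF p(1)] by auto
      then show "\<forall>\<^sub>F n in sequentially. \<forall>x\<in>{0..norm C}. dist (poly (q n) x) x < e"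
      proof eventually_elim
        case (elim n)
        show ?case
        proof
          fix x assume x: "x \<in> {0..norm C}"
          have "dist (poly (p n) (x\<^sup>2)) ((x\<^sup>2) powr (1/2)) < e" using elim sq[OF x] by blast
          moreover have "(x\<^sup>2) powr (1/2) = x" using x by (simp add: powr_half_sqrt)
          ultimately show "dist (poly (q n) x) x < e"
            by (simp add: q_def poly_pcompose power2_eq_square)
        qed
      qed
    qed
    moreover have "uniform_limit {0..norm C} (\<lambda>n. poly [:0, 1:]) (\<lambda>x. x) sequentially"
      by (rule uniform_limitI) (auto simp: eventually_sequentially)
    ultimately have "(\<lambda>n. poly_op (q n) C - poly_op [:0, 1:] C) \<longlonglongrightarrow> 0"
      by (rule poly_op_diff_tendsto[OF Cp])
    moreover have "poly_op (q n) C = poly_op (p n) A" for n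
      using C(2) by (simp only: q_def poly_op_pcompose poly_op_mult poly_op_X)
    ultimately have "(\<lambda>n. poly_op (p n) A - C) \<longlonglongrightarrow> 0" by simp
    then have "(\<lambda>n. poly_op (p n) A) \<longlonglongrightarrow> C" by (simp add: LIM_zero_iff)
    then show "C = ?R" using p(2) LIMSEQ_unique by blast
  qed
  then have sqrt: "sqrt_op A = ?R"
    unfolding sqrt_op_def using R positive_op_iff by (intro the_equality) blast+
  show "sqrt_op A o\<^sub>L sqrt_op A = A" "pos_op (sqrt_op A)" "complex_linear (sqrt_op A)"
    unfolding sqrt by (fact R)+
qed

section \<open>Polar decomposition of operator tuples\<close>

definition complex_linear_tuple :: "('a::chilbert_space, 'd) op_tuple \<Rightarrow> bool" where
  "complex_linear_tuple T \<longleftrightarrow> (\<forall>i. complex_linear (T i))"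

lemma complex_linear_tupleD: "complex_linear_tuple T \<Longrightarrow> complex_linear (T i)"
  by (simp add: complex_linear_tuple_def)

lemma inner_gram:
  fixes T :: "('a::chilbert_space, 'd::finite) op_tuple"
  assumes T: "complex_linear_tuple T"
  shows "inner ((\<Sum>i\<in>UNIV. adj (T i) o\<^sub>L T i) x) y = (\<Sum>i\<in>UNIV. inner (T i x) (T i y))"
  by (simp add: blinfun.sum_left inner_sum_left inner_adj_left complex_linear_tupleD[OF T])

lemma
  fixes T :: "('a::chilbert_space, 'd::finite) op_tuple"
  assumes T: "complex_linear_tuple T"
  shows pos_op_modulus: "pos_op (modulus T)"
    and complex_linear_modulus: "complex_linear (modulus T)"
    and norm_modulus: "(norm (modulus T x))\<^sup>2 = (\<Sum>i\<in>UNIV. (norm (T i x))\<^sup>2)"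
proof -
  let ?G = "\<Sum>i\<in>UNIV. adj (T i) o\<^sub>L T i"
  have "inner (?G x) y = inner x (?G y)" for x y
    unfolding inner_commute[of x] inner_gram[OF T] by (simp only: inner_commute)
  moreover have "0 \<le> inner (?G x) x" for x
    unfolding inner_gram[OF T] by (intro sum_nonneg) simp
  ultimately have G: "pos_op ?G" by (simp only: pos_op_def sym_op_def) blast
  have Gc: "complex_linear ?G"
    by (intro complex_linear_sum complex_linear_compose complex_linear_adj complex_linear_tupleD[OF T])
  show P: "pos_op (modulus T)" "complex_linear (modulus T)"
    unfolding modulus_def by (rule pos_op_sqrt_op[OF G Gc], rule complex_linear_sqrt_op[OF G Gc])
  have "modulus T (modulus T x) = ?G x"
    using arg_cong[OF sqrt_op_square[OF G Gc], of "\<lambda>A. blinfun_apply A x"]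
    by (simp only: modulus_def blinfun_apply_blinfun_compose)
  then have "inner (modulus T x) (modulus T x) = inner (?G x) x"
    using sym_opD[OF pos_op_sym[OF P(1)], of "modulus T x" x] by simp
  then show "(norm (modulus T x))\<^sup>2 = (\<Sum>i\<in>UNIV. (norm (T i x))\<^sup>2)"
    by (simp only: inner_gram[OF T] power2_norm_eq_inner)
qed

section \<open>Existence and uniqueness of the polar factor\<close>

lemma subspace_closure:
  fixes S :: "'a::real_normed_vector set"
  assumes S: "subspace S"
  shows "subspace (closure S)"
proof (rule subspaceI)
  show "0 \<in> closure S" using subspace_0[OF S] closure_subset by blast
next
  fix x y assume "x \<in> closure S" "y \<in> closure S"
  then obtain u v where "\<And>n. u n \<in> S" "u \<longlonglongrightarrow> x" "\<And>n. v n \<in> S" "v \<longlonglongrightarrow> y"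
    unfolding closure_sequential by blast
  then have "\<And>n. u n + v n \<in> S" "(\<lambda>n. u n + v n) \<longlonglongrightarrow> x + y"
    by (auto intro: subspace_add[OF S] tendsto_add)
  then show "x + y \<in> closure S" unfolding closure_sequential by (intro exI[of _ "\<lambda>n. u n + v n"]) blast
next
  fix c x assume "x \<in> closure S"
  then obtain u where "\<And>n. u n \<in> S" "u \<longlonglongrightarrow> x"
    unfolding closure_sequential by blast
  then have "\<And>n. c *\<^sub>R u n \<in> S" "(\<lambda>n. c *\<^sub>R u n) \<longlonglongrightarrow> c *\<^sub>R x"
    by (auto intro: subspace_scale[OF S] tendsto_scaleR)
  then show "c *\<^sub>R x \<in> closure S" unfolding closure_sequential by (intro exI[of _ "\<lambda>n. c *\<^sub>R u n"]) blast
qed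

text \<open>Every vector splits into one in the closure of \<open>range P\<close> and one orthogonal
  to it. Uniqueness and complex linearity of the polar factor are both checked on these two
  parts.\<close>

lemma bounded_linear_eqI_range:
  fixes P :: "'a::{real_inner, complete_space} \<Rightarrow>\<^sub>L 'a" and f g :: "'a \<Rightarrow> 'b::real_normed_vector"
  assumes f: "bounded_linear f" and g: "bounded_linear g"
    and range: "\<And>x. f (P x) = g (P x)"
    and orth: "\<And>x. (\<And>u. inner x (P u) = 0) \<Longrightarrow> f x = g x"
  shows "f x = g x"
proof -
  let ?S = "closure (range P)"
  have S: "subspace ?S"
    by (intro subspace_closure linear_subspace_image bounded_linear.linear[OF blinfun.bounded_linear_right] subspace_UNIV)
  obtain p where p: "p \<in> ?S" "\<And>s. s \<in> ?S \<Longrightarrow> inner (x - p) s = 0"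
    using orthogonal_projection_exists[OF S closed_closure, of x] by blast
  have "?S \<subseteq> {y. f y = g y}"
    by (rule closure_minimal)
      (use range in \<open>auto intro!: closed_Collect_eq linear_continuous_on f g\<close>)
  then have "f p = g p" using p(1) by blast
  moreover have "f (x - p) = g (x - p)"
    by (rule orth, rule p(2)) (use closure_subset[of "range P"] in auto)
  ultimately have "f (p + (x - p)) = g (p + (x - p))"
    by (simp only: linear_add[OF bounded_linear.linear[OF f]] linear_add[OF bounded_linear.linear[OF g]])
  then show ?thesis by simp
qed

text \<open>W sends P x to F x, is extended by limits to the closure of \<open>range P\<close> and
  by zero to the orthogonal complement. The last clause says that \<open>norm (W x)\<close> is the
  norm of the projection of x; the kernel and the partial isometry property are read off from
  it.\<close>

lemma isometric_factorization:
  fixes P :: "'a::{real_inner, complete_space} \<Rightarrow>\<^sub>L 'a" and F :: "'a \<Rightarrow> 'b::banach"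
  assumes F: "bounded_linear F" and FP: "\<And>x. norm (F x) = norm (P x)"
  shows "\<exists>W. bounded_linear W \<and> (\<forall>x. W (P x) = F x) \<and>
    (\<forall>x p. p \<in> closure (range P) \<longrightarrow> (\<forall>s\<in>closure (range P). inner (x - p) s = 0) \<longrightarrow> norm (W x) = norm p)"
proof -
  interpret F: bounded_linear F by (rule F)
  let ?S = "closure (range P)"
  have S: "subspace ?S"
    by (intro subspace_closure linear_subspace_image bounded_linear.linear[OF blinfun.bounded_linear_right] subspace_UNIV)
  have dist: "dist (F u) (F v) = dist (P u) (P v)" for u v
    using FP[of "u - v"] by (simp add: dist_norm F.diff blinfun.diff_right)
  have seq: "\<exists>u. (\<lambda>n. P (u n)) \<longlonglongrightarrow> p" if p: "p \<in> ?S" for p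
  proof -
    obtain y where y: "\<forall>n. y n \<in> range P" "y \<longlonglongrightarrow> p"
      using p unfolding closure_sequential by auto
    then have "\<forall>n. \<exists>u. y n = P u" by (simp add: image_iff)
    from choice[OF this] obtain u where "\<forall>n. y n = P (u n)" ..
    then have "y = (\<lambda>n. P (u n))" by (simp add: fun_eq_iff)
    then show ?thesis using y(2) by (intro exI[of _ u]) simp
  qed
  have "\<exists>v. \<forall>u. (\<lambda>n. P (u n)) \<longlonglongrightarrow> p \<longrightarrow> (\<lambda>n. F (u n)) \<longlonglongrightarrow> v" if "p \<in> ?S" for p
  proof -
    obtain u0 where u0: "(\<lambda>n. P (u0 n)) \<longlonglongrightarrow> p" using seq \<open>p \<in> ?S\<close> by blast
    have "Cauchy (\<lambda>n. F (u0 n))"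
      using LIMSEQ_imp_Cauchy[OF u0] by (simp add: Cauchy_def dist)
    then obtain v where v: "(\<lambda>n. F (u0 n)) \<longlonglongrightarrow> v" using Cauchy_convergent convergent_def by blast
    have "(\<lambda>n. F (u n)) \<longlonglongrightarrow> v" if u: "(\<lambda>n. P (u n)) \<longlonglongrightarrow> p" for u
    proof -
      have "(\<lambda>n. dist (F (u n)) (F (u0 n))) \<longlonglongrightarrow> dist p p"
        unfolding dist by (intro tendsto_dist u u0)
      then have "(\<lambda>n. F (u n) - F (u0 n)) \<longlonglongrightarrow> 0" by (simp add: dist_norm tendsto_norm_zero_iff)
      from tendsto_add[OF this v] show ?thesis by simp
    qed
    then show ?thesis by blast
  qed
  then have "\<forall>p. \<exists>v. p \<in> ?S \<longrightarrow> (\<forall>u. (\<lambda>n. P (u n)) \<longlonglongrightarrow> p \<longrightarrow> (\<lambda>n. F (u n)) \<longlonglongrightarrow> v)" by blast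
  from choice[OF this] obtain W0
    where W0: "\<And>p u. p \<in> ?S \<Longrightarrow> (\<lambda>n. P (u n)) \<longlonglongrightarrow> p \<Longrightarrow> (\<lambda>n. F (u n)) \<longlonglongrightarrow> W0 p" by blast
  have W0_add: "W0 (p + q) = W0 p + W0 q" if p: "p \<in> ?S" and q: "q \<in> ?S" for p q
  proof -
    obtain u v where u: "(\<lambda>n. P (u n)) \<longlonglongrightarrow> p" and v: "(\<lambda>n. P (v n)) \<longlonglongrightarrow> q" using seq p q by blast
    have "(\<lambda>n. P (u n + v n)) \<longlonglongrightarrow> p + q" unfolding blinfun.add_right by (intro tendsto_add u v)
    then have "(\<lambda>n. F (u n + v n)) \<longlonglongrightarrow> W0 (p + q)" by (rule W0[OF subspace_add[OF S p q]])
    moreover have "(\<lambda>n. F (u n + v n)) \<longlonglongrightarrow> W0 p + W0 q"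
      unfolding F.add by (intro tendsto_add W0 p q u v)
    ultimately show ?thesis by (rule LIMSEQ_unique)
  qed
  have W0_scale: "W0 (r *\<^sub>R p) = r *\<^sub>R W0 p" if p: "p \<in> ?S" for r p
  proof -
    obtain u where u: "(\<lambda>n. P (u n)) \<longlonglongrightarrow> p" using seq p by blast
    have "(\<lambda>n. P (r *\<^sub>R u n)) \<longlonglongrightarrow> r *\<^sub>R p" unfolding blinfun.scaleR_right by (intro tendsto_intros u)
    then have "(\<lambda>n. F (r *\<^sub>R u n)) \<longlonglongrightarrow> W0 (r *\<^sub>R p)" by (rule W0[OF subspace_scale[OF S p]])
    moreover have "(\<lambda>n. F (r *\<^sub>R u n)) \<longlonglongrightarrow> r *\<^sub>R W0 p"
      unfolding F.scaleR by (intro tendsto_intros W0 p u)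
    ultimately show ?thesis by (rule LIMSEQ_unique)
  qed
  have W0_norm: "norm (W0 p) = norm p" if p: "p \<in> ?S" for p
  proof -
    obtain u where u: "(\<lambda>n. P (u n)) \<longlonglongrightarrow> p" using seq p by blast
    have "(\<lambda>n. norm (F (u n))) \<longlonglongrightarrow> norm (W0 p)" by (intro tendsto_norm W0 p u)
    moreover have "(\<lambda>n. norm (F (u n))) \<longlonglongrightarrow> norm p" unfolding FP by (intro tendsto_norm u)
    ultimately show ?thesis by (rule LIMSEQ_unique)
  qed
  have "\<forall>x. \<exists>p. p \<in> ?S \<and> (\<forall>s\<in>?S. inner (x - p) s = 0)"
    using orthogonal_projection_exists[OF S closed_closure] by blast
  from choice[OF this] obtain pr
    where prS: "\<And>x. pr x \<in> ?S" and pr: "\<And>x s. s \<in> ?S \<Longrightarrow> inner (x - pr x) s = 0" by blast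
  have pr_unique: "pr x = p" if p: "p \<in> ?S" "\<And>s. s \<in> ?S \<Longrightarrow> inner (x - p) s = 0" for x p
  proof -
    have d: "pr x - p \<in> ?S" using subspace_diff[OF S prS p(1)] .
    have "inner (pr x - p) (pr x - p) = inner (x - p) (pr x - p) - inner (x - pr x) (pr x - p)"
      by (simp add: inner_diff_left)
    also have "\<dots> = 0" using p(2)[OF d] pr[OF d] by simp
    finally show ?thesis by simp
  qed
  have pr_add: "pr (x + y) = pr x + pr y" for x y
    by (rule pr_unique) (use pr[of _ x] pr[of _ y] in
      \<open>auto simp: inner_diff_left inner_add_left intro!: subspace_add[OF S] prS\<close>)
  have pr_scale: "pr (r *\<^sub>R x) = r *\<^sub>R pr x" for r x
    by (rule pr_unique) (use pr[of _ x] in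
      \<open>auto simp: inner_diff_left intro!: subspace_scale[OF S] prS\<close>)
  have pr_le: "norm (pr x) \<le> norm x" for x
  proof -
    have "(norm (pr x))\<^sup>2 = inner x (pr x)"
      using pr[OF prS, of x x] by (simp add: power2_norm_eq_inner inner_diff_left)
    also have "\<dots> \<le> norm x * norm (pr x)" by (rule norm_cauchy_schwarz)
    finally show ?thesis by (cases "pr x = 0") (auto simp: power2_eq_square)
  qed
  define W where "W x = W0 (pr x)" for x
  have "bounded_linear W"
    by (rule bounded_linear_intro[of _ 1])
      (auto simp: W_def pr_add pr_scale W0_add W0_scale W0_norm prS pr_le)
  moreover have "W (P x) = F x" for x
  proof -
    have PS: "P x \<in> ?S" using closure_subset[of "range P"] by auto
    have "pr (P x) = P x" by (rule pr_unique[OF PS]) simp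
    moreover have "(\<lambda>n. F x) \<longlonglongrightarrow> W0 (P x)" by (rule W0[OF PS, of "\<lambda>_. x"]) simp
    ultimately show ?thesis by (simp add: W_def LIMSEQ_const_iff)
  qed
  moreover have "norm (W x) = norm p"
    if "p \<in> ?S" "\<forall>s\<in>?S. inner (x - p) s = 0" for x p
    using pr_unique[of p x] that by (simp add: W_def W0_norm)
  ultimately show ?thesis by blast
qed

lemma norm_column_op: "(norm (column_op V x))\<^sup>2 = (\<Sum>i\<in>UNIV. (norm (V i x))\<^sup>2)"
  by (simp add: column_op_def norm_vec_def L2_set_def sum_nonneg)

lemma bounded_linear_column_op: "bounded_linear (column_op V)"
proof (rule bounded_linear_intro[of _ "\<Sum>i\<in>UNIV. norm (V i)"])
  show "column_op V (x + y) = column_op V x + column_op V y" for x y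
    by (simp add: column_op_def vec_eq_iff blinfun.add_right)
  show "column_op V (r *\<^sub>R x) = r *\<^sub>R column_op V x" for r x
    by (simp add: column_op_def vec_eq_iff blinfun.scaleR_right)
  show "norm (column_op V x) \<le> norm x * (\<Sum>i\<in>UNIV. norm (V i))" for x
  proof -
    have "norm (column_op V x) \<le> (\<Sum>i\<in>UNIV. norm (V i x))"
      unfolding norm_vec_def by (rule order_trans[OF L2_set_le_sum]) (simp_all add: column_op_def)
    also have "\<dots> \<le> (\<Sum>i\<in>UNIV. norm (V i) * norm x)" by (intro sum_mono norm_blinfun)
    finally show ?thesis by (simp add: sum_distrib_left mult.commute)
  qed
qed

text \<open>Since P is symmetric, its kernel is the orthogonal complement of its range, which is
  where W vanishes. The final clause, contractivity, is added to the properties in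
  \<open>polar_part\<close> for later sums over the index.\<close>

lemma polar_part_exists:
  fixes T :: "('a::chilbert_space, 'd::finite) op_tuple"
  assumes T: "complex_linear_tuple T"
  shows "\<exists>V. (\<forall>i. complex_linear (V i)) \<and>
     (\<forall>x. (\<forall>y. column_op V y = 0 \<longrightarrow> cinner x y = 0) \<longrightarrow> norm (column_op V x) = norm x) \<and>
     {x. column_op V x = 0} = {x. modulus T x = 0} \<and>
     (\<forall>i. T i = V i o\<^sub>L modulus T) \<and> (\<forall>x. norm (column_op V x) \<le> norm x)"
proof -
  define P where "P = modulus T"
  have P: "sym_op P" "complex_linear P"
    using pos_op_sym[OF pos_op_modulus[OF T]] complex_linear_modulus[OF T] by (auto simp: P_def)
  let ?S = "closure (range P)"
  have S: "subspace ?S"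
    by (intro subspace_closure linear_subspace_image bounded_linear.linear[OF blinfun.bounded_linear_right] subspace_UNIV)
  have "(norm (column_op T x))\<^sup>2 = (norm (P x))\<^sup>2" for x
    by (simp only: norm_column_op P_def norm_modulus[OF T])
  then have nP: "norm (column_op T x) = norm (P x)" for x by simp
  obtain W where W: "bounded_linear W" "\<And>x. W (P x) = column_op T x"
    and Wn: "\<And>x p. p \<in> ?S \<Longrightarrow> (\<And>s. s \<in> ?S \<Longrightarrow> inner (x - p) s = 0) \<Longrightarrow> norm (W x) = norm p"
    using isometric_factorization[OF bounded_linear_column_op nP] by blast
  define V where "V i = Blinfun (\<lambda>x. W x $ i)" for i
  have V: "V i x = W x $ i" for i x
    unfolding V_def by (subst bounded_linear_Blinfun_apply) (auto intro: bounded_linear_compose[OF bounded_linear_vec_nth W(1)])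
  have colV: "column_op V x = W x" for x by (simp add: column_op_def V vec_eq_iff)
  have VP: "V i (P x) = T i x" for i x by (simp add: V W(2) column_op_def)
  have zero_iff: "P x = 0 \<longleftrightarrow> (\<forall>u. inner x (P u) = 0)" for x
  proof
    assume "\<forall>u. inner x (P u) = 0"
    then have "inner (P x) (P x) = 0" using sym_opD[OF P(1), of x "P x"] by simp
    then show "P x = 0" by simp
  next
    assume "P x = 0"
    then show "\<forall>u. inner x (P u) = 0" using sym_opD[OF P(1), of x] by simp
  qed
  obtain pr where prS: "\<And>x. pr x \<in> ?S" and pr: "\<And>x s. s \<in> ?S \<Longrightarrow> inner (x - pr x) s = 0"
  proof -
    have "\<forall>x. \<exists>p. p \<in> ?S \<and> (\<forall>s\<in>?S. inner (x - p) s = 0)"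
      using orthogonal_projection_exists[OF S closed_closure] by blast
    from choice[OF this] show ?thesis using that by blast
  qed
  have Wpr: "norm (W x) = norm (pr x)" for x by (rule Wn[OF prS pr])
  have ker: "W x = 0 \<longleftrightarrow> P x = 0" for x
  proof
    assume "W x = 0"
    then have "pr x = 0" using Wpr[of x] by simp
    then have "inner x s = 0" if "s \<in> ?S" for s using pr[OF that, of x] by simp
    then show "P x = 0" unfolding zero_iff using closure_subset[of "range P"] by auto
  next
    assume "P x = 0"
    then have "range P \<subseteq> {s. inner x s = 0}" unfolding zero_iff by blast
    then have "?S \<subseteq> {s. inner x s = 0}"
      by (rule closure_minimal) (intro closed_Collect_eq continuous_intros)
    then have "norm (W x) = norm (0 :: 'a)" by (intro Wn subspace_0[OF S]) auto
    then show "W x = 0" by simp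
  qed
  have cl: "complex_linear (V i)" for i
    unfolding complex_linear_def
  proof (intro allI)
    fix c x
    show "V i (c *\<^sub>C x) = c *\<^sub>C V i x"
    proof (rule bounded_linear_eqI_range[of "\<lambda>x. V i (c *\<^sub>C x)" "\<lambda>x. c *\<^sub>C V i x" P x])
      show "bounded_linear (\<lambda>x. V i (c *\<^sub>C x))" "bounded_linear (\<lambda>x. c *\<^sub>C V i x)"
        by (intro bounded_linear_compose[OF blinfun.bounded_linear_right bounded_linear_scaleC]
            bounded_linear_compose[OF bounded_linear_scaleC blinfun.bounded_linear_right])+
      show "V i (c *\<^sub>C P x) = c *\<^sub>C V i (P x)" for x
        using complex_linearD[OF P(2), of c x] complex_linearD[OF complex_linear_tupleD[OF T], of i c x] by (metis VP)
      show "V i (c *\<^sub>C x) = c *\<^sub>C V i x" if "\<And>u. inner x (P u) = 0" for x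
      proof -
        have "P x = 0" using that zero_iff by blast
        then have "W x = 0" "W (c *\<^sub>C x) = 0" using ker complex_linearD[OF P(2), of c x] by auto
        then show ?thesis by (simp add: V)
      qed
    qed
  qed
  have iso: "norm (column_op V x) = norm x" if x: "\<forall>y. column_op V y = 0 \<longrightarrow> cinner x y = 0" for x
  proof -
    have "P (x - pr x) = 0" unfolding zero_iff
      by (intro allI pr subsetD[OF closure_subset]) simp
    then have "cinner x (x - pr x) = 0" using x ker by (simp add: colV)
    then have "inner x (x - pr x) = 0" by (simp add: inner_eq_Re_cinner)
    then have "inner (x - pr x) (x - pr x) = 0"
      using pr[OF prS, of x x] by (simp add: inner_diff_left inner_diff_right inner_commute)
    then have "x = pr x" by simp
    then show ?thesis using Wpr[of x] by (simp add: colV)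
  qed
  have le: "norm (column_op V x) \<le> norm x" for x
  proof -
    have "(norm (pr x))\<^sup>2 = inner x (pr x)"
      using pr[OF prS, of x x] by (simp add: power2_norm_eq_inner inner_diff_left)
    also have "\<dots> \<le> norm x * norm (pr x)" by (rule norm_cauchy_schwarz)
    finally have "norm (pr x) \<le> norm x" by (cases "pr x = 0") (auto simp: power2_eq_square)
    then show ?thesis by (simp add: colV Wpr)
  qed
  show ?thesis
    using cl iso le ker by (intro exI[of _ V]) (auto simp: colV P_def[symmetric] blinfun_eqI VP)
qed

lemma
  fixes T :: "('a::chilbert_space, 'd::finite) op_tuple"
  assumes T: "complex_linear_tuple T"
  shows complex_linear_polar_part: "complex_linear_tuple (polar_part T)"
    and polar_part_modulus: "polar_part T i o\<^sub>L modulus T = T i"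
    and polar_part_contraction: "(\<Sum>i\<in>UNIV. (norm (polar_part T i x))\<^sup>2) \<le> (norm x)\<^sup>2"
proof -
  obtain V where V: "(\<forall>i. complex_linear (V i)) \<and>
     (\<forall>x. (\<forall>y. column_op V y = 0 \<longrightarrow> cinner x y = 0) \<longrightarrow> norm (column_op V x) = norm x) \<and>
     {x. column_op V x = 0} = {x. modulus T x = 0} \<and>
     (\<forall>i. T i = V i o\<^sub>L modulus T)" and le: "\<And>x. norm (column_op V x) \<le> norm x"
    using polar_part_exists[OF T] by blast
  have "polar_part T = V"
    unfolding polar_part_def
  proof (rule the_equality)
    fix U assume U: "(\<forall>i. complex_linear (U i)) \<and>
     (\<forall>x. (\<forall>y. column_op U y = 0 \<longrightarrow> cinner x y = 0) \<longrightarrow> norm (column_op U x) = norm x) \<and>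
     {x. column_op U x = 0} = {x. modulus T x = 0} \<and>
     (\<forall>i. T i = U i o\<^sub>L modulus T)"
    show "U = V"
    proof (rule ext, rule blinfun_eqI)
      fix i x
      show "U i x = V i x"
      proof (rule bounded_linear_eqI_range[of "U i" "V i" "modulus T"])
        show "U i (modulus T x) = V i (modulus T x)" for x
          using U V by (metis blinfun_apply_blinfun_compose)
        show "U i x = V i x" if "\<And>u. inner x (modulus T u) = 0" for x
        proof -
          have "inner (modulus T x) (modulus T x) = 0"
            using that sym_opD[OF pos_op_sym[OF pos_op_modulus[OF T]], of x "modulus T x"] by simp
          then have "modulus T x = 0" by simp
          then have "column_op U x = 0" "column_op V x = 0" using U V by blast+
          then show ?thesis by (simp add: column_op_def vec_eq_iff)
        qed
      qed (rule blinfun.bounded_linear_right)+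
    qed
  qed (rule V)
  then show "complex_linear_tuple (polar_part T)" "polar_part T i o\<^sub>L modulus T = T i"
    "(\<Sum>i\<in>UNIV. (norm (polar_part T i x))\<^sup>2) \<le> (norm x)\<^sup>2"
    using V le by (simp_all add: complex_linear_tuple_def norm_column_op[symmetric] power_mono)
qed

section \<open>Column norms\<close>

text \<open>Operator norm of the column into the direct sum of copies of H. The ball, unlike the
  sphere, is nonempty even in the zero space.\<close>

definition col_norm :: "'j set \<Rightarrow> ('j \<Rightarrow> ('a::chilbert_space \<Rightarrow>\<^sub>L 'a)) \<Rightarrow> real" where
  "col_norm I X = (SUP x\<in>cball 0 1. L2_set (\<lambda>j. norm (X j x)) I)"

lemma col_norm_bdd: "bdd_above ((\<lambda>x. L2_set (\<lambda>j. norm (blinfun_apply (X j) x)) I) ` cball 0 1)"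
proof (rule bdd_aboveI2)
  fix x :: 'a assume x: "x \<in> cball 0 1"
  have "L2_set (\<lambda>j. norm (X j x)) I \<le> (\<Sum>j\<in>I. norm (X j x))" by (rule L2_set_le_sum) simp
  also have "\<dots> \<le> (\<Sum>j\<in>I. norm (X j) * 1)"
    using x by (intro sum_mono order_trans[OF norm_blinfun] mult_left_mono) auto
  finally show "L2_set (\<lambda>j. norm (X j x)) I \<le> (\<Sum>j\<in>I. norm (X j) * 1)" .
qed

lemma col_norm_nonneg: "0 \<le> col_norm I X"
  unfolding col_norm_def by (rule cSUP_upper2[OF col_norm_bdd, of 0]) (auto simp: L2_set_nonneg)

lemma L2_col_le: "L2_set (\<lambda>j. norm (blinfun_apply (X j) x)) I \<le> col_norm I X * norm x"
proof (cases "x = 0")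
  case False
  have "L2_set (\<lambda>j. norm (X j ((1 / norm x) *\<^sub>R x))) I \<le> col_norm I X"
    unfolding col_norm_def by (rule cSUP_upper[OF _ col_norm_bdd]) (use False in simp)
  also have "L2_set (\<lambda>j. norm (X j ((1 / norm x) *\<^sub>R x))) I = L2_set (\<lambda>j. (1 / norm x) * norm (X j x)) I"
    by (simp add: blinfun.scaleR_right)
  also have "\<dots> = (1 / norm x) * L2_set (\<lambda>j. norm (X j x)) I"
    by (rule L2_set_right_distrib[symmetric]) simp
  finally show ?thesis using False by (simp add: divide_le_eq)
qed (simp add: L2_set_def)

lemma sum_col_le: "(\<Sum>j\<in>I. (norm (blinfun_apply (X j) x))\<^sup>2) \<le> (col_norm I X)\<^sup>2 * (norm x)\<^sup>2"
proof -
  have "(L2_set (\<lambda>j. norm (X j x)) I)\<^sup>2 \<le> (col_norm I X * norm x)\<^sup>2"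
    by (rule power_mono[OF L2_col_le L2_set_nonneg])
  then show ?thesis by (simp add: L2_set_def sum_nonneg power_mult_distrib)
qed

lemma col_norm_le:
  assumes "0 \<le> c" and "\<And>x. (\<Sum>j\<in>I. (norm (blinfun_apply (X j) x))\<^sup>2) \<le> c\<^sup>2 * (norm x)\<^sup>2"
  shows "col_norm I X \<le> c"
  unfolding col_norm_def
proof (rule cSUP_least)
  fix x :: 'a assume x: "x \<in> cball 0 1"
  have "(\<Sum>j\<in>I. (norm (X j x))\<^sup>2) \<le> c\<^sup>2 * (norm x)\<^sup>2" by (rule assms)
  also have "\<dots> \<le> c\<^sup>2 * 1" using x by (intro mult_left_mono) (auto simp: power_le_one)
  finally have "(\<Sum>j\<in>I. (norm (X j x))\<^sup>2) \<le> c\<^sup>2" by simp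
  then show "L2_set (\<lambda>j. norm (X j x)) I \<le> c"
    unfolding L2_set_def using assms(1) by (simp add: real_le_lsqrt sum_nonneg)
qed auto

section \<open>Interpolation\<close>

definition op_pow :: "('a::real_normed_vector \<Rightarrow>\<^sub>L 'a) \<Rightarrow> nat \<Rightarrow> ('a \<Rightarrow>\<^sub>L 'a)" where
  "op_pow Z n = ((o\<^sub>L) Z ^^ n) id_blinfun"

lemma op_pow_0 [simp]: "op_pow Z 0 = id_blinfun"
  and op_pow_Suc: "op_pow Z (Suc n) = Z o\<^sub>L op_pow Z n"
  by (simp_all add: op_pow_def)

lemma norm_op_pow_le: "norm (op_pow Z n) \<le> norm Z ^ n"
proof (induction n)
  case (Suc n)
  have "norm (op_pow Z (Suc n)) \<le> norm Z * norm (op_pow Z n)"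
    unfolding op_pow_Suc by (rule norm_blinfun_compose)
  also have "\<dots> \<le> norm Z * norm Z ^ n" by (intro mult_left_mono Suc) simp
  finally show ?case by simp
qed (simp add: norm_blinfun_id_le)

lemma op_pow_square: "op_pow (Z o\<^sub>L Z) n = op_pow Z (2 * n)"
  by (induction n) (simp_all add: op_pow_Suc blinfun_compose_assoc)

lemma norm_square_sym_op:
  fixes Z :: "'a::chilbert_space \<Rightarrow>\<^sub>L 'a"
  assumes "sym_op Z"
  shows "(norm Z)\<^sup>2 \<le> norm (Z o\<^sub>L Z)"
proof -
  have "norm Z \<le> sqrt (norm (Z o\<^sub>L Z))"
  proof (rule norm_blinfun_bound)
    fix x
    have "(norm (Z x))\<^sup>2 = inner ((Z o\<^sub>L Z) x) x"
      using sym_opD[OF assms] by (simp add: power2_norm_eq_inner)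
    also have "\<dots> \<le> norm ((Z o\<^sub>L Z) x) * norm x" by (rule norm_cauchy_schwarz)
    also have "\<dots> \<le> norm (Z o\<^sub>L Z) * norm x * norm x" by (intro mult_right_mono norm_blinfun) auto
    also have "\<dots> = (sqrt (norm (Z o\<^sub>L Z)) * norm x)\<^sup>2" by (simp add: power2_eq_square)
    finally show "norm (Z x) \<le> sqrt (norm (Z o\<^sub>L Z)) * norm x" by (rule power2_le_imp_le) simp
  qed simp
  then have "(norm Z)\<^sup>2 \<le> (sqrt (norm (Z o\<^sub>L Z)))\<^sup>2" by (rule power_mono) simp
  then show ?thesis by simp
qed

lemma norm_power_sym_op:
  fixes Z :: "'a::chilbert_space \<Rightarrow>\<^sub>L 'a"
  assumes "sym_op Z"
  shows "norm Z ^ (2 ^ m) \<le> norm (op_pow Z (2 ^ m))"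
  using assms
proof (induction m arbitrary: Z)
  case 0
  then show ?case by (simp add: op_pow_Suc)
next
  case (Suc m)
  have "sym_op (Z o\<^sub>L Z)" using Suc.prems by (simp add: sym_op_def)
  note IH = Suc.IH[OF this]
  have "norm Z ^ (2 ^ Suc m) = ((norm Z)\<^sup>2) ^ (2 ^ m)" by (simp add: power_mult)
  also have "\<dots> \<le> norm (Z o\<^sub>L Z) ^ (2 ^ m)"
    by (intro power_mono norm_square_sym_op Suc.prems) simp
  also have "\<dots> \<le> norm (op_pow Z (2 ^ Suc m))" using IH by (simp add: op_pow_square)
  finally show ?case .
qed

text \<open>For symmetric Z the norm is determined by the powers Z^(2^m), so constants are lost in
  the limit. The shift by 2 leaves room for one unmatched factor at either end of the power.\<close>

lemma norm_sym_op_le_of_powers: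
  fixes Z :: "'a::chilbert_space \<Rightarrow>\<^sub>L 'a"
  assumes Z: "sym_op Z" and M: "0 \<le> M" and bound: "\<And>n. norm (op_pow Z (n + 2)) \<le> C * M ^ n"
  shows "norm Z \<le> M"
proof (rule ccontr)
  assume "\<not> norm Z \<le> M"
  then have ZM: "M < norm Z" by simp
  then have Z0: "norm Z > 0" using M by linarith
  have le: "norm Z ^ (2 ^ Suc m) \<le> C * M ^ (2 ^ Suc m - 2)" for m
  proof -
    have "(2::nat) \<le> 2 ^ Suc m" by simp
    then have "(2::nat) ^ Suc m - 2 + 2 = 2 ^ Suc m" by (rule le_add_diff_inverse2)
    then show ?thesis using norm_power_sym_op[OF Z, of "Suc m"] bound[of "2 ^ Suc m - 2"]
      by (metis order_trans)
  qed
  show False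
  proof (cases "M = 0")
    case True
    then show False using le[of 1] Z0 by (simp add: not_less[symmetric])
  next
    case False
    then have M0: "M > 0" using M by simp
    define q where "q = norm Z / M"
    have q1: "q > 1" using ZM M0 by (simp add: q_def)
    have qm: "q ^ m \<le> C / M\<^sup>2" for m
    proof -
      have "m \<le> 2 ^ Suc m" by (rule less_imp_le) (induction m, auto)
      then have "q ^ m \<le> q ^ (2 ^ Suc m)" using q1 by (intro power_increasing) auto
      also have "\<dots> = norm Z ^ (2 ^ Suc m) / M ^ (2 ^ Suc m)" by (simp only: q_def power_divide)
      also have "\<dots> \<le> (C * M ^ (2 ^ Suc m - 2)) / M ^ (2 ^ Suc m)"
        using le M0 by (intro divide_right_mono) auto
      also have "M ^ (2 ^ Suc m) = M ^ (2 ^ Suc m - 2) * M\<^sup>2"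
        by (subst power_add[symmetric], subst le_add_diff_inverse2) simp_all
      finally show ?thesis using M0 by simp
    qed
    obtain m where "C / M\<^sup>2 < q ^ m" using real_arch_pow[OF q1] by blast
    then show False using qm[of m] by simp
  qed
qed

locale column =
  fixes P :: "'a::chilbert_space \<Rightarrow>\<^sub>L 'a" and I :: "'j set" and X :: "'j \<Rightarrow> ('a \<Rightarrow>\<^sub>L 'a)"
  assumes P: "pos_op P" and X: "\<And>j. complex_linear (X j)"
begin

definition \<phi> :: "real \<Rightarrow> real \<Rightarrow> real" where
  "\<phi> a b = col_norm I (\<lambda>j. power_op P a o\<^sub>L X j o\<^sub>L power_op P b)"

lemma \<phi>_nonneg: "0 \<le> \<phi> a b"
  by (simp add: \<phi>_def col_norm_nonneg)

text \<open>The square of the left-hand side is the norm of the selfadjoint \<open>P\<^sup>b\<^sup>1 G P\<^sup>b\<^sup>1\<close> with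
  \<open>b\<^sub>1 = (b + b') / 2\<close>, which is the spectral radius of \<open>P\<^sup>b\<^sup>' G P\<^sup>b\<close>.\<close>

lemma \<phi>_midpoint:
  assumes nn: "0 \<le> a" "0 \<le> b" "0 \<le> a'" "0 \<le> b'"
  shows "(\<phi> ((a + a') / 2) ((b + b') / 2))\<^sup>2 \<le> \<phi> a b * \<phi> a' b'"
proof -
  define a1 b1 where "a1 = (a + a') / 2" and "b1 = (b + b') / 2"
  define W where "W s = power_op P s" for s
  have nn1: "0 \<le> a1" "0 \<le> b1" using nn by (auto simp: a1_def b1_def)
  have Wadd: "W s (W r x) = W (s + r) x" if "0 \<le> s" "0 \<le> r" for s r x
    using power_op_add[OF P that] by (simp add: W_def)
  have Wsym: "inner (W s x) y = inner x (W s y)" if "0 \<le> s" for s x y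
    using sym_opD[OF sym_op_power_op[OF P that]] by (simp add: W_def)
  \<comment> \<open>G depends on a and a' only through their sum. Hence the middle power may be
    shared evenly in Z, but as a and a' in E, where Cauchy-Schwarz then produces the two corner
    values.\<close>
  define G where "G = (\<Sum>j\<in>I. adj (X j) o\<^sub>L W (a1 + a1) o\<^sub>L X j)"
  define Z where "Z = W b1 o\<^sub>L G o\<^sub>L W b1"
  define E where "E = W b' o\<^sub>L G o\<^sub>L W b"
  have G_inner: "inner (G x) y = (\<Sum>j\<in>I. inner (W (c + d) (X j x)) (X j y))" if "c + d = a1 + a1" for c d x y
    by (simp add: G_def that blinfun.sum_left inner_sum_left inner_adj_left X)
  have G_split: "inner (G x) y = (\<Sum>j\<in>I. inner (W c (X j x)) (W d (X j y)))"
    if "c + d = a1 + a1" "0 \<le> c" "0 \<le> d" for c d x y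
  proof -
    have "inner (W (c + d) u) v = inner (W c u) (W d v)" for u v
      using that by (simp add: Wsym[of d, symmetric] Wadd add.commute)
    then show ?thesis by (simp add: G_inner[OF that(1)])
  qed
  have "sym_op G"
    unfolding sym_op_def
  proof (intro allI)
    fix x y
    show "inner (G x) y = inner x (G y)"
      using G_split[of a1 a1 x y] G_split[of a1 a1 y x] nn1 by (simp add: inner_commute)
  qed
  then have symZ: "sym_op Z" using nn1 by (simp add: sym_op_def Z_def Wsym)
  have "norm E \<le> \<phi> a b * \<phi> a' b'"
  proof (rule norm_blinfun_bound)
    fix x
    have ineq: "inner (E x) y \<le> (\<phi> a b * norm x) * (\<phi> a' b' * norm y)" for y
    proof -
      have "inner (E x) y = (\<Sum>j\<in>I. inner (W a (X j (W b x))) (W a' (X j (W b' y))))"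
        using nn G_split[of a a' "W b x" "W b' y"] by (simp add: E_def Wsym a1_def)
      also have "\<dots> \<le> (\<Sum>j\<in>I. \<bar>norm (W a (X j (W b x)))\<bar> * \<bar>norm (W a' (X j (W b' y)))\<bar>)"
        by (intro sum_mono) (simp add: norm_cauchy_schwarz)
      also have "\<dots> \<le> L2_set (\<lambda>j. norm (W a (X j (W b x)))) I * L2_set (\<lambda>j. norm (W a' (X j (W b' y)))) I"
        by (rule L2_set_mult_ineq)
      also have "\<dots> \<le> (\<phi> a b * norm x) * (\<phi> a' b' * norm y)"
        using L2_col_le[of "\<lambda>j. W a o\<^sub>L X j o\<^sub>L W b" x I] L2_col_le[of "\<lambda>j. W a' o\<^sub>L X j o\<^sub>L W b'" y I]
        by (intro mult_mono) (auto simp: \<phi>_def W_def L2_set_nonneg col_norm_nonneg)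
      finally show ?thesis .
    qed
    show "norm (E x) \<le> \<phi> a b * \<phi> a' b' * norm x"
    proof (cases "E x = 0")
      case False
      have "norm (E x) * norm (E x) \<le> (\<phi> a b * \<phi> a' b' * norm x) * norm (E x)"
        using ineq[of "E x"] by (simp add: power2_norm_eq_inner[symmetric] power2_eq_square mult_ac)
      then show ?thesis using False by (simp add: mult_le_cancel_right)
    qed (simp add: \<phi>_nonneg)
  qed (simp add: \<phi>_nonneg)
  moreover have "norm Z \<le> norm E"
  proof (rule norm_sym_op_le_of_powers[OF symZ norm_ge_zero])
    fix n
    let ?L = "W b1 o\<^sub>L G o\<^sub>L W b" and ?R = "W b' o\<^sub>L G o\<^sub>L W b1"
    have WW: "W b1 (W b1 x) = W b (W b' x)" for x using nn nn1 by (simp add: Wadd b1_def)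
    \<comment> \<open>Each inner P^b1 P^b1 is rewritten as P^b P^b', which regroups the power of Z
      into a power of E; the two end factors contribute only a constant.\<close>
    have "op_pow Z (n + 2) = ?L o\<^sub>L (op_pow E n o\<^sub>L ?R)"
    proof (induction n)
      case 0
      show ?case by (rule blinfun_eqI) (simp add: op_pow_Suc numeral_2_eq_2 Z_def WW)
    next
      case (Suc n)
      have "op_pow Z (Suc n + 2) = Z o\<^sub>L op_pow Z (n + 2)" by (simp add: op_pow_Suc)
      also have "\<dots> = Z o\<^sub>L (?L o\<^sub>L (op_pow E n o\<^sub>L ?R))" by (simp only: Suc)
      also have "\<dots> = ?L o\<^sub>L (op_pow E (Suc n) o\<^sub>L ?R)"
        by (rule blinfun_eqI) (simp add: op_pow_Suc Z_def E_def WW)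
      finally show ?case .
    qed
    also have "norm (?L o\<^sub>L (op_pow E n o\<^sub>L ?R)) \<le> norm ?L * (norm E ^ n * norm ?R)"
      by (rule order_trans[OF norm_blinfun_compose mult_left_mono[OF
            order_trans[OF norm_blinfun_compose mult_right_mono[OF norm_op_pow_le]]]]) auto
    finally show "norm (op_pow Z (n + 2)) \<le> (norm ?L * norm ?R) * norm E ^ n" by (simp add: mult_ac)
  qed
  moreover have "\<phi> a1 b1 \<le> sqrt (norm Z)"
    unfolding \<phi>_def
  proof (rule col_norm_le)
    fix x
    have "(\<Sum>j\<in>I. (norm ((power_op P a1 o\<^sub>L X j o\<^sub>L power_op P b1) x))\<^sup>2)
        = (\<Sum>j\<in>I. inner (W a1 (X j (W b1 x))) (W a1 (X j (W b1 x))))"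
      by (simp add: W_def power2_norm_eq_inner)
    also have "\<dots> = inner (G (W b1 x)) (W b1 x)"
      using G_split[of a1 a1 "W b1 x" "W b1 x"] nn1 by simp
    also have "\<dots> = inner (Z x) x" using nn1 by (simp add: Z_def Wsym)
    also have "\<dots> \<le> norm (Z x) * norm x" by (rule norm_cauchy_schwarz)
    also have "\<dots> \<le> norm Z * norm x * norm x" by (intro mult_right_mono norm_blinfun) auto
    also have "\<dots> = (sqrt (norm Z))\<^sup>2 * (norm x)\<^sup>2" by (simp add: power2_eq_square)
    finally show "(\<Sum>j\<in>I. (norm ((power_op P a1 o\<^sub>L X j o\<^sub>L power_op P b1) x))\<^sup>2)
        \<le> (sqrt (norm Z))\<^sup>2 * (norm x)\<^sup>2" .
  qed simp
  then have "(\<phi> a1 b1)\<^sup>2 \<le> (sqrt (norm Z))\<^sup>2" by (rule power_mono) (rule \<phi>_nonneg)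
  ultimately show ?thesis unfolding a1_def[symmetric] b1_def[symmetric] by simp
qed

lemma \<phi>_bounded:
  assumes "a \<in> {0..1}" "b \<in> {0..1}"
  shows "\<phi> a b \<le> (1 + norm P) * col_norm I X * (1 + norm P)"
  unfolding \<phi>_def
proof (rule col_norm_le)
  fix x
  have A: "norm (power_op P a) \<le> 1 + norm P" and B: "norm (power_op P b) \<le> 1 + norm P"
    using assms by (auto intro: norm_power_op_le[OF P])
  have "(\<Sum>j\<in>I. (norm ((power_op P a o\<^sub>L X j o\<^sub>L power_op P b) x))\<^sup>2)
      \<le> (\<Sum>j\<in>I. ((1 + norm P) * norm (X j (power_op P b x)))\<^sup>2)"
    using A by (intro sum_mono power_mono) (auto intro: order_trans[OF norm_blinfun mult_right_mono])
  also have "\<dots> = (1 + norm P)\<^sup>2 * (\<Sum>j\<in>I. (norm (X j (power_op P b x)))\<^sup>2)"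
    by (simp add: power_mult_distrib sum_distrib_left)
  also have "\<dots> \<le> (1 + norm P)\<^sup>2 * ((col_norm I X)\<^sup>2 * (norm (power_op P b x))\<^sup>2)"
    by (intro mult_left_mono sum_col_le) simp
  also have "\<dots> \<le> (1 + norm P)\<^sup>2 * ((col_norm I X)\<^sup>2 * ((1 + norm P) * norm x)\<^sup>2)"
    using B by (intro mult_left_mono power_mono) (auto intro: order_trans[OF norm_blinfun mult_right_mono])
  finally show "(\<Sum>j\<in>I. (norm ((power_op P a o\<^sub>L X j o\<^sub>L power_op P b) x))\<^sup>2)
      \<le> ((1 + norm P) * col_norm I X * (1 + norm P))\<^sup>2 * (norm x)\<^sup>2"
    by (simp add: power_mult_distrib mult_ac)
qed (simp add: col_norm_nonneg)

end

text \<open>Boundedness replaces continuity here: the supremum \<open>L\<close> of the normalised function satisfies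
  \<open>L\<^sup>2 \<le> L\<close>.\<close>

lemma midpoint_log_convex_bounded:
  fixes g :: "real \<Rightarrow> real"
  assumes nonneg: "\<And>s. 0 \<le> g s" and K: "\<And>s. s \<in> {0..1} \<Longrightarrow> g s \<le> K"
    and mid: "\<And>s r. s \<in> {0..1} \<Longrightarrow> r \<in> {0..1} \<Longrightarrow> (g ((s + r) / 2))\<^sup>2 \<le> g s * g r"
    and u: "0 < u" "g 0 \<le> u" and v: "0 < v" "g 1 \<le> v" and s: "s \<in> {0..1}"
  shows "g s \<le> u powr (1 - s) * v powr s"
proof -
  \<comment> \<open>Strictly positive majorants u and v allow division by w even if g vanishes at an
    endpoint.\<close>
  define w :: "real \<Rightarrow> real" where "w s = u powr (1 - s) * v powr s" for s
  have w0: "w s > 0" for s using u v by (simp add: w_def)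
  have w_mid: "(w ((s + r) / 2))\<^sup>2 = w s * w r" for s r :: real
  proof -
    have half: "(x powr c)\<^sup>2 = x powr (2 * c)" if "x > 0" for x c :: real
      using that by (simp add: power2_eq_square powr_add[symmetric])
    have "(w ((s + r) / 2))\<^sup>2 = u powr (2 * (1 - (s + r) / 2)) * v powr (2 * ((s + r) / 2))"
      unfolding w_def power_mult_distrib by (simp only: half u v)
    also have "2 * (1 - (s + r) / 2) = (1 - s) + (1 - r)" by (simp add: add_divide_distrib)
    also have "2 * ((s + r) / 2) = s + r" by simp
    also have "u powr ((1 - s) + (1 - r)) * v powr (s + r) = w s * w r" by (simp only: powr_add w_def mult_ac)
    finally show ?thesis .
  qed
  define h where "h s = g s / w s" for s
  have h0: "0 \<le> h s" for s using nonneg w0[of s] by (simp add: h_def)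
  have h_mid: "(h ((s + r) / 2))\<^sup>2 \<le> h s * h r" if "s \<in> {0..1}" "r \<in> {0..1}" for s r
    using mid[OF that] w0[of s] w0[of r] by (simp add: h_def power_divide w_mid divide_right_mono)
  have "bdd_above (h ` {0..1})"
  proof (rule bdd_aboveI2)
    fix s :: real assume s: "s \<in> {0..1}"
    have p: "x powr c \<le> 1 + x" if "x > 0" "c \<in> {0..1}" for x c :: real
    proof (cases "x \<le> 1")
      case True
      then have "x powr c \<le> 1" using that by (intro powr_le1) auto
      then show ?thesis using that by simp
    next
      case False
      then have "x powr c \<le> x powr 1" using that by (intro powr_mono) auto
      then show ?thesis using False by simp
    qed
    have "h s = g s * ((1 / u) powr (1 - s) * (1 / v) powr s)"
      using u v by (simp add: h_def w_def powr_divide)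
    also have "\<dots> \<le> K * ((1 + 1 / u) * (1 + 1 / v))"
      using K[OF s] nonneg[of s] u v s by (intro mult_mono p) auto
    finally show "h s \<le> K * ((1 + 1 / u) * (1 + 1 / v))" .
  qed
  note bdd = this
  define L where "L = (SUP s\<in>{0..1}. h s)"
  have hL: "h s \<le> L" if "s \<in> {0..1}" for s unfolding L_def by (rule cSUP_upper[OF that bdd])
  have h01: "h 0 \<le> 1" "h 1 \<le> 1" using u v by (auto simp: h_def w_def)
  have L0: "0 \<le> L" using hL[of 0] h0[of 0] by simp
  \<comment> \<open>Every s is the midpoint of an endpoint, where h is at most 1, and another point
    of the interval, where h is at most L.\<close>
  have "h s \<le> sqrt L" if s: "s \<in> {0..1}" for s
  proof -
    have "(h s)\<^sup>2 \<le> L"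
    proof (cases "s \<le> 1 / 2")
      case True
      have "(h s)\<^sup>2 \<le> h 0 * h (2 * s)" using h_mid[of 0 "2 * s"] True s by simp
      also have "\<dots> \<le> 1 * L" using True s by (intro mult_mono h01 hL h0) auto
      finally show ?thesis by simp
    next
      case False
      have "(h s)\<^sup>2 \<le> h (2 * s - 1) * h 1" using h_mid[of "2 * s - 1" 1] False s by simp
      also have "\<dots> \<le> L * 1" using False s L0 by (intro mult_mono h01 hL h0) auto
      finally show ?thesis by simp
    qed
    then show ?thesis by (rule real_le_rsqrt)
  qed
  then have "L \<le> sqrt L" unfolding L_def by (intro cSUP_least) auto
  then have "L\<^sup>2 \<le> (sqrt L)\<^sup>2" by (rule power_mono) (rule L0)
  then have "L * L \<le> 1 * L" using L0 by (simp add: power2_eq_square)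
  then have "L \<le> 1" using L0 by (cases "L = 0") (auto simp: mult_le_cancel_right)
  then have "h s \<le> 1" using hL[OF s] by simp
  then show ?thesis using w0[of s] by (simp add: h_def w_def)
qed

lemma (in column) \<phi>_interpolate:
  assumes ab: "a \<in> {0..1}" "b \<in> {0..1}" "a' \<in> {0..1}" "b' \<in> {0..1}"
    and u: "0 < u" "\<phi> a b \<le> u" and v: "0 < v" "\<phi> a' b' \<le> v" and s: "s \<in> {0..1}"
  shows "\<phi> ((1 - s) * a + s * a') ((1 - s) * b + s * b') \<le> u powr (1 - s) * v powr s"
proof -
  have cvx: "(1 - s) * x + s * y \<in> {0..1}" if "s \<in> {0..1}" "x \<in> {0..1}" "y \<in> {0..1}" for s x y :: real
    using that convexD_alt[of "{0..1::real}" x y s] by simp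
  show ?thesis
  proof (rule midpoint_log_convex_bounded[where g = "\<lambda>s. \<phi> ((1 - s) * a + s * a') ((1 - s) * b + s * b')"])
    show "\<phi> ((1 - s) * a + s * a') ((1 - s) * b + s * b') \<le> (1 + norm P) * col_norm I X * (1 + norm P)"
      if "s \<in> {0..1}" for s by (intro \<phi>_bounded cvx that ab)
    show "(\<phi> ((1 - (s + r) / 2) * a + (s + r) / 2 * a') ((1 - (s + r) / 2) * b + (s + r) / 2 * b'))\<^sup>2
       \<le> \<phi> ((1 - s) * a + s * a') ((1 - s) * b + s * b') * \<phi> ((1 - r) * a + r * a') ((1 - r) * b + r * b')"
      if s: "s \<in> {0..1}" and r: "r \<in> {0..1}" for s r
    proof -
      have e: "(1 - (s + r) / 2) * x + (s + r) / 2 * y = (((1 - s) * x + s * y) + ((1 - r) * x + r * y)) / 2" for x y :: real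
        by (simp add: field_simps)
      show ?thesis unfolding e using cvx[OF s ab(1,3)] cvx[OF s ab(2,4)] cvx[OF r ab(1,3)] cvx[OF r ab(2,4)]
        by (intro \<phi>_midpoint) auto
    qed
  qed (use u v s \<phi>_nonneg in auto)
qed

section \<open>Powers of an operator tuple and the iterated Aluthge transform\<close>

text \<open>By Fekete's lemma, \<open>growth_rate (pow_norm T)\<close> is the limit of the \<open>k\<close>-th roots of
  \<open>pow_norm T k\<close>.\<close>

primrec word_op :: "('a::chilbert_space, 'd) op_tuple \<Rightarrow> 'd list \<Rightarrow> ('a \<Rightarrow>\<^sub>L 'a)" where
  "word_op T [] = id_blinfun"
| "word_op T (i # w) = T i o\<^sub>L word_op T w"

definition words :: "nat \<Rightarrow> 'd list set" where
  "words k = {w. length w = k}"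

definition pow_norm :: "('a::chilbert_space, 'd::finite) op_tuple \<Rightarrow> nat \<Rightarrow> real" where
  "pow_norm T k = col_norm (words k) (word_op T)"

lemma word_op_append: "word_op T (u @ v) = word_op T u o\<^sub>L word_op T v"
  by (induction u) (simp_all add: blinfun_compose_assoc)

lemma complex_linear_word_op: "complex_linear_tuple T \<Longrightarrow> complex_linear (word_op T w)"
  by (induction w) (auto intro: complex_linear_compose complex_linear_tupleD)

lemma sum_words_0: "(\<Sum>w\<in>words 0. f w) = f []"
  by (simp add: words_def)

lemma sum_words_add:
  "(\<Sum>w\<in>words (m + n). f w) = (\<Sum>u\<in>words m. \<Sum>v\<in>words n. f (u @ v :: 'd::finite list))"
proof -
  have "(\<Sum>u\<in>words m. \<Sum>v\<in>words n. f (u @ v)) = (\<Sum>(u, v)\<in>words m \<times> words n. f (u @ v))"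
    by (rule sum.cartesian_product)
  also have "\<dots> = (\<Sum>w\<in>words (m + n). f w)"
    by (rule sum.reindex_bij_witness[of _ "\<lambda>w. (take m w, drop m w)" "\<lambda>(u, v). u @ v"])
      (auto simp: words_def)
  finally show ?thesis by simp
qed

lemma sum_words_1: "(\<Sum>w\<in>words 1. f w) = (\<Sum>i\<in>UNIV. f [i :: 'd::finite])"
  by (rule sum.reindex_bij_witness[of _ "\<lambda>i. [i]" hd]) (auto simp: words_def length_Suc_conv)

lemma sum_words_Cons: "(\<Sum>w\<in>words (Suc k). f w) = (\<Sum>i\<in>UNIV. \<Sum>w\<in>words k. f (i # w :: 'd::finite list))"
  using sum_words_add[of f 1 k] sum_words_1[of "\<lambda>u. \<Sum>v\<in>words k. f (u @ v)"] by simp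

lemma sum_words_snoc: "(\<Sum>w\<in>words (Suc k). f w) = (\<Sum>w\<in>words k. \<Sum>i\<in>UNIV. f (w @ [i :: 'd::finite]))"
  using sum_words_add[of f k 1] by (simp only: sum_words_1 Suc_eq_plus1)

lemma pow_norm_nonneg: "0 \<le> pow_norm T k"
  by (simp add: pow_norm_def col_norm_nonneg)

lemma sum_word_op_le: "(\<Sum>w\<in>words k. (norm (word_op T w x))\<^sup>2) \<le> (pow_norm T k)\<^sup>2 * (norm x)\<^sup>2"
  unfolding pow_norm_def by (rule sum_col_le)

lemma pow_norm_le:
  "0 \<le> c \<Longrightarrow> (\<And>x. (\<Sum>w\<in>words k. (norm (word_op T w x))\<^sup>2) \<le> c\<^sup>2 * (norm x)\<^sup>2) \<Longrightarrow> pow_norm T k \<le> c"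
  unfolding pow_norm_def by (rule col_norm_le)

lemma pow_norm_add_le: "pow_norm T (m + n) \<le> pow_norm T m * pow_norm T n"
proof (rule pow_norm_le)
  fix x
  have "(\<Sum>w\<in>words (m + n). (norm (word_op T w x))\<^sup>2)
      = (\<Sum>v\<in>words n. \<Sum>u\<in>words m. (norm (word_op T u (word_op T v x)))\<^sup>2)"
    by (subst sum.swap) (simp add: sum_words_add word_op_append)
  also have "\<dots> \<le> (\<Sum>v\<in>words n. (pow_norm T m)\<^sup>2 * (norm (word_op T v x))\<^sup>2)"
    by (intro sum_mono sum_word_op_le)
  also have "\<dots> \<le> (pow_norm T m)\<^sup>2 * ((pow_norm T n)\<^sup>2 * (norm x)\<^sup>2)"
    unfolding sum_distrib_left[symmetric] by (intro mult_left_mono sum_word_op_le) simp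
  finally show "(\<Sum>w\<in>words (m + n). (norm (word_op T w x))\<^sup>2) \<le> (pow_norm T m * pow_norm T n)\<^sup>2 * (norm x)\<^sup>2"
    by (simp add: power_mult_distrib mult_ac)
qed (simp add: pow_norm_nonneg)

lemma pow_norm_0_le: "pow_norm T 0 \<le> 1"
  by (rule pow_norm_le) (simp_all add: sum_words_0)

lemma tuple_norm_eq_pow_norm:
  assumes T: "complex_linear_tuple T"
  shows "tuple_norm T = pow_norm T 1"
proof (rule antisym)
  have eq: "(\<Sum>w\<in>words 1. (norm (word_op T w x))\<^sup>2) = (norm (modulus T x))\<^sup>2" for x
    by (simp only: sum_words_1 word_op.simps blinfun_compose_id norm_modulus[OF T])
  show "tuple_norm T \<le> pow_norm T 1"
    unfolding tuple_norm_def
  proof (rule norm_blinfun_bound[OF pow_norm_nonneg])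
    fix x
    have "(norm (modulus T x))\<^sup>2 \<le> (pow_norm T 1 * norm x)\<^sup>2"
      using sum_word_op_le[of T x 1] by (simp only: eq power_mult_distrib)
    then show "norm (modulus T x) \<le> pow_norm T 1 * norm x"
      by (rule power2_le_imp_le) (simp add: pow_norm_nonneg)
  qed
  show "pow_norm T 1 \<le> tuple_norm T"
  proof (rule pow_norm_le)
    fix x
    show "(\<Sum>w\<in>words 1. (norm (word_op T w x))\<^sup>2) \<le> (tuple_norm T)\<^sup>2 * (norm x)\<^sup>2"
      unfolding eq tuple_norm_def power_mult_distrib[symmetric] by (intro power_mono norm_blinfun) simp
  qed (simp add: tuple_norm_def)
qed

section \<open>Column norms under one Aluthge transform\<close>

locale aluthge_step =
  fixes T :: "('a::chilbert_space, 'd::finite) op_tuple" and t :: real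
  assumes T: "complex_linear_tuple T" and t: "0 < t" "t < 1"
begin

abbreviation P where "P \<equiv> modulus T"
abbreviation V where "V \<equiv> polar_part T"
abbreviation \<Delta> where "\<Delta> \<equiv> aluthge t T"

lemma P: "pos_op P" "complex_linear P"
  by (rule pos_op_modulus[OF T], rule complex_linear_modulus[OF T])

lemma VP: "V i (P x) = T i x"
  using arg_cong[OF polar_part_modulus[OF T, of i], of "\<lambda>A. blinfun_apply A x"] by simp

lemma Pt: "power_op P (1 - t) (power_op P t x) = P x"
proof -
  have "power_op P (1 - t + t) = power_op P (1 - t) o\<^sub>L power_op P t"
    by (rule power_op_add[OF P(1)]) (use t in auto)
  from arg_cong[OF this, of "\<lambda>A. blinfun_apply A x"] show ?thesis by (simp add: power_op_1[OF P(1)])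
qed

lemma complex_linear_aluthge: "complex_linear_tuple \<Delta>"
  unfolding complex_linear_tuple_def aluthge_def
  using t complex_linear_tupleD[OF complex_linear_polar_part[OF T]]
  by (auto intro!: complex_linear_compose complex_linear_power_op P)

text \<open>Between neighbours P^(1-t) P^t = P, and V_j P = T_j. Only the leading P^t and the factor
  V_i P^(1-t) of the last letter find no partner, so the last letter is split off.\<close>

lemma word_op_aluthge_snoc:
  "word_op \<Delta> (w @ [i]) = power_op P t o\<^sub>L (word_op T w o\<^sub>L V i) o\<^sub>L power_op P (1 - t)"
proof (induction w)
  case (Cons j w)
  show ?case
    by (rule blinfun_eqI) (simp add: Cons, simp add: aluthge_def Pt VP)
qed (rule blinfun_eqI, simp add: aluthge_def)

lemma word_op_via_aluthge:
  "T i (word_op T w x) = V i (power_op P (1 - t) (word_op \<Delta> w (power_op P t x)))"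
proof (induction w arbitrary: i)
  case (Cons j w)
  show ?case using Cons[of j] by (simp add: aluthge_def Pt VP)
qed (simp add: Pt VP)

lemma pow_norm_Suc_le:
  "pow_norm T (Suc k) \<le> norm (power_op P (1 - t)) * norm (power_op P t) * pow_norm \<Delta> k"
proof (rule pow_norm_le)
  fix x
  let ?A = "power_op P (1 - t)" and ?B = "power_op P t"
  have "(\<Sum>w\<in>words (Suc k). (norm (word_op T w x))\<^sup>2)
      = (\<Sum>w\<in>words k. \<Sum>i\<in>UNIV. (norm (V i (?A (word_op \<Delta> w (?B x)))))\<^sup>2)"
    unfolding sum_words_Cons by (subst sum.swap) (simp add: word_op_via_aluthge)
  also have "\<dots> \<le> (\<Sum>w\<in>words k. (norm (?A (word_op \<Delta> w (?B x))))\<^sup>2)"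
    by (intro sum_mono polar_part_contraction[OF T])
  also have "\<dots> \<le> (\<Sum>w\<in>words k. (norm ?A * norm (word_op \<Delta> w (?B x)))\<^sup>2)"
    by (intro sum_mono power_mono norm_blinfun) simp
  also have "\<dots> = (norm ?A)\<^sup>2 * (\<Sum>w\<in>words k. (norm (word_op \<Delta> w (?B x)))\<^sup>2)"
    by (simp add: power_mult_distrib sum_distrib_left)
  also have "\<dots> \<le> (norm ?A)\<^sup>2 * ((pow_norm \<Delta> k)\<^sup>2 * (norm (?B x))\<^sup>2)"
    by (intro mult_left_mono sum_word_op_le) simp
  also have "\<dots> \<le> (norm ?A)\<^sup>2 * ((pow_norm \<Delta> k)\<^sup>2 * (norm ?B * norm x)\<^sup>2)"
    by (intro mult_left_mono power_mono norm_blinfun) auto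
  finally show "(\<Sum>w\<in>words (Suc k). (norm (word_op T w x))\<^sup>2)
      \<le> (norm ?A * norm ?B * pow_norm \<Delta> k)\<^sup>2 * (norm x)\<^sup>2"
    by (simp add: power_mult_distrib mult_ac)
qed (simp add: pow_norm_nonneg)

text \<open>The previous bound shifts the length by one and costs a constant; neither affects
  exponential growth.\<close>

lemma growth_rate_le_aluthge: "growth_rate (pow_norm T) \<le> growth_rate (pow_norm \<Delta>)"
proof (rule dense_ge)
  fix R assume R: "growth_rate (pow_norm \<Delta>) < R"
  let ?\<rho> = "growth_rate (pow_norm T)"
  define K where "K = norm (power_op P (1 - t)) * norm (power_op P t)"
  obtain C where C: "\<And>k. pow_norm \<Delta> k \<le> C * R ^ k"
    using growth_rate_bound[OF pow_norm_nonneg pow_norm_add_le R] by blast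
  have R0: "0 \<le> R" using growth_rate_nonneg[of "pow_norm \<Delta>"] pow_norm_nonneg R by (meson less_le order_trans)
  have \<rho>0: "0 \<le> ?\<rho>" by (rule growth_rate_nonneg[OF pow_norm_nonneg])
  show "?\<rho> \<le> R"
  proof (cases "?\<rho> = 0")
    case False
    then have \<rho>: "?\<rho> > 0" using \<rho>0 by simp
    show ?thesis
    proof (rule power_le_const_mult_power[OF R0])
      fix n
      have "?\<rho> ^ Suc n \<le> pow_norm T (Suc n)" by (rule growth_rate_power_le[OF pow_norm_nonneg]) simp
      also have "\<dots> \<le> K * pow_norm \<Delta> n" unfolding K_def by (rule pow_norm_Suc_le)
      also have "\<dots> \<le> K * (C * R ^ n)" by (intro mult_left_mono C) (simp add: K_def)
      finally show "?\<rho> ^ n \<le> (K * C / ?\<rho>) * R ^ n" using \<rho> by (simp add: field_simps)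
    qed
  qed (use R0 in simp)
qed

context
  fixes m :: nat
begin

private abbreviation I where "I \<equiv> words m \<times> (UNIV :: 'd set)"
private definition X where "X = (\<lambda>(w, i). word_op T w o\<^sub>L V i)"

interpretation column P I X
  by unfold_locales (auto simp: X_def intro!: P complex_linear_compose complex_linear_word_op[OF T]
      complex_linear_tupleD[OF complex_linear_polar_part[OF T]])

private lemma sum_I: "(\<Sum>j\<in>I. f j) = (\<Sum>w\<in>words m. \<Sum>i\<in>UNIV. f (w, i))"
  by (simp add: sum.cartesian_product)

text \<open>The four corners of the exponent square: a factor P on the right turns V_i into T_i, a
  factor P on the left adds a letter because |P x|^2 is the sum of the |T_l x|^2. An unmatched V is
  removed by contractivity, so the lengths are m, m + 1, m + 1 and m + 2.\<close>

private lemma corner_00: "\<phi> 0 0 \<le> pow_norm T m"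
  unfolding \<phi>_def
proof (rule col_norm_le[OF pow_norm_nonneg])
  fix x
  have "(\<Sum>j\<in>I. (norm ((power_op P 0 o\<^sub>L X j o\<^sub>L power_op P 0) x))\<^sup>2)
      = (\<Sum>i\<in>UNIV. \<Sum>w\<in>words m. (norm (word_op T w (V i x)))\<^sup>2)"
    unfolding sum_I by (subst sum.swap) (simp add: X_def)
  also have "\<dots> \<le> (\<Sum>i\<in>UNIV. (pow_norm T m)\<^sup>2 * (norm (V i x))\<^sup>2)"
    by (intro sum_mono sum_word_op_le)
  also have "\<dots> \<le> (pow_norm T m)\<^sup>2 * (norm x)\<^sup>2"
    unfolding sum_distrib_left[symmetric] by (intro mult_left_mono polar_part_contraction[OF T]) simp
  finally show "(\<Sum>j\<in>I. (norm ((power_op P 0 o\<^sub>L X j o\<^sub>L power_op P 0) x))\<^sup>2) \<le> (pow_norm T m)\<^sup>2 * (norm x)\<^sup>2" .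
qed

private lemma corner_01: "\<phi> 0 1 \<le> pow_norm T (Suc m)"
  unfolding \<phi>_def
proof (rule col_norm_le[OF pow_norm_nonneg])
  fix x
  have "(\<Sum>j\<in>I. (norm ((power_op P 0 o\<^sub>L X j o\<^sub>L power_op P 1) x))\<^sup>2)
      = (\<Sum>w\<in>words (Suc m). (norm (word_op T w x))\<^sup>2)"
    unfolding sum_I sum_words_snoc by (simp add: X_def power_op_1[OF P(1)] VP word_op_append)
  then show "(\<Sum>j\<in>I. (norm ((power_op P 0 o\<^sub>L X j o\<^sub>L power_op P 1) x))\<^sup>2) \<le> (pow_norm T (Suc m))\<^sup>2 * (norm x)\<^sup>2"
    using sum_word_op_le by metis
qed

private lemma norm_P_sum: "(norm (P x))\<^sup>2 = (\<Sum>l\<in>UNIV. (norm (T l x))\<^sup>2)"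
  by (rule norm_modulus[OF T])

private lemma corner_10: "\<phi> 1 0 \<le> pow_norm T (Suc m)"
  unfolding \<phi>_def
proof (rule col_norm_le[OF pow_norm_nonneg])
  fix x
  have "(\<Sum>j\<in>I. (norm ((power_op P 1 o\<^sub>L X j o\<^sub>L power_op P 0) x))\<^sup>2)
      = (\<Sum>i\<in>UNIV. \<Sum>w\<in>words m. \<Sum>l\<in>UNIV. (norm (T l (word_op T w (V i x))))\<^sup>2)"
    unfolding sum_I by (subst sum.swap) (simp add: X_def power_op_1[OF P(1)] norm_P_sum)
  also have "\<dots> = (\<Sum>i\<in>UNIV. \<Sum>w\<in>words (Suc m). (norm (word_op T w (V i x)))\<^sup>2)"
    unfolding sum_words_Cons by (intro sum.cong refl, subst sum.swap) simp
  also have "\<dots> \<le> (\<Sum>i\<in>UNIV. (pow_norm T (Suc m))\<^sup>2 * (norm (V i x))\<^sup>2)"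
    by (intro sum_mono sum_word_op_le)
  also have "\<dots> \<le> (pow_norm T (Suc m))\<^sup>2 * (norm x)\<^sup>2"
    unfolding sum_distrib_left[symmetric] by (intro mult_left_mono polar_part_contraction[OF T]) simp
  finally show "(\<Sum>j\<in>I. (norm ((power_op P 1 o\<^sub>L X j o\<^sub>L power_op P 0) x))\<^sup>2) \<le> (pow_norm T (Suc m))\<^sup>2 * (norm x)\<^sup>2" .
qed

private lemma corner_11: "\<phi> 1 1 \<le> pow_norm T (Suc (Suc m))"
  unfolding \<phi>_def
proof (rule col_norm_le[OF pow_norm_nonneg])
  fix x
  have "(\<Sum>j\<in>I. (norm ((power_op P 1 o\<^sub>L X j o\<^sub>L power_op P 1) x))\<^sup>2)
      = (\<Sum>w\<in>words (Suc m). \<Sum>l\<in>UNIV. (norm (T l (word_op T w x)))\<^sup>2)"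
    unfolding sum_I sum_words_snoc by (simp add: X_def power_op_1[OF P(1)] norm_P_sum VP word_op_append)
  also have "\<dots> = (\<Sum>w\<in>words (Suc (Suc m)). (norm (word_op T w x))\<^sup>2)"
    unfolding sum_words_Cons[of _ "Suc m"] by (subst sum.swap) simp
  also have "\<dots> \<le> (pow_norm T (Suc (Suc m)))\<^sup>2 * (norm x)\<^sup>2" by (rule sum_word_op_le)
  finally show "(\<Sum>j\<in>I. (norm ((power_op P 1 o\<^sub>L X j o\<^sub>L power_op P 1) x))\<^sup>2) \<le> (pow_norm T (Suc (Suc m)))\<^sup>2 * (norm x)\<^sup>2" .
qed

private lemma pow_norm_aluthge_le_\<phi>: "pow_norm \<Delta> (Suc m) \<le> \<phi> t (1 - t)"
proof (rule pow_norm_le[OF \<phi>_nonneg])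
  fix x
  have "(\<Sum>w\<in>words (Suc m). (norm (word_op \<Delta> w x))\<^sup>2)
      = (\<Sum>j\<in>I. (norm ((power_op P t o\<^sub>L X j o\<^sub>L power_op P (1 - t)) x))\<^sup>2)"
    unfolding sum_I sum_words_snoc by (simp add: X_def word_op_aluthge_snoc)
  also have "\<dots> \<le> (\<phi> t (1 - t))\<^sup>2 * (norm x)\<^sup>2" unfolding \<phi>_def by (rule sum_col_le)
  finally show "(\<Sum>w\<in>words (Suc m). (norm (word_op \<Delta> w x))\<^sup>2) \<le> (\<phi> t (1 - t))\<^sup>2 * (norm x)\<^sup>2" .
qed

text \<open>The exponent (t, 1 - t) lies on the segment from (0, 1) to (1, 0), and both ends have
  the same bound. The e keeps this bound positive.\<close>

lemma pow_norm_aluthge_le: "pow_norm \<Delta> (Suc m) \<le> pow_norm T (Suc m)"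
proof (rule field_le_epsilon)
  fix e :: real assume "0 < e"
  let ?u = "pow_norm T (Suc m) + e"
  have u: "0 < ?u" using pow_norm_nonneg[of T "Suc m"] \<open>0 < e\<close> by linarith
  have "\<phi> ((1 - t) * 0 + t * 1) ((1 - t) * 1 + t * 0) \<le> ?u powr (1 - t) * ?u powr t"
    using corner_01 corner_10 t u \<open>0 < e\<close> by (intro \<phi>_interpolate) auto
  also have "?u powr (1 - t) * ?u powr t = ?u" using u by (simp add: powr_add[symmetric])
  finally show "pow_norm \<Delta> (Suc m) \<le> ?u" using pow_norm_aluthge_le_\<phi> by simp
qed

text \<open>The exponent \<open>(t, 1 - t)\<close> lies on the segment from \<open>(1/2, 1/2)\<close> to one of \<open>(0, 1)\<close>, \<open>(1, 0)\<close>.\<close>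

lemma pow_norm_aluthge_interpolate:
  assumes A: "0 < A" "pow_norm T m \<le> A" and B: "0 < B" "pow_norm T (Suc m) \<le> B"
    and C: "0 < C" "pow_norm T (Suc (Suc m)) \<le> C"
  shows "pow_norm \<Delta> (Suc m) \<le> (A * C) powr min t (1 - t) * B powr (1 - 2 * min t (1 - t))"
proof -
  define \<tau> where "\<tau> = min t (1 - t)"
  have \<tau>: "2 * \<tau> \<in> {0..1}" using t by (auto simp: \<tau>_def min_def)
  have "\<phi> ((1 - 1/2) * 0 + 1/2 * 1) ((1 - 1/2) * 0 + 1/2 * 1) \<le> A powr (1 - 1/2) * C powr (1/2)"
    using corner_00 corner_11 A C by (intro \<phi>_interpolate) auto
  then have mid: "\<phi> (1/2) (1/2) \<le> (A * C) powr (1/2)" using A C by (simp add: powr_mult)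
  have AC: "0 < (A * C) powr (1/2)" using A C by simp
  have "\<phi> t (1 - t) \<le> B powr (1 - 2 * \<tau>) * ((A * C) powr (1/2)) powr (2 * \<tau>)"
  proof (cases "t \<le> 1/2")
    case True
    then have \<tau>t: "\<tau> = t" by (simp add: \<tau>_def)
    have "\<phi> ((1 - 2 * \<tau>) * 0 + 2 * \<tau> * (1/2)) ((1 - 2 * \<tau>) * 1 + 2 * \<tau> * (1/2))
        \<le> B powr (1 - 2 * \<tau>) * ((A * C) powr (1/2)) powr (2 * \<tau>)"
      using corner_01 mid AC B \<tau> by (intro \<phi>_interpolate) auto
    then show ?thesis by (simp add: \<tau>t)
  next
    case False
    then have \<tau>t: "\<tau> = 1 - t" by (simp add: \<tau>_def)
    have "t = (1 - 2 * \<tau>) * 1 + 2 * \<tau> * (1/2)" "1 - t = (1 - 2 * \<tau>) * 0 + 2 * \<tau> * (1/2)"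
      by (simp_all add: \<tau>t field_simps)
    moreover have "\<phi> ((1 - 2 * \<tau>) * 1 + 2 * \<tau> * (1/2)) ((1 - 2 * \<tau>) * 0 + 2 * \<tau> * (1/2))
        \<le> B powr (1 - 2 * \<tau>) * ((A * C) powr (1/2)) powr (2 * \<tau>)"
      using corner_10 mid AC B \<tau> by (intro \<phi>_interpolate) auto
    ultimately show ?thesis by (simp only:)
  qed
  then show ?thesis using pow_norm_aluthge_le_\<phi> by (simp add: powr_powr \<tau>_def mult.commute)
qed

end

end

section \<open>Limits along the iterated transform\<close>

lemma tuple_norm_aluthge_tendsto:
  fixes T :: "('a::chilbert_space, 'd::finite) op_tuple"
  assumes T: "complex_linear_tuple T" and t: "0 < t" "t < 1"
  shows "(\<lambda>n. tuple_norm ((aluthge t ^^ n) T)) \<longlonglongrightarrow> growth_rate (pow_norm T)"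
proof -
  define D where "D n = (aluthge t ^^ n) T" for n
  have D_Suc: "D (Suc n) = aluthge t (D n)" for n by (simp add: D_def)
  have D0: "D 0 = T" by (simp add: D_def)
  have cl: "complex_linear_tuple (D n)" for n
  proof (induction n)
    case (Suc n)
    interpret aluthge_step "D n" t by unfold_locales (use Suc t in auto)
    show ?case unfolding D_Suc by (rule complex_linear_aluthge)
  qed (simp add: D0 T)
  have step: "aluthge_step (D n) t" for n by unfold_locales (use cl t in auto)
  define c where "c n k = pow_norm (D n) k" for n k
  have c0: "0 \<le> c n k" for n k by (simp add: c_def pow_norm_nonneg)
  have mono: "c (Suc n) (Suc k) \<le> c n (Suc k)" for n k
    unfolding c_def D_Suc by (rule aluthge_step.pow_norm_aluthge_le[OF step])
  have mono_le: "c n (Suc k) \<le> c 0 (Suc k)" for n k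
    by (rule lift_Suc_antimono_le[of "\<lambda>n. c n (Suc k)", OF mono]) simp
  have "\<exists>L. (\<lambda>n. c n (Suc k)) \<longlonglongrightarrow> L" for k
  proof -
    have "decseq (\<lambda>n. c n (Suc k))" by (rule decseq_SucI) (rule mono)
    then show ?thesis using decseq_convergent[of "\<lambda>n. c n (Suc k)" 0] c0 by metis
  qed
  \<comment> \<open>The index is shifted: \<open>s k\<close> belongs to words of length
    \<open>Suc k\<close>, so \<open>s 0\<close> is the limit of the tuple norms.\<close>
  then obtain s where s: "\<And>k. (\<lambda>n. c n (Suc k)) \<longlonglongrightarrow> s k" by metis
  have s0: "0 \<le> s k" for k by (rule LIMSEQ_le_const[OF s]) (use c0 in auto)
  have s_le: "s k \<le> c n (Suc k)" for k n
    by (rule decseq_ge[OF decseq_SucI[of "\<lambda>n. c n (Suc k)", OF mono] s])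
  have \<rho>_le: "growth_rate (pow_norm T) \<le> growth_rate (pow_norm (D n))" for n
  proof (induction n)
    case (Suc n)
    then show ?case unfolding D_Suc using aluthge_step.growth_rate_le_aluthge[OF step[of n]] by linarith
  qed (simp add: D0)
  have lower: "growth_rate (pow_norm T) \<le> s 0"
  proof (rule LIMSEQ_le_const[OF s])
    have "growth_rate (pow_norm (D n)) ^ 1 \<le> pow_norm (D n) 1" for n
      by (rule growth_rate_power_le[OF pow_norm_nonneg]) simp
    then show "\<exists>N. \<forall>n\<ge>N. growth_rate (pow_norm T) \<le> c n (Suc 0)"
      using \<rho>_le by (metis One_nat_def c_def order_trans power_one_right)
  qed
  define \<tau> where "\<tau> = min t (1 - t)"
  have \<tau>0: "0 < \<tau>" using t by (simp add: \<tau>_def)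
  have interp: "c (Suc n) (Suc m) \<le> (A * C) powr \<tau> * B powr (1 - 2 * \<tau>)"
    if "0 < A" "c n m \<le> A" "0 < B" "c n (Suc m) \<le> B" "0 < C" "c n (Suc (Suc m)) \<le> C" for n m A B C
    unfolding c_def D_Suc \<tau>_def
    by (rule aluthge_step.pow_norm_aluthge_interpolate[OF step]) (use that in \<open>auto simp: c_def\<close>)
  \<comment> \<open>\<open>a\<close> is an asymptotic bound for words of length m: it is 1 for m =
    0, where \<open>pow_norm_0_le\<close> takes the place of convergence, and
    \<open>s (m - 1)\<close> otherwise.\<close>
  have convex: "(s m)\<^sup>2 \<le> a * s (Suc m)"
    if sm: "0 < s m" and a: "0 < a" "\<And>e. 0 < e \<Longrightarrow> \<forall>\<^sub>F n in sequentially. c n m \<le> a + e" for m a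
  proof -
    have le: "(s m)\<^sup>2 \<le> (a + e) * (s (Suc m) + e)" if e: "0 < e" for e
    proof -
      have "\<forall>\<^sub>F n in sequentially. c n (Suc (Suc m)) < s (Suc m) + e"
        using s by (rule order_tendstoD) (use e in simp)
      with a(2)[OF e] have ev: "\<forall>\<^sub>F n in sequentially. c (Suc n) (Suc m)
          \<le> ((a + e) * (s (Suc m) + e)) powr \<tau> * (c n (Suc m)) powr (1 - 2 * \<tau>)"
      proof eventually_elim
        case (elim n)
        have "0 < c n (Suc m)" using s_le[of m n] sm by linarith
        then show ?case using elim e a(1) s0[of "Suc m"] by (intro interp) auto
      qed
      have "(\<lambda>n. ((a + e) * (s (Suc m) + e)) powr \<tau> * (c n (Suc m)) powr (1 - 2 * \<tau>))
          \<longlonglongrightarrow> ((a + e) * (s (Suc m) + e)) powr \<tau> * (s m) powr (1 - 2 * \<tau>)"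
        by (intro tendsto_intros s) (use sm in auto)
      then have "s m \<le> ((a + e) * (s (Suc m) + e)) powr \<tau> * (s m) powr (1 - 2 * \<tau>)"
        by (rule tendsto_le[OF sequentially_bot _ LIMSEQ_Suc[OF s] ev])
      then have "s m powr (2 * \<tau>) * s m powr (1 - 2 * \<tau>) \<le> ((a + e) * (s (Suc m) + e)) powr \<tau> * (s m) powr (1 - 2 * \<tau>)"
        using sm by (simp add: powr_add[symmetric])
      then have "s m powr (2 * \<tau>) \<le> ((a + e) * (s (Suc m) + e)) powr \<tau>" using sm by simp
      then have "((s m)\<^sup>2) powr \<tau> \<le> ((a + e) * (s (Suc m) + e)) powr \<tau>"
        using sm by (simp add: powr_powr[symmetric])
      moreover have "0 \<le> (a + e) * (s (Suc m) + e)" using e a(1) s0[of "Suc m"] by simp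
      ultimately show ?thesis using powr_less_mono2[OF \<tau>0] by (meson not_less)
    qed
    have "((\<lambda>e. (a + e) * (s (Suc m) + e)) \<longlongrightarrow> (a + 0) * (s (Suc m) + 0)) (at_right 0)"
      by (intro tendsto_intros)
    then have "(s m)\<^sup>2 \<le> (a + 0) * (s (Suc m) + 0)"
      by (rule tendsto_lowerbound) (use le in \<open>auto simp: eventually_at_filter\<close>)
    then show ?thesis by simp
  qed
  have upper: "s 0 \<le> growth_rate (pow_norm T)"
  proof (cases "s 0 = 0")
    case True
    then show ?thesis using growth_rate_nonneg[of "pow_norm T", OF pow_norm_nonneg] by simp
  next
    case False
    then have s00: "0 < s 0" using s0[of 0] by simp
    \<comment> \<open>By log-convexity the ratios \<open>s (Suc k) / s k\<close> do not decrease,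
      and the first is at least \<open>s 0\<close>. Positivity is carried along because
      \<open>convex\<close> requires it.\<close>
    have ind: "0 < s k \<and> s 0 * s k \<le> s (Suc k)" for k
    proof (induction k)
      case 0
      have "(s 0)\<^sup>2 \<le> 1 * s (Suc 0)"
      proof (rule convex[OF s00])
        fix e :: real assume "0 < e"
        then show "\<forall>\<^sub>F n in sequentially. c n 0 \<le> 1 + e"
          unfolding c_def by (intro always_eventually allI order_trans[OF pow_norm_0_le]) simp
      qed simp
      then show ?case using s00 by (simp add: power2_eq_square)
    next
      case (Suc k)
      have pos: "0 < s (Suc k)" using Suc s00 by (smt (verit) mult_pos_pos)
      have "(s (Suc k))\<^sup>2 \<le> s k * s (Suc (Suc k))"
      proof (rule convex[OF pos])
        show "\<forall>\<^sub>F n in sequentially. c n (Suc k) \<le> s k + e" if "0 < e" for e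
          using order_tendstoD(2)[OF s[of k], of "s k + e"] that by (auto elim: eventually_mono)
      qed (use Suc in simp)
      moreover have "(s 0 * s k) * s (Suc k) \<le> s (Suc k) * s (Suc k)"
        using Suc pos by (intro mult_right_mono) auto
      ultimately have "s k * (s 0 * s (Suc k)) \<le> s k * s (Suc (Suc k))"
        by (simp only: power2_eq_square mult_ac)
      then show ?case using Suc pos by (simp add: mult_le_cancel_left_pos)
    qed
    have "s 0 ^ Suc k \<le> s k" for k
    proof (induction k)
      case (Suc k)
      have "s 0 ^ Suc (Suc k) \<le> s 0 * s k" using Suc s00 by simp
      then show ?case using ind[of k] by linarith
    qed simp
    then have "s 0 ^ n \<le> pow_norm T n" if "n \<ge> 1" for n
      using that s_le[of "n - 1" 0] by (cases n) (auto simp: c_def D0 intro: order_trans)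
    then show ?thesis by (rule growth_rate_greatest[OF pow_norm_nonneg _ s0])
  qed
  have "(\<lambda>n. tuple_norm (D n)) \<longlonglongrightarrow> s 0"
    using s[of 0] by (simp add: c_def tuple_norm_eq_pow_norm[OF cl])
  then show ?thesis using lower upper by (simp add: D_def)
qed

section \<open>Exactness of the Koszul complex\<close>

definition koszul_sign :: "'d::{finite,linorder} \<Rightarrow> 'd set \<Rightarrow> real" where
  "koszul_sign i J = (- 1) ^ card {j\<in>J. j < i}"

lemma koszul_boundary_sign:
  "koszul_boundary S x J = (\<Sum>i\<in>J. koszul_sign i J *\<^sub>R S i (x (J - {i})))"
  by (simp add: koszul_boundary_def koszul_sign_def)

lemma koszul_sign_square [simp]: "koszul_sign i J * koszul_sign i J = 1"
  by (simp add: koszul_sign_def power_mult_distrib[symmetric])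

lemma koszul_sign_less:
  assumes "i \<in> J" "j \<in> J" "i < j"
  shows "koszul_sign i J * koszul_sign j (J - {i}) = - (koszul_sign j J * koszul_sign i (J - {j}))"
proof -
  have 1: "{l \<in> J - {j}. l < i} = {l \<in> J. l < i}" using assms(3) by auto
  have 2: "{l \<in> J - {i}. l < j} = {l \<in> J. l < j} - {i}" by auto
  have "i \<in> {l \<in> J. l < j}" using assms by simp
  then have "card {l \<in> J. l < j} = Suc (card ({l \<in> J. l < j} - {i}))"
    using card_Suc_Diff1[of "{l \<in> J. l < j}" i] by simp
  then have "koszul_sign j J = - koszul_sign j (J - {i})"
    unfolding koszul_sign_def 2 by (simp only: power_Suc)
  moreover have "koszul_sign i (J - {j}) = koszul_sign i J" unfolding koszul_sign_def 1 ..
  ultimately show ?thesis by (simp add: mult.commute)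
qed

lemma koszul_sign_swap:
  assumes "i \<in> J" "j \<in> J" "i \<noteq> j"
  shows "koszul_sign i J * koszul_sign j (J - {i}) = - (koszul_sign j J * koszul_sign i (J - {j}))"
proof (cases "i < j")
  case False
  then have "j < i" using assms(3) by simp
  then show ?thesis using koszul_sign_less[OF assms(2,1)] by simp
qed (use koszul_sign_less assms in blast)

lemma koszul_sign_swap':
  assumes "i \<in> J" "j \<notin> J"
  shows "koszul_sign i J * koszul_sign j (insert j (J - {i})) = - (koszul_sign j (insert j J) * koszul_sign i (insert j J))"
proof -
  let ?K = "insert j J"
  have "i \<noteq> j" using assms by auto
  then have "koszul_sign i ?K * koszul_sign j (?K - {i}) = - (koszul_sign j ?K * koszul_sign i (?K - {j}))"
    using assms by (intro koszul_sign_swap) auto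
  moreover have "?K - {j} = J" "?K - {i} = insert j (J - {i})" using assms by auto
  ultimately have *: "koszul_sign i ?K * koszul_sign j (insert j (J - {i})) = - (koszul_sign j ?K * koszul_sign i J)" by simp
  have "koszul_sign i J * koszul_sign j (insert j (J - {i}))
      = (koszul_sign i ?K * koszul_sign i ?K) * (koszul_sign i J * koszul_sign j (insert j (J - {i})))" by simp
  also have "\<dots> = koszul_sign i ?K * koszul_sign i J * (koszul_sign i ?K * koszul_sign j (insert j (J - {i})))"
    by (simp only: mult_ac)
  also have "\<dots> = - ((koszul_sign i J * koszul_sign i J) * (koszul_sign j ?K * koszul_sign i ?K))"
    unfolding * by (simp add: mult_ac)
  finally show ?thesis by simp
qed

lemma sum_swap_antisym:
  fixes a :: "'d \<Rightarrow> 'd \<Rightarrow> 'a::real_vector"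
  assumes "finite J" and "\<And>i j. i \<in> J \<Longrightarrow> j \<in> J \<Longrightarrow> i \<noteq> j \<Longrightarrow> a i j = - a j i"
  shows "(\<Sum>i\<in>J. \<Sum>j\<in>J - {i}. a i j) = 0"
proof -
  let ?s = "\<Sum>i\<in>J. \<Sum>j\<in>J - {i}. a i j"
  have pairs: "(\<Sum>i\<in>J. \<Sum>j\<in>J - {i}. b i j) = (\<Sum>(i, j)\<in>(SIGMA i:J. J - {i}). b i j)" for b :: "'d \<Rightarrow> 'd \<Rightarrow> 'a"
    by (rule sum.Sigma) (use assms(1) in auto)
  have "?s = (\<Sum>i\<in>J. \<Sum>j\<in>J - {i}. - a j i)"
    by (intro sum.cong refl) (use assms(2) in auto)
  also have "\<dots> = (\<Sum>i\<in>J. \<Sum>j\<in>J - {i}. - a i j)"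
    unfolding pairs by (rule sum.reindex_bij_witness[of _ prod.swap prod.swap]) auto
  also have "\<dots> = - ?s" by (simp add: sum_negf)
  finally have "2 *\<^sub>R ?s = 0" by (simp add: scaleR_2 eq_neg_iff_add_eq_0)
  then show ?thesis by simp
qed

text \<open>The homotopy contracts with the \<open>B\<^sub>i\<close>: it maps \<open>x \<otimes> e\<^sub>J\<close> to the signed sum of the
  \<open>B\<^sub>i x \<otimes> e\<^bsub>J - {i}\<^esub>\<close>.\<close>

lemma koszul_exact_of_left_inverse:
  fixes S B :: "'d::{finite,linorder} \<Rightarrow> 'a::chilbert_space \<Rightarrow> 'a"
  assumes S: "\<And>i. linear (S i)" and B: "\<And>i. linear (B i)"
    and SS: "\<And>i j x. S i (S j x) = S j (S i x)" and SB: "\<And>i j x. S i (B j x) = B j (S i x)"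
    and inverse: "\<And>x. (\<Sum>i\<in>UNIV. B i (S i x)) = x"
  shows "koszul_exact S"
proof -
  let ?d = "koszul_boundary S"
  define h where "h x K = (\<Sum>j\<in>- K. koszul_sign j (insert j K) *\<^sub>R B j (x (insert j K)))"
    for x :: "'d set \<Rightarrow> 'a" and K
  have S0: "S i 0 = 0" and B0: "B i 0 = 0" for i
    using linear_0[OF S] linear_0[OF B] by auto
  have Ssum: "S i (\<Sum>j\<in>A. f j *\<^sub>R g j) = (\<Sum>j\<in>A. f j *\<^sub>R S i (g j))" for i A g and f :: "'d \<Rightarrow> real"
    by (simp add: linear_sum[OF S] linear_scale[OF S])
  have Bsum: "B i (\<Sum>j\<in>A. f j *\<^sub>R g j) = (\<Sum>j\<in>A. f j *\<^sub>R B i (g j))" for i A g and f :: "'d \<Rightarrow> real"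
    by (simp add: linear_sum[OF B] linear_scale[OF B])
  have dd: "?d (?d x) J = 0" for x J
  proof -
    have "?d (?d x) J = (\<Sum>i\<in>J. \<Sum>j\<in>J - {i}.
        (koszul_sign i J * koszul_sign j (J - {i})) *\<^sub>R S i (S j (x (J - {i} - {j}))))"
      by (simp add: koszul_boundary_sign Ssum scaleR_sum_right)
    also have "\<dots> = 0"
    proof (rule sum_swap_antisym)
      fix i j assume ij: "i \<in> J" "j \<in> J" "i \<noteq> j"
      have "J - {i} - {j} = J - {j} - {i}" by auto
      then show "(koszul_sign i J * koszul_sign j (J - {i})) *\<^sub>R S i (S j (x (J - {i} - {j})))
          = - ((koszul_sign j J * koszul_sign i (J - {j})) *\<^sub>R S j (S i (x (J - {j} - {i}))))"
        unfolding koszul_sign_swap[OF ij] by (simp add: SS[of i j])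
    qed simp
    finally show ?thesis .
  qed
  \<comment> \<open>Removing i and inserting j in the two orders gives opposite signs, so the mixed
    terms cancel. The diagonal terms run over J in one summand and over its complement in the other,
    and together give the full sum in \<open>inverse\<close>.\<close>
  have homotopy: "?d (h x) J + h (?d x) J = x J" for x J
  proof -
    have "?d (h x) J = (\<Sum>i\<in>J. \<Sum>j\<in>- (J - {i}).
        (koszul_sign i J * koszul_sign j (insert j (J - {i}))) *\<^sub>R B j (S i (x (insert j (J - {i})))))"
      by (simp only: koszul_boundary_sign h_def Ssum scaleR_sum_right scaleR_scaleR SB)
    also have "\<dots> = (\<Sum>i\<in>J. B i (S i (x J)) + (\<Sum>j\<in>- J.
        (koszul_sign i J * koszul_sign j (insert j (J - {i}))) *\<^sub>R B j (S i (x (insert j (J - {i}))))))"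
    proof (rule sum.cong[OF refl])
      fix i assume i: "i \<in> J"
      have "- (J - {i}) = insert i (- J)" using i by auto
      then show "(\<Sum>j\<in>- (J - {i}).
          (koszul_sign i J * koszul_sign j (insert j (J - {i}))) *\<^sub>R B j (S i (x (insert j (J - {i})))))
        = B i (S i (x J)) + (\<Sum>j\<in>- J.
          (koszul_sign i J * koszul_sign j (insert j (J - {i}))) *\<^sub>R B j (S i (x (insert j (J - {i})))))"
        using i by (simp add: insert_absorb)
    qed
    finally have dh: "?d (h x) J = (\<Sum>i\<in>J. B i (S i (x J))) + (\<Sum>i\<in>J. \<Sum>j\<in>- J.
        (koszul_sign i J * koszul_sign j (insert j (J - {i}))) *\<^sub>R B j (S i (x (insert j (J - {i})))))"
      by (simp only: sum.distrib)
    have "h (?d x) J = (\<Sum>j\<in>- J. \<Sum>i\<in>insert j J.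
        (koszul_sign j (insert j J) * koszul_sign i (insert j J)) *\<^sub>R B j (S i (x (insert j J - {i}))))"
      by (simp only: koszul_boundary_sign h_def Bsum scaleR_sum_right scaleR_scaleR)
    also have "\<dots> = (\<Sum>j\<in>- J. B j (S j (x J)) + (\<Sum>i\<in>J.
        - ((koszul_sign i J * koszul_sign j (insert j (J - {i}))) *\<^sub>R B j (S i (x (insert j (J - {i}))))))) "
    proof (rule sum.cong[OF refl])
      fix j assume "j \<in> - J"
      then have j: "j \<notin> J" by simp
      have "insert j J - {j} = J" using j by auto
      moreover have "(koszul_sign j (insert j J) * koszul_sign i (insert j J)) *\<^sub>R B j (S i (x (insert j J - {i})))
          = - ((koszul_sign i J * koszul_sign j (insert j (J - {i}))) *\<^sub>R B j (S i (x (insert j (J - {i})))))"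
        if i: "i \<in> J" for i
      proof -
        have "insert j J - {i} = insert j (J - {i})" using i j by auto
        then show ?thesis unfolding koszul_sign_swap'[OF i j] by simp
      qed
      ultimately show "(\<Sum>i\<in>insert j J.
          (koszul_sign j (insert j J) * koszul_sign i (insert j J)) *\<^sub>R B j (S i (x (insert j J - {i}))))
        = B j (S j (x J)) + (\<Sum>i\<in>J.
          - ((koszul_sign i J * koszul_sign j (insert j (J - {i}))) *\<^sub>R B j (S i (x (insert j (J - {i}))))))"
        using j by simp
    qed
    finally have hd: "h (?d x) J = (\<Sum>j\<in>- J. B j (S j (x J))) - (\<Sum>i\<in>J. \<Sum>j\<in>- J.
        (koszul_sign i J * koszul_sign j (insert j (J - {i}))) *\<^sub>R B j (S i (x (insert j (J - {i})))))"
      by (simp only: sum.distrib sum_negf sum.swap[of _ J "- J"]) simp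
    have "(\<Sum>i\<in>J. B i (S i (x J))) + (\<Sum>j\<in>- J. B j (S j (x J))) = (\<Sum>i\<in>J \<union> - J. B i (S i (x J)))"
      by (rule sum.union_disjoint[symmetric]) auto
    also have "\<dots> = x J" using inverse[of "x J"] by (simp add: Compl_partition)
    finally show ?thesis unfolding dh hd by simp
  qed
  have d_space: "?d y \<in> koszul_space k" if "y \<in> (if k = 0 then {\<lambda>_. 0} else koszul_space (k - 1))" for y k
  proof -
    have "?d y J = 0" if J: "card J \<noteq> k" for J
    proof -
      have "y (J - {i}) = 0" if i: "i \<in> J" for i
      proof (cases "k = 0")
        case False
        have "card J = Suc (card (J - {i}))" using card_Suc_Diff1[of J i] i by simp
        then have "card (J - {i}) \<noteq> k - 1" using J False by auto
        then show ?thesis using False \<open>y \<in> _\<close> by (simp add: koszul_space_def)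
      qed (use \<open>y \<in> _\<close> in simp)
      then show ?thesis by (simp add: koszul_boundary_sign S0)
    qed
    then show ?thesis by (simp add: koszul_space_def)
  qed
  have h_space: "h x \<in> (if k = 0 then {\<lambda>_. 0} else koszul_space (k - 1))" if x: "x \<in> koszul_space k" for x k
  proof -
    have "h x K = 0" if K: "Suc (card K) \<noteq> k" for K
    proof -
      have "x (insert j K) = 0" if "j \<in> - K" for j
      proof -
        have "card (insert j K) = Suc (card K)" using that by (intro card_insert_disjoint) auto
        then show ?thesis using x K by (simp add: koszul_space_def)
      qed
      then show ?thesis by (simp add: h_def B0)
    qed
    then show ?thesis by (auto simp: koszul_space_def fun_eq_iff)
  qed
  have "{x \<in> koszul_space k. ?d x = (\<lambda>_. 0)} = ?d ` (if k = 0 then {\<lambda>_. 0} else koszul_space (k - 1))" for k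
  proof (intro set_eqI iffI)
    fix x assume "x \<in> {x \<in> koszul_space k. ?d x = (\<lambda>_. 0)}"
    then have x: "x \<in> koszul_space k" "?d x = (\<lambda>_. 0)" by auto
    have "h (\<lambda>_. 0) J = 0" for J by (simp add: h_def B0)
    then have "x = ?d (h x)" using homotopy[of x] x(2) by (simp add: fun_eq_iff)
    then show "x \<in> ?d ` (if k = 0 then {\<lambda>_. 0} else koszul_space (k - 1))" using h_space[OF x(1)] by blast
  next
    fix x assume "x \<in> ?d ` (if k = 0 then {\<lambda>_. 0} else koszul_space (k - 1))"
    then show "x \<in> {x \<in> koszul_space k. ?d x = (\<lambda>_. 0)}" using d_space dd by blast
  qed
  then show ?thesis by (simp add: koszul_exact_def)
qed

text \<open>Exactness in top degree: the full index set lies in no larger one, so every element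
  there is a cocycle and hence a boundary.\<close>

lemma koszul_exact_surj:
  fixes S :: "'d::{finite,linorder} \<Rightarrow> 'a::chilbert_space \<Rightarrow> 'a"
  assumes exact: "koszul_exact S" and S: "\<And>i. linear (S i)"
  shows "\<exists>z. y = (\<Sum>i\<in>UNIV. S i (z i))"
proof -
  define x where "x J = (if J = UNIV then y else 0)" for J :: "'d set"
  have "x \<in> koszul_space CARD('d)" by (auto simp: koszul_space_def x_def)
  moreover have "koszul_boundary S x = (\<lambda>_. 0)"
  proof
    fix J :: "'d set"
    have "x (J - {i}) = 0" for i by (auto simp: x_def)
    then show "koszul_boundary S x J = 0" using linear_0[OF S] by (simp add: koszul_boundary_def)
  qed
  moreover have "{x \<in> koszul_space CARD('d). koszul_boundary S x = (\<lambda>_. 0)}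
      = koszul_boundary S ` (if CARD('d) = 0 then {\<lambda>_. 0} else koszul_space (CARD('d) - 1))"
    using exact unfolding koszul_exact_def by blast
  ultimately obtain w where "x = koszul_boundary S w" by blast
  then have "y = koszul_boundary S w UNIV" by (metis x_def)
  then have "y = (\<Sum>i\<in>UNIV. S i (koszul_sign i UNIV *\<^sub>R w (UNIV - {i})))"
    by (simp add: koszul_boundary_sign linear_scale[OF S])
  then show ?thesis by (rule exI[where x = "\<lambda>i. koszul_sign i UNIV *\<^sub>R w (UNIV - {i})"])
qed

lemma linear_shift:
  assumes "complex_linear_tuple T"
  shows "linear (\<lambda>x. blinfun_apply (T i) x - c *\<^sub>C x)"
  by (intro linear_compose_sub bounded_linear.linear blinfun.bounded_linear_right bounded_linear_scaleC)

text \<open>If the complex were exact, every x would be a sum of (T_i - l_i) z_i, and its pairing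
  with (n + 1) y_n would be bounded by the sum of the |z_i|. Uniform boundedness would then bound (n
  + 1) y_n, although the y_n are unit vectors.\<close>

lemma mem_taylor_spectrum_of_approx_eigenvector:
  fixes T :: "('a::chilbert_space, 'd::{finite,linorder}) op_tuple"
  assumes T: "complex_linear_tuple T"
    and approx: "\<And>e. 0 < e \<Longrightarrow> \<exists>y. norm y = 1 \<and> (\<forall>i. norm (adj (T i) y - cnj (l $ i) *\<^sub>C y) \<le> e)"
  shows "l \<in> taylor_spectrum T"
proof (rule ccontr)
  assume "l \<notin> taylor_spectrum T"
  then have exact: "koszul_exact (\<lambda>i x. T i x - l $ i *\<^sub>C x)" by (simp add: taylor_spectrum_def)
  have "\<forall>n. \<exists>y. norm y = 1 \<and> (\<forall>i. norm (adj (T i) y - cnj (l $ i) *\<^sub>C y) \<le> 1 / real (Suc n))"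
    using approx by simp
  from choice[OF this] obtain y where y: "\<And>n. norm (y n) = 1"
    "\<And>n i. norm (adj (T i) (y n) - cnj (l $ i) *\<^sub>C y n) \<le> 1 / real (Suc n)" by blast
  have "\<exists>C. \<forall>n. norm (real (Suc n) *\<^sub>R y n) \<le> C"
  proof (rule weakly_bounded_imp_bounded)
    fix x
    obtain z where x: "x = (\<Sum>i\<in>UNIV. T i (z i) - l $ i *\<^sub>C z i)"
      using koszul_exact_surj[OF exact linear_shift[OF T]] by blast
    have "\<bar>inner x (real (Suc n) *\<^sub>R y n)\<bar> \<le> (\<Sum>i\<in>UNIV. norm (z i))" for n
    proof -
      have "inner (T i (z i) - l $ i *\<^sub>C z i) (y n) = inner (z i) (adj (T i) (y n) - cnj (l $ i) *\<^sub>C y n)" for i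
        by (simp add: inner_diff_left inner_diff_right inner_adj complex_linear_tupleD[OF T] inner_scaleC_left)
      then have "inner x (real (Suc n) *\<^sub>R y n)
          = real (Suc n) * (\<Sum>i\<in>UNIV. inner (z i) (adj (T i) (y n) - cnj (l $ i) *\<^sub>C y n))"
        by (simp add: x inner_sum_left)
      also have "\<bar>\<dots>\<bar> \<le> real (Suc n) * (\<Sum>i\<in>UNIV. norm (z i) * (1 / real (Suc n)))"
        unfolding abs_mult
      proof (intro mult_mono order_trans[OF sum_abs] sum_mono)
        fix i
        have "\<bar>inner (z i) (adj (T i) (y n) - cnj (l $ i) *\<^sub>C y n)\<bar>
            \<le> norm (z i) * norm (adj (T i) (y n) - cnj (l $ i) *\<^sub>C y n)" by (rule Cauchy_Schwarz_ineq2)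
        also have "\<dots> \<le> norm (z i) * (1 / real (Suc n))" by (intro mult_left_mono y) simp
        finally show "\<bar>inner (z i) (adj (T i) (y n) - cnj (l $ i) *\<^sub>C y n)\<bar> \<le> norm (z i) * (1 / real (Suc n))" .
      qed auto
      also have "\<dots> = (\<Sum>i\<in>UNIV. norm (z i))" by (simp only: sum_distrib_right[symmetric]) simp
      finally show ?thesis .
    qed
    then show "\<exists>C. \<forall>n. \<bar>inner x (real (Suc n) *\<^sub>R y n)\<bar> \<le> C" by blast
  qed
  then obtain C where "\<And>n. real (Suc n) \<le> C" using y(1) by auto
  then show False by (meson not_less order.trans reals_Archimedean2 less_imp_le lessI of_nat_less_iff le_less_trans)
qed

section \<open>The Taylor spectrum is bounded by the growth rate\<close>

lemma op_pow_scaleR: "op_pow (r *\<^sub>R A) n = r ^ n *\<^sub>R op_pow A n"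
  by (induction n) (simp_all add: op_pow_Suc blinfun_compose_scaleR_left blinfun_compose_scaleR_right)

lemma op_pow_commute:
  assumes "A o\<^sub>L D = D o\<^sub>L A"
  shows "op_pow A n o\<^sub>L D = D o\<^sub>L op_pow A n"
proof (induction n)
  case (Suc n)
  have "op_pow A (Suc n) o\<^sub>L D = A o\<^sub>L (op_pow A n o\<^sub>L D)" by (simp add: op_pow_Suc blinfun_compose_assoc)
  also have "\<dots> = (A o\<^sub>L D) o\<^sub>L op_pow A n" by (simp only: Suc blinfun_compose_assoc)
  also have "\<dots> = D o\<^sub>L op_pow A (Suc n)" by (simp only: assms op_pow_Suc blinfun_compose_assoc)
  finally show ?case .
qed simp

text \<open>The commutation clause is applied with D a component of the tuple and with D a complex
  scalar.\<close>

lemma neumann_inverse: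
  fixes A :: "'a::banach \<Rightarrow>\<^sub>L 'a"
  assumes bound: "\<And>n. norm (op_pow A n) \<le> C * q ^ n" and q: "0 \<le> q" "q < 1"
  shows "\<exists>N. N o\<^sub>L (id_blinfun - A) = id_blinfun \<and> (\<forall>D. A o\<^sub>L D = D o\<^sub>L A \<longrightarrow> N o\<^sub>L D = D o\<^sub>L N)"
proof -
  have sm: "summable (\<lambda>n. op_pow A n)"
    by (rule summable_comparison_test'[of "\<lambda>n. C * q ^ n" 0])
      (use bound q in \<open>auto intro!: summable_mult summable_geometric\<close>)
  define N where "N = (\<Sum>n. op_pow A n)"
  have right: "N o\<^sub>L D = (\<Sum>n. op_pow A n o\<^sub>L D)" for D
    unfolding N_def
    by (rule bounded_linear.suminf[OF bounded_bilinear.bounded_linear_left[OF bounded_bilinear_blinfun_compose] sm])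
  have left: "D o\<^sub>L N = (\<Sum>n. D o\<^sub>L op_pow A n)" for D
    unfolding N_def
    by (rule bounded_linear.suminf[OF bounded_bilinear.bounded_linear_right[OF bounded_bilinear_blinfun_compose] sm])
  have "N o\<^sub>L (id_blinfun - A) = id_blinfun"
  proof -
    have "op_pow A n o\<^sub>L (id_blinfun - A) = op_pow A n - op_pow A (Suc n)" for n
    proof -
      have "op_pow A n o\<^sub>L (id_blinfun - A) = op_pow A n - (op_pow A n o\<^sub>L A)"
        by (rule blinfun_eqI) (simp add: blinfun.diff_left blinfun.diff_right)
      then show ?thesis by (simp add: op_pow_commute op_pow_Suc)
    qed
    moreover have "(\<lambda>n. op_pow A n - op_pow A (Suc n)) sums (op_pow A 0 - 0)"
      by (rule telescope_sums'[OF summable_LIMSEQ_zero[OF sm]])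
    ultimately have "(\<Sum>n. op_pow A n o\<^sub>L (id_blinfun - A)) = id_blinfun" by (simp add: sums_iff)
    then show ?thesis by (simp add: right)
  qed
  moreover have "N o\<^sub>L D = D o\<^sub>L N" if "A o\<^sub>L D = D o\<^sub>L A" for D
    unfolding right left op_pow_commute[OF that] ..
  ultimately show ?thesis by blast
qed

definition scale_op :: "complex \<Rightarrow> ('a::complex_inner \<Rightarrow>\<^sub>L 'a)" where
  "scale_op c = Blinfun (\<lambda>x. c *\<^sub>C x)"

lemma scale_op_apply [simp]: "scale_op c x = c *\<^sub>C x"
  by (simp add: scale_op_def bounded_linear_Blinfun_apply bounded_linear_scaleC)

text \<open>Pointwise version of \<open>pow_norm\<close>. It satisfies the recursion
  \<open>word_norm_Suc\<close>, which allows bounds on powers to be proved by induction before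
  taking suprema.\<close>

definition word_norm :: "('a::chilbert_space, 'd::finite) op_tuple \<Rightarrow> nat \<Rightarrow> 'a \<Rightarrow> real" where
  "word_norm T k x = L2_set (\<lambda>w. norm (word_op T w x)) (words k)"

lemma word_norm_le: "word_norm T k x \<le> pow_norm T k * norm x"
  unfolding word_norm_def pow_norm_def by (rule L2_col_le)

lemma word_norm_nonneg: "0 \<le> word_norm T k x"
  by (simp add: word_norm_def L2_set_nonneg)

lemma word_norm_0: "word_norm T 0 x = norm x"
  by (simp add: word_norm_def L2_set_def sum_words_0)

lemma word_norm_Suc: "word_norm T (Suc k) x = L2_set (\<lambda>i. word_norm T k (T i x)) UNIV"
proof -
  have "(\<Sum>w\<in>words (Suc k). (norm (word_op T w x))\<^sup>2) = (\<Sum>i\<in>UNIV. \<Sum>w\<in>words k. (norm (word_op T w (T i x)))\<^sup>2)"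
    unfolding sum_words_snoc by (subst sum.swap) (simp add: word_op_append)
  then show ?thesis by (simp add: word_norm_def L2_set_def sum_nonneg)
qed

lemma sum_word_norm_le:
  fixes b :: "complex ^ 'd::finite"
  shows "(\<Sum>i\<in>UNIV. cmod (b $ i) * word_norm T k (T i x)) \<le> norm b * word_norm T (Suc k) x"
proof -
  have "(\<Sum>i\<in>UNIV. cmod (b $ i) * word_norm T k (T i x))
      = (\<Sum>i\<in>UNIV. \<bar>cmod (b $ i)\<bar> * \<bar>word_norm T k (T i x)\<bar>)"
    by (simp add: word_norm_nonneg)
  also have "\<dots> \<le> L2_set (\<lambda>i. cmod (b $ i)) UNIV * L2_set (\<lambda>i. word_norm T k (T i x)) UNIV"
    by (rule L2_set_mult_ineq)
  finally show ?thesis by (simp add: norm_vec_def word_norm_Suc)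
qed

lemma taylor_spectrum_norm_le:
  fixes T :: "('a::chilbert_space, 'd::{finite,linorder}) op_tuple"
  assumes "commuting_tuple T" and l: "l \<in> taylor_spectrum T"
  shows "norm l \<le> growth_rate (pow_norm T)"
proof (rule ccontr)
  assume "\<not> norm l \<le> growth_rate (pow_norm T)"
  then obtain R where R: "growth_rate (pow_norm T) < R" "R < norm l" using dense by (meson not_le)
  have T: "complex_linear_tuple T" and TT: "T i o\<^sub>L T j = T j o\<^sub>L T i" for i j
    using assms(1) by (auto simp: commuting_tuple_def complex_linear_tuple_def)
  have TT': "T i (T j x) = T j (T i x)" for i j x
    using arg_cong[OF TT[of i j], of "\<lambda>A. blinfun_apply A x"] by simp
  have R0: "0 \<le> R" using growth_rate_nonneg[of "pow_norm T", OF pow_norm_nonneg] R by simp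
  have l0: "norm l > 0" using R R0 by linarith
  obtain C where C: "\<And>k. pow_norm T k \<le> C * R ^ k"
    using growth_rate_bound[OF pow_norm_nonneg pow_norm_add_le R(1)] by blast
  define S where "S = (\<Sum>i\<in>UNIV. scale_op (cnj (l $ i)) o\<^sub>L T i)"
  have S_apply: "S x = (\<Sum>i\<in>UNIV. cnj (l $ i) *\<^sub>C T i x)" for x
    by (simp add: S_def blinfun.sum_left)
  have ST: "S o\<^sub>L T j = T j o\<^sub>L S" for j
    by (rule blinfun_eqI) (simp add: S_apply blinfun.sum_right TT'[of _ j] complex_linearD[OF complex_linear_tupleD[OF T]])
  have Sc: "S o\<^sub>L scale_op c = scale_op c o\<^sub>L S" for c
    by (rule blinfun_eqI)
      (simp add: S_apply complex_vector.scale_sum_right complex_linearD[OF complex_linear_tupleD[OF T]] scaleC_scaleC mult.commute)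
  \<comment> \<open>Cauchy-Schwarz in each letter. A bound through the individual norms of the
    \<open>T i\<close> would not see the joint growth rate.\<close>
  have pow_bound: "norm (op_pow S k x) \<le> norm l ^ k * word_norm T k x" for k x
  proof (induction k arbitrary: x)
    case (Suc k)
    have comm: "op_pow S k (T i x) = T i (op_pow S k x)" for i
      using arg_cong[OF op_pow_commute[OF ST, of k i], of "\<lambda>A. blinfun_apply A x"] by simp
    have "norm (op_pow S (Suc k) x) \<le> (\<Sum>i\<in>UNIV. norm (cnj (l $ i) *\<^sub>C op_pow S k (T i x)))"
      unfolding op_pow_Suc by (simp add: S_apply comm norm_sum)
    also have "\<dots> = (\<Sum>i\<in>UNIV. cmod (l $ i) * norm (op_pow S k (T i x)))"
      by (simp add: norm_scaleC)
    also have "\<dots> \<le> (\<Sum>i\<in>UNIV. cmod (l $ i) * (norm l ^ k * word_norm T k (T i x)))"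
      by (intro sum_mono mult_left_mono Suc) simp
    also have "\<dots> = norm l ^ k * (\<Sum>i\<in>UNIV. cmod (l $ i) * word_norm T k (T i x))"
      by (simp add: sum_distrib_left mult_ac)
    also have "\<dots> \<le> norm l ^ k * (norm l * word_norm T (Suc k) x)"
      by (intro mult_left_mono sum_word_norm_le) simp
    finally show ?case by (simp add: mult_ac)
  qed (simp add: word_norm_0)
  define A where "A = (1 / (norm l)\<^sup>2) *\<^sub>R S"
  have "norm (op_pow A k) \<le> C * (R / norm l) ^ k" for k
  proof -
    have "norm (op_pow S k) \<le> norm l ^ k * (C * R ^ k)"
    proof (rule norm_blinfun_bound)
      show "0 \<le> norm l ^ k * (C * R ^ k)"
        using order_trans[OF pow_norm_nonneg C] by simp
      fix x
      have "norm (op_pow S k x) \<le> norm l ^ k * (pow_norm T k * norm x)"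
        by (rule order_trans[OF pow_bound]) (intro mult_left_mono word_norm_le, simp)
      also have "\<dots> \<le> norm l ^ k * (C * R ^ k * norm x)"
        by (intro mult_left_mono mult_right_mono C) auto
      finally show "norm (op_pow S k x) \<le> norm l ^ k * (C * R ^ k) * norm x" by (simp add: mult_ac)
    qed
    then have "norm (op_pow A k) \<le> (1 / (norm l)\<^sup>2) ^ k * (norm l ^ k * (C * R ^ k))"
      by (simp add: A_def op_pow_scaleR power_abs[symmetric] mult_left_mono divide_right_mono)
    also have "\<dots> = C * (R / norm l) ^ k"
      using l0 by (simp add: power_divide power2_eq_square power_mult_distrib)
    finally show ?thesis .
  qed
  then obtain N where N: "N o\<^sub>L (id_blinfun - A) = id_blinfun"
    and Ncomm: "\<And>D. A o\<^sub>L D = D o\<^sub>L A \<Longrightarrow> N o\<^sub>L D = D o\<^sub>L N"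
    using neumann_inverse[of A C "R / norm l"] R R0 l0 by auto
  have NT: "N (T j x) = T j (N x)" for j x
  proof -
    have "A o\<^sub>L T j = T j o\<^sub>L A"
      by (simp add: A_def blinfun_compose_scaleR_left blinfun_compose_scaleR_right ST)
    from arg_cong[OF Ncomm[OF this], of "\<lambda>A. blinfun_apply A x"] show ?thesis by simp
  qed
  have Nc: "N (c *\<^sub>C x) = c *\<^sub>C N x" for c x
  proof -
    have "A o\<^sub>L scale_op c = scale_op c o\<^sub>L A"
      by (simp add: A_def blinfun_compose_scaleR_left blinfun_compose_scaleR_right Sc)
    from arg_cong[OF Ncomm[OF this], of "\<lambda>A. blinfun_apply A x"] show ?thesis by simp
  qed
  \<comment> \<open>Since the sum of cnj l_i (l_i - T_i) equals |l|^2 (I - A), these maps form a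
    left inverse of the column of the T_i - l_i.\<close>
  define B where "B i x = (- cnj (l $ i) / complex_of_real ((norm l)\<^sup>2)) *\<^sub>C N x" for i x
  have "koszul_exact (\<lambda>i x. T i x - l $ i *\<^sub>C x)"
  proof (rule koszul_exact_of_left_inverse[where B = B])
    show "linear (\<lambda>x. T i x - l $ i *\<^sub>C x)" for i by (rule linear_shift[OF T])
    show "linear (B i)" for i
      unfolding B_def
      by (intro bounded_linear.linear bounded_linear_compose[OF bounded_linear_scaleC blinfun.bounded_linear_right])
    show "T i (T j x - l $ j *\<^sub>C x) - l $ i *\<^sub>C (T j x - l $ j *\<^sub>C x)
        = T j (T i x - l $ i *\<^sub>C x) - l $ j *\<^sub>C (T i x - l $ i *\<^sub>C x)" for i j x
      by (simp add: blinfun.diff_right complex_vector.scale_right_diff_distrib TT'[of i j] scaleC_scaleC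
          mult.commute complex_linearD[OF complex_linear_tupleD[OF T]])
    show "T i (B j x) - l $ i *\<^sub>C B j x = B j (T i x - l $ i *\<^sub>C x)" for i j x
      by (simp add: B_def blinfun.diff_right blinfun.minus_right complex_vector.scale_right_diff_distrib scaleC_scaleC
          mult.commute complex_linearD[OF complex_linear_tupleD[OF T]] NT Nc)
    show "(\<Sum>i\<in>UNIV. B i (T i x - l $ i *\<^sub>C x)) = x" for x
    proof -
      let ?c = "complex_of_real (1 / (norm l)\<^sup>2)"
      have norm_l: "(\<Sum>i\<in>UNIV. cnj (l $ i) * l $ i) = complex_of_real ((norm l)\<^sup>2)"
      proof -
        have "(norm l)\<^sup>2 = (\<Sum>i\<in>UNIV. (cmod (l $ i))\<^sup>2)"
          by (simp add: norm_vec_def L2_set_def sum_nonneg)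
        then show ?thesis by (simp only: of_real_sum complex_norm_square mult.commute)
      qed
      have "B i (T i x - l $ i *\<^sub>C x) = N (?c *\<^sub>C ((cnj (l $ i) * l $ i) *\<^sub>C x) - ?c *\<^sub>C (cnj (l $ i) *\<^sub>C T i x))" for i
        by (simp add: B_def Nc[symmetric] complex_vector.scale_right_diff_distrib scaleC_scaleC)
      then have "(\<Sum>i\<in>UNIV. B i (T i x - l $ i *\<^sub>C x))
          = N (?c *\<^sub>C ((\<Sum>i\<in>UNIV. cnj (l $ i) * l $ i) *\<^sub>C x) - ?c *\<^sub>C S x)"
        by (simp only: blinfun.sum_right[symmetric] sum_subtractf complex_vector.scale_sum_right[symmetric]
            complex_vector.scale_sum_left[symmetric] S_apply)
      also have "\<dots> = N (x - A x)"
        using l0 scaleR_scaleC[of 1 x] scaleR_scaleC[of "1 / (norm l)\<^sup>2" "S x"]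
        by (simp add: norm_l scaleC_scaleC A_def blinfun.scaleR_left)
      also have "\<dots> = x"
        using arg_cong[OF N, of "\<lambda>A. blinfun_apply A x"] by (simp add: blinfun.diff_left)
      finally show ?thesis .
    qed
  qed
  then show False using l by (simp add: taylor_spectrum_def)
qed

section \<open>Joint approximate eigenvectors of commuting operators\<close>

text \<open>The complex scalars are a parameter because the space to which this is applied is the
  type of real-linear operators, with scalars acting by \<open>left_scale\<close>.\<close>

locale complex_scaling =
  fixes sc :: "complex \<Rightarrow> 'b::real_normed_vector \<Rightarrow> 'b"
  assumes sc_add_right: "sc c (x + y) = sc c x + sc c y"
    and sc_add_left: "sc (b + c) x = sc b x + sc c x"
    and sc_sc: "sc b (sc c x) = sc (b * c) x"
    and sc_of_real: "sc (of_real r) x = r *\<^sub>R x"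
    and norm_sc: "norm (sc c x) = cmod c * norm x"
begin

definition complex_bounded_linear :: "('b \<Rightarrow> 'b) \<Rightarrow> bool" where
  "complex_bounded_linear S \<longleftrightarrow> bounded_linear S \<and> (\<forall>c x. S (sc c x) = sc c (S x))"

lemma sc_zero_left [simp]: "sc 0 x = 0"
  using norm_sc[of 0 x] by simp

lemma sc_zero_right [simp]: "sc c 0 = 0"
  using norm_sc[of c 0] by simp

lemma sc_one [simp]: "sc 1 x = x"
  using sc_of_real[of 1 x] by simp

lemma sc_minus_left: "sc (- c) x = - sc c x"
  using sc_add_left[of c "- c" x] by (simp add: eq_neg_iff_add_eq_0 add.commute)

lemma sc_scaleR: "sc c (r *\<^sub>R x) = r *\<^sub>R sc c x"
  by (simp add: sc_of_real[symmetric] sc_sc mult.commute)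

lemma complex_bounded_linear_shift:
  assumes "complex_bounded_linear S"
  shows "complex_bounded_linear (\<lambda>x. S x - sc c x)"
proof -
  have "bounded_linear (sc c)"
    by (rule bounded_linear_intro[of _ "cmod c"])
      (simp_all add: sc_add_right sc_scaleR norm_sc mult.commute)
  moreover have "sc b (x - y) = sc b x - sc b y" for b x y
    using sc_add_right[of b "x - y" y] by simp
  ultimately show ?thesis
    using assms by (auto simp: complex_bounded_linear_def sc_sc mult.commute intro: bounded_linear_sub)
qed

definition poly_apply :: "('b \<Rightarrow> 'b) \<Rightarrow> complex poly \<Rightarrow> 'b \<Rightarrow> 'b" where
  "poly_apply S p x = fold_coeffs (\<lambda>a y. sc a x + S y) p 0"

context
  fixes S :: "'b \<Rightarrow> 'b"
  assumes S: "complex_bounded_linear S"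
begin

interpretation S: bounded_linear S
  using S by (simp add: complex_bounded_linear_def)

lemma poly_apply_0 [simp]: "poly_apply S 0 x = 0"
  by (simp add: poly_apply_def)

lemma poly_apply_pCons: "poly_apply S (pCons a p) x = sc a x + S (poly_apply S p x)"
  by (cases "p = 0 \<and> a = 0") (auto simp: poly_apply_def S.zero)

lemma poly_apply_1: "poly_apply S 1 x = x"
  by (simp add: one_pCons poly_apply_pCons S.zero)

lemma poly_apply_linear_factor: "poly_apply S [:- c, 1:] x = S x - sc c x"
  by (simp add: poly_apply_pCons S.zero sc_minus_left)

lemma poly_apply_add: "poly_apply S (p + q) x = poly_apply S p x + poly_apply S q x"
  by (induction p q rule: poly_induct2) (simp_all add: poly_apply_pCons sc_add_left S.add)

lemma poly_apply_smult: "poly_apply S (smult c p) x = sc c (poly_apply S p x)"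
  using S by (induction p) (simp_all add: poly_apply_pCons sc_add_right sc_sc complex_bounded_linear_def)

lemma poly_apply_mult: "poly_apply S (p * q) x = poly_apply S p (poly_apply S q x)"
  by (induction p) (simp_all add: poly_apply_pCons poly_apply_add poly_apply_smult)

lemma poly_apply_power: "poly_apply S ([:0, 1:] ^ n) x = (S ^^ n) x"
  by (induction n) (simp_all add: poly_apply_1 poly_apply_mult poly_apply_pCons S.zero)

lemma poly_apply_scaleR: "poly_apply S p (r *\<^sub>R x) = r *\<^sub>R poly_apply S p x"
  by (induction p) (simp_all add: poly_apply_pCons sc_scaleR S.scaleR scaleR_add_right)

lemma poly_apply_commute:
  assumes D: "complex_bounded_linear D" and "\<And>x. D (S x) = S (D x)"
  shows "D (poly_apply S p x) = poly_apply S p (D x)"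
proof -
  interpret D: bounded_linear D using D by (simp add: complex_bounded_linear_def)
  show ?thesis
    using assms by (induction p) (simp_all add: poly_apply_pCons D.zero D.add complex_bounded_linear_def)
qed

lemma poly_apply_bounded: "\<exists>K\<ge>0. \<forall>x. norm (poly_apply S p x) \<le> K * norm x"
proof (induction p)
  case (pCons a p)
  then obtain K where K: "K \<ge> 0" "\<And>x. norm (poly_apply S p x) \<le> K * norm x" by blast
  obtain L where L: "L \<ge> 0" "\<And>x. norm (S x) \<le> norm x * L" using S.nonneg_bounded by blast
  have "norm (poly_apply S (pCons a p) x) \<le> (cmod a + K * L) * norm x" for x
  proof -
    have "norm (poly_apply S (pCons a p) x) \<le> norm (sc a x) + norm (S (poly_apply S p x))"
      unfolding poly_apply_pCons by (rule norm_triangle_ineq)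
    also have "\<dots> \<le> cmod a * norm x + (K * norm x) * L"
      using K(2)[of x] L by (intro add_mono order_trans[OF L(2)] mult_right_mono) (auto simp: norm_sc)
    finally show ?thesis by (simp add: algebra_simps)
  qed
  then show ?case using K L by (intro exI[of _ "cmod a + K * L"]) auto
qed (auto intro: exI[of _ 0])

end

end

text \<open>S is the next map to receive an approximate eigenvalue; \<D> holds the maps that are to
  stay almost zero on the approximate eigenvectors.\<close>

locale approx_kernel = complex_scaling sc for sc :: "complex \<Rightarrow> 'b::real_normed_vector \<Rightarrow> 'b" +
  fixes S :: "'b \<Rightarrow> 'b" and \<D> :: "('b \<Rightarrow> 'b) set"
  assumes S: "complex_bounded_linear S"
    and \<D>: "\<And>D. D \<in> \<D> \<Longrightarrow> complex_bounded_linear D"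
    and commute: "\<And>D x. D \<in> \<D> \<Longrightarrow> D (S x) = S (D x)"
    and kernel: "\<And>e. 0 < e \<Longrightarrow> \<exists>x. norm x = 1 \<and> (\<forall>D\<in>\<D>. norm (D x) \<le> e)"
begin

definition N :: "real \<Rightarrow> 'b set" where
  "N e = {x. norm x \<le> 1 \<and> (\<forall>D\<in>\<D>. norm (D x) \<le> e)}"

text \<open>The norm of \<open>p(S)\<close> on the limiting joint kernel of \<open>\<D>\<close>, that is, on the joint kernel in
  an ultrapower.\<close>

definition \<nu> :: "complex poly \<Rightarrow> real" where
  "\<nu> p = (INF e\<in>{0<..}. SUP x\<in>N e. norm (poly_apply S p x))"

lemma zero_in_N: "0 < e \<Longrightarrow> 0 \<in> N e"
proof -
  assume e: "0 < e"
  have "norm (D 0) \<le> e" if "D \<in> \<D>" for D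
  proof -
    have "D 0 = 0"
      using \<D>[OF that] by (intro linear_0 bounded_linear.linear) (simp add: complex_bounded_linear_def)
    then show ?thesis using e by simp
  qed
  then show ?thesis by (simp add: N_def)
qed

lemma N_mono: "e \<le> e' \<Longrightarrow> N e \<subseteq> N e'"
  by (auto simp: N_def intro: order_trans)

lemma bdd_N: "bdd_above ((\<lambda>x. norm (poly_apply S p x)) ` N e)"
proof -
  obtain K where K: "K \<ge> 0" "\<And>x. norm (poly_apply S p x) \<le> K * norm x"
    using poly_apply_bounded[OF S] by blast
  show ?thesis
  proof (rule bdd_aboveI2)
    fix x assume "x \<in> N e"
    then have "K * norm x \<le> K * 1" using K by (intro mult_left_mono) (auto simp: N_def)
    then show "norm (poly_apply S p x) \<le> K * 1" using K(2)[of x] by linarith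
  qed
qed

lemma sup_N_nonneg: "0 < e \<Longrightarrow> 0 \<le> (SUP x\<in>N e. norm (poly_apply S p x))"
  by (rule cSUP_upper2[OF bdd_N zero_in_N]) auto

lemma bdd_sup_N: "bdd_below ((\<lambda>e. SUP x\<in>N e. norm (poly_apply S p x)) ` {0<..})"
  by (rule bdd_belowI2[of _ 0]) (simp add: sup_N_nonneg)

lemma \<nu>_nonneg: "0 \<le> \<nu> p"
  unfolding \<nu>_def by (rule cINF_greatest) (auto simp: sup_N_nonneg)

lemma \<nu>_lessD:
  assumes "\<nu> p < c"
  shows "\<exists>e>0. \<forall>x\<in>N e. norm (poly_apply S p x) < c"
proof -
  obtain e where e: "0 < e" "(SUP x\<in>N e. norm (poly_apply S p x)) < c"
    using assms cINF_less_iff[OF _ bdd_sup_N[of p], of c] unfolding \<nu>_def by auto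
  have "norm (poly_apply S p x) < c" if "x \<in> N e" for x
    using cSUP_upper[OF that bdd_N, of p] e(2) by linarith
  then show ?thesis using e(1) by blast
qed

lemma \<nu>_leI:
  assumes e: "0 < e" and le: "\<And>x. x \<in> N e \<Longrightarrow> norm (poly_apply S p x) \<le> c"
  shows "\<nu> p \<le> c"
proof -
  have "\<nu> p \<le> (SUP x\<in>N e. norm (poly_apply S p x))"
    unfolding \<nu>_def by (rule cINF_lower[OF bdd_sup_N]) (use e in simp)
  also have "\<dots> \<le> c" by (rule cSUP_least) (use zero_in_N[OF e] le in auto)
  finally show ?thesis .
qed

text \<open>Because \<D> commutes with S, the rescaled vector q(S) x is again almost annihilated by
  \<D>, so the bound for p applies to it.\<close>

lemma \<nu>_mult: "\<nu> (p * q) \<le> \<nu> p * \<nu> q"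
proof (rule tendsto_lowerbound[of "\<lambda>h. (\<nu> p + h) * (\<nu> q + h)" _ "at_right 0"])
  have "((\<lambda>h. (\<nu> p + h) * (\<nu> q + h)) \<longlongrightarrow> (\<nu> p + 0) * (\<nu> q + 0)) (at_right 0)"
    by (intro tendsto_intros)
  then show "((\<lambda>h. (\<nu> p + h) * (\<nu> q + h)) \<longlongrightarrow> \<nu> p * \<nu> q) (at_right 0)" by simp
  have "\<nu> (p * q) \<le> (\<nu> p + h) * (\<nu> q + h)" if h: "0 < h" for h
  proof -
    define c where "c = \<nu> q + h"
    have c0: "c > 0" using \<nu>_nonneg[of q] h by (simp add: c_def)
    obtain e1 where e1: "0 < e1" "\<And>x. x \<in> N e1 \<Longrightarrow> norm (poly_apply S p x) < \<nu> p + h"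
      using \<nu>_lessD[of p "\<nu> p + h"] h by auto
    obtain e2 where e2: "0 < e2" "\<And>x. x \<in> N e2 \<Longrightarrow> norm (poly_apply S q x) < c"
      using \<nu>_lessD[of q c] h by (auto simp: c_def)
    obtain K where K: "K \<ge> 0" "\<And>x. norm (poly_apply S q x) \<le> K * norm x"
      using poly_apply_bounded[OF S] by blast
    \<comment> \<open>q(S) enlarges \<open>norm (D x)\<close> by at most K, and rescaling divides by
      c; \<open>K + 1\<close> avoids division by zero.\<close>
    define e where "e = min e2 (e1 * c / (K + 1))"
    have e0: "0 < e" using e1 e2 c0 K by (simp add: e_def)
    show ?thesis
    proof (rule \<nu>_leI[OF e0])
      fix x assume x: "x \<in> N e"
      define y where "y = (1 / c) *\<^sub>R poly_apply S q x"
      have "x \<in> N e2" using x N_mono[of e e2] by (auto simp: e_def)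
      then have "norm y \<le> 1" using e2(2)[of x] c0 by (simp add: y_def)
      moreover have "norm (D y) \<le> e1" if D: "D \<in> \<D>" for D
      proof -
        have "D y = (1 / c) *\<^sub>R poly_apply S q (D x)"
          using \<D>[OF D] poly_apply_commute[OF S \<D>[OF D] commute[OF D], of q x]
          by (simp add: y_def complex_bounded_linear_def bounded_linear.linear linear_scale)
        then have "norm (D y) = norm (poly_apply S q (D x)) / c" using c0 by simp
        also have "\<dots> \<le> (K * norm (D x)) / c" using K c0 by (intro divide_right_mono) auto
        also have "\<dots> \<le> ((K + 1) * e) / c"
          using x D K c0 e0 by (intro divide_right_mono mult_mono) (auto simp: N_def)
        also have "\<dots> \<le> ((K + 1) * (e1 * c / (K + 1))) / c"
          using K c0 by (intro divide_right_mono mult_left_mono) (auto simp: e_def)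
        also have "\<dots> = e1" using K c0 by simp
        finally show ?thesis .
      qed
      ultimately have "y \<in> N e1" by (simp add: N_def)
      have "poly_apply S (p * q) x = c *\<^sub>R poly_apply S p y"
        using c0 by (simp add: poly_apply_mult[OF S] y_def poly_apply_scaleR[OF S])
      then have "norm (poly_apply S (p * q) x) = norm (poly_apply S p y) * c" using c0 by simp
      also have "\<dots> \<le> (\<nu> p + h) * c" using e1(2)[OF \<open>y \<in> N e1\<close>] c0 by (intro mult_right_mono) auto
      finally show "norm (poly_apply S (p * q) x) \<le> (\<nu> p + h) * (\<nu> q + h)" by (simp add: c_def)
    qed
  qed
  then show "\<forall>\<^sub>F h in at_right 0. \<nu> (p * q) \<le> (\<nu> p + h) * (\<nu> q + h)"
    by (simp add: eventually_at_filter)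
qed simp

sublocale poly_seminorm \<nu>
proof
  show "0 \<le> \<nu> p" for p by (rule \<nu>_nonneg)
  show "\<nu> (p * q) \<le> \<nu> p * \<nu> q" for p q by (rule \<nu>_mult)
  show "\<nu> (p + q) \<le> \<nu> p + \<nu> q" for p q
  proof (rule field_le_epsilon)
    fix h :: real assume h: "0 < h"
    obtain e1 where e1: "0 < e1" "\<And>x. x \<in> N e1 \<Longrightarrow> norm (poly_apply S p x) < \<nu> p + h / 2"
      using \<nu>_lessD[of p "\<nu> p + h / 2"] h by auto
    obtain e2 where e2: "0 < e2" "\<And>x. x \<in> N e2 \<Longrightarrow> norm (poly_apply S q x) < \<nu> q + h / 2"
      using \<nu>_lessD[of q "\<nu> q + h / 2"] h by auto
    show "\<nu> (p + q) \<le> \<nu> p + \<nu> q + h"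
    proof (rule \<nu>_leI[of "min e1 e2"])
      fix x assume "x \<in> N (min e1 e2)"
      then have "x \<in> N e1" "x \<in> N e2" using N_mono[of "min e1 e2" e1] N_mono[of "min e1 e2" e2] by auto
      then have "norm (poly_apply S p x) + norm (poly_apply S q x) \<le> \<nu> p + \<nu> q + h"
        using e1(2)[of x] e2(2)[of x] by linarith
      then show "norm (poly_apply S (p + q) x) \<le> \<nu> p + \<nu> q + h"
        unfolding poly_apply_add[OF S] by (rule order_trans[OF norm_triangle_ineq])
    qed (use e1 e2 in simp)
  qed
  show "\<nu> (smult c p) \<le> cmod c * \<nu> p" for c p
  proof (rule field_le_epsilon)
    fix h :: real assume h: "0 < h"
    have k: "cmod c + 1 > 0" by (simp add: add_nonneg_pos)
    then have "0 < h / (cmod c + 1)" using h by simp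
    then obtain e where e: "0 < e" "\<And>x. x \<in> N e \<Longrightarrow> norm (poly_apply S p x) < \<nu> p + h / (cmod c + 1)"
      using \<nu>_lessD[of p "\<nu> p + h / (cmod c + 1)"] by auto
    show "\<nu> (smult c p) \<le> cmod c * \<nu> p + h"
    proof (rule \<nu>_leI[OF e(1)])
      fix x assume x: "x \<in> N e"
      have "norm (poly_apply S (smult c p) x) = cmod c * norm (poly_apply S p x)"
        by (simp add: poly_apply_smult[OF S] norm_sc)
      also have "\<dots> \<le> cmod c * (\<nu> p + h / (cmod c + 1))"
        using e(2)[OF x] by (intro mult_left_mono) auto
      also have "\<dots> = cmod c * \<nu> p + h * (cmod c / (cmod c + 1))" by (simp add: algebra_simps)
      also have "\<dots> \<le> cmod c * \<nu> p + h * 1" using h k by (intro add_left_mono mult_left_mono) auto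
      finally show "norm (poly_apply S (smult c p) x) \<le> cmod c * \<nu> p + h" by simp
    qed
  qed
  show "\<nu> 1 = 1"
  proof (rule antisym)
    show "\<nu> 1 \<le> 1" by (rule \<nu>_leI[of 1]) (auto simp: poly_apply_1[OF S] N_def)
    show "1 \<le> \<nu> 1"
    proof (rule ccontr)
      assume "\<not> 1 \<le> \<nu> 1"
      then obtain e where e: "0 < e" "\<And>x. x \<in> N e \<Longrightarrow> norm x < 1"
        using \<nu>_lessD[of 1 1] by (auto simp: poly_apply_1[OF S])
      obtain x where "norm x = 1" "x \<in> N e" using kernel[OF e(1)] by (auto simp: N_def)
      then show False using e(2)[of x] by simp
    qed
  qed
qed

text \<open>The eigenvector is p(S) x, normalised, for an x in the approximate kernel with |p(S) x|
  > \<nu> p / 2: the root property makes S - \<mu> small on it, and commutation keeps it almost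
  annihilated by \<D>.\<close>

lemma approx_eigenvector_of_approx_root:
  assumes root: "\<And>\<delta>. 0 < \<delta> \<Longrightarrow> \<exists>p. \<nu> ([:- \<mu>, 1:] * p) < \<delta> * \<nu> p" and e: "0 < e"
  shows "\<exists>x. norm x = 1 \<and> norm (S x - sc \<mu> x) \<le> e \<and> (\<forall>D\<in>\<D>. norm (D x) \<le> e)"
proof -
  have "0 < e / 2" using e by simp
  from root[OF this] obtain p where p: "\<nu> ([:- \<mu>, 1:] * p) < e / 2 * \<nu> p" by blast
  define a where "a = \<nu> p"
  have "0 < e / 2 * \<nu> p" using p \<nu>_nonneg[of "[:- \<mu>, 1:] * p"] by linarith
  then have a0: "0 < a" using e by (simp add: a_def zero_less_mult_iff)
  obtain e1 where e1: "0 < e1" "\<And>x. x \<in> N e1 \<Longrightarrow> norm (poly_apply S ([:- \<mu>, 1:] * p) x) < e / 2 * a"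
    using \<nu>_lessD[OF p] unfolding a_def by blast
  obtain K where K: "K \<ge> 0" "\<And>x. norm (poly_apply S p x) \<le> K * norm x"
    using poly_apply_bounded[OF S] by blast
  define e2 where "e2 = min e1 (e * (a / 2) / (K + 1))"
  have e20: "0 < e2" using e1 e a0 K by (simp add: e2_def)
  have "\<exists>x\<in>N e2. a / 2 < norm (poly_apply S p x)"
  proof (rule ccontr)
    assume "\<not> ?thesis"
    then have "\<nu> p \<le> a / 2" by (intro \<nu>_leI[OF e20]) (auto simp: not_less)
    then show False using a0 by (simp add: a_def)
  qed
  then obtain x where x: "x \<in> N e2" "a / 2 < norm (poly_apply S p x)" by blast
  define z where "z = poly_apply S p x"
  have z: "a / 2 < norm z" using x(2) by (simp add: z_def)
  then have z0: "0 < norm z" using a0 by linarith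
  define y where "y = (1 / norm z) *\<^sub>R z"
  have small: "(1 / norm z) * norm v \<le> e" if v: "norm v \<le> e * a / 2" for v :: 'b
  proof -
    have "norm v \<le> e * (a / 2)" using v by simp
    also have "\<dots> \<le> e * norm z" using z e by (intro mult_left_mono) auto
    finally have "norm v \<le> e * norm z" .
    then show ?thesis using z0 by (simp add: field_simps)
  qed
  have "norm y = 1" using z0 by (simp add: y_def)
  moreover have "norm (S y - sc \<mu> y) \<le> e"
  proof -
    have "x \<in> N e1" using x(1) N_mono[of e2 e1] by (auto simp: e2_def)
    then have "norm (poly_apply S [:- \<mu>, 1:] z) \<le> e * a / 2"
      using e1(2)[of x] by (simp only: poly_apply_mult[OF S] z_def) simp
    moreover have "S y - sc \<mu> y = (1 / norm z) *\<^sub>R poly_apply S [:- \<mu>, 1:] z"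
      by (simp only: poly_apply_linear_factor[OF S, symmetric] y_def poly_apply_scaleR[OF S])
    ultimately show ?thesis using small by simp
  qed
  moreover have "norm (D y) \<le> e" if D: "D \<in> \<D>" for D
  proof -
    have "D y = (1 / norm z) *\<^sub>R poly_apply S p (D x)"
      using \<D>[OF D] poly_apply_commute[OF S \<D>[OF D] commute[OF D], of p x]
      by (simp add: y_def z_def complex_bounded_linear_def bounded_linear.linear linear_scale)
    moreover have "norm (poly_apply S p (D x)) \<le> e * a / 2"
    proof -
      have "norm (poly_apply S p (D x)) \<le> K * norm (D x)" by (rule K(2))
      also have "\<dots> \<le> (K + 1) * e2" using x(1) D K e20 by (intro mult_mono) (auto simp: N_def)
      also have "\<dots> \<le> (K + 1) * (e * (a / 2) / (K + 1))" using K by (intro mult_left_mono) (auto simp: e2_def)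
      also have "\<dots> = e * (a / 2)"
      proof -
        have "K + 1 \<noteq> 0" using K(1) by linarith
        then show ?thesis by (metis nonzero_mult_div_cancel_left times_divide_eq_right)
      qed
      finally show ?thesis by simp
    qed
    ultimately show ?thesis using small by simp
  qed
  ultimately show ?thesis by blast
qed

text \<open>No modulus is prescribed here, so the growth rate of \<nu>(X^n) itself serves as the
  radius of the circle.\<close>

lemma approx_eigenvalue_exists:
  "\<exists>\<mu>. \<forall>e>0. \<exists>x. norm x = 1 \<and> norm (S x - sc \<mu> x) \<le> e \<and> (\<forall>D\<in>\<D>. norm (D x) \<le> e)"
proof -
  let ?a = "\<lambda>n. \<nu> (X ^ n)"
  have a: "0 \<le> ?a n" "?a (m + n) \<le> ?a m * ?a n" for m n
    using \<nu>_mult[of "X ^ m" "X ^ n"] by (simp_all add: \<nu>_nonneg power_add)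
  have low: "growth_rate ?a ^ n \<le> ?a n" for n
    using growth_rate_power_le[of ?a n, OF a(1)] by (cases n) (auto simp: one)
  show ?thesis
    using exists_approx_root[OF growth_rate_nonneg[of ?a, OF a(1)] low growth_rate_bound[of ?a, OF a]]
      approx_eigenvector_of_approx_root by blast
qed

text \<open>With \<D> empty, every \<open>N e\<close> is the unit ball and \<nu> is the operator
  norm of p(S); the two growth assumptions then fix the radius.\<close>

lemma approx_eigenvalue_on_circle:
  assumes empty: "\<D> = {}" and r: "0 \<le> r"
    and low: "\<And>n. \<exists>x. norm x \<le> 1 \<and> r ^ n \<le> norm ((S ^^ n) x)"
    and growth: "\<And>R. r < R \<Longrightarrow> \<exists>C. \<forall>n x. norm ((S ^^ n) x) \<le> C * R ^ n * norm x"
  shows "\<exists>\<mu>. cmod \<mu> = r \<and> (\<forall>e>0. \<exists>x. norm x = 1 \<and> norm (S x - sc \<mu> x) \<le> e)"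
proof -
  have N: "N e = {x. norm x \<le> 1}" for e unfolding N_def using empty by simp
  have low': "r ^ n \<le> \<nu> (X ^ n)" for n
  proof (rule ccontr)
    assume "\<not> r ^ n \<le> \<nu> (X ^ n)"
    then have "\<nu> (X ^ n) < r ^ n" by simp
    from \<nu>_lessD[OF this] obtain e where "\<And>x. x \<in> N e \<Longrightarrow> norm ((S ^^ n) x) < r ^ n"
      by (auto simp: X_def poly_apply_power[OF S])
    then show False using low[of n] by (force simp: N)
  qed
  have growth': "\<exists>C. \<forall>n. \<nu> (X ^ n) \<le> C * R ^ n" if R: "r < R" for R
  proof -
    obtain C where C: "\<And>n x. norm ((S ^^ n) x) \<le> C * R ^ n * norm x" using growth[OF R] by blast
    have "\<nu> (X ^ n) \<le> \<bar>C\<bar> * R ^ n" for n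
    proof (rule \<nu>_leI[of 1])
      fix x assume "x \<in> N 1"
      then have x: "norm x \<le> 1" by (simp add: N)
      have "norm ((S ^^ n) x) \<le> C * R ^ n * norm x" by (rule C)
      also have "\<dots> \<le> (\<bar>C\<bar> * R ^ n) * 1" using x r R by (intro mult_mono mult_right_mono) auto
      finally show "norm (poly_apply S (X ^ n) x) \<le> \<bar>C\<bar> * R ^ n" by (simp add: X_def poly_apply_power[OF S])
    qed simp
    then show ?thesis by blast
  qed
  show ?thesis
    using exists_approx_root[OF r low' growth'] approx_eigenvector_of_approx_root by blast
qed

end

section \<open>The growth rate is attained on the Taylor spectrum\<close>

text \<open>The complex scalars act on operators from the left, so that left multiplication by a
  complex linear operator is complex linear on all of them.\<close>

definition left_scale :: "complex \<Rightarrow> ('a::complex_inner \<Rightarrow>\<^sub>L 'a) \<Rightarrow> ('a \<Rightarrow>\<^sub>L 'a)" where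
  "left_scale c X = scale_op c o\<^sub>L X"

lemma left_scale_apply [simp]: "left_scale c X x = c *\<^sub>C X x"
  by (simp add: left_scale_def)

interpretation left_scale: complex_scaling "left_scale :: complex \<Rightarrow> ('a::chilbert_space \<Rightarrow>\<^sub>L 'a) \<Rightarrow> _"
proof
  fix X Y :: "'a \<Rightarrow>\<^sub>L 'a" and b c :: complex and r :: real
  show "left_scale c (X + Y) = left_scale c X + left_scale c Y"
    by (rule blinfun_eqI) (simp add: blinfun.add_left scaleC_add_right)
  show "left_scale (b + c) X = left_scale b X + left_scale c X"
    by (rule blinfun_eqI) (simp add: blinfun.add_left scaleC_add_left)
  show "left_scale b (left_scale c X) = left_scale (b * c) X"
    by (rule blinfun_eqI) (simp add: scaleC_scaleC)
  show "left_scale (of_real r) X = r *\<^sub>R X"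
    by (rule blinfun_eqI) (simp add: blinfun.scaleR_left scaleR_scaleC)
  have le: "norm (left_scale c X) \<le> cmod c * norm X" for c and X :: "'a \<Rightarrow>\<^sub>L 'a"
  proof (rule norm_blinfun_bound)
    show "norm (left_scale c X x) \<le> cmod c * norm X * norm x" for x
      using mult_left_mono[OF norm_blinfun[of X x], of "cmod c"] by (simp add: norm_scaleC mult.assoc)
  qed simp
  show "norm (left_scale c X) = cmod c * norm X"
  proof (cases "c = 0")
    case False
    have "left_scale (1 / c) (left_scale c X) = X"
      using False scaleR_scaleC[of 1] by (intro blinfun_eqI) (simp add: scaleC_scaleC)
    then have "norm X \<le> cmod (1 / c) * norm (left_scale c X)" using le by metis
    then have "cmod c * norm X \<le> norm (left_scale c X)"
      using False by (simp add: norm_divide field_simps)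
    then show ?thesis using le[of c X] by simp
  qed (use le[of 0 X] in simp)
qed

context
  fixes T :: "('a::chilbert_space, 'd::{finite,linorder}) op_tuple"
  assumes T: "commuting_tuple T" and nontrivial: "\<exists>u :: 'a. u \<noteq> 0"
begin

private lemma cl: "complex_linear_tuple T"
  using T by (simp add: commuting_tuple_def complex_linear_tuple_def)

private lemmas clD = complex_linear_tupleD[OF cl]

private definition L :: "'d \<Rightarrow> ('a \<Rightarrow>\<^sub>L 'a) \<Rightarrow> ('a \<Rightarrow>\<^sub>L 'a)" where
  "L i X = adj (T i) o\<^sub>L X"

private definition Q :: "('a \<Rightarrow>\<^sub>L 'a) \<Rightarrow> ('a \<Rightarrow>\<^sub>L 'a)" where
  "Q X = (\<Sum>i\<in>UNIV. L i X o\<^sub>L T i)"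

private lemma L_apply [simp]: "L i X x = adj (T i) (X x)"
  by (simp add: L_def)

private lemma Q_apply: "Q X x = (\<Sum>i\<in>UNIV. adj (T i) (X (T i x)))"
  by (simp add: Q_def blinfun.sum_left)

private lemma TT: "T i (T j x) = T j (T i x)"
proof -
  have "T i o\<^sub>L T j = T j o\<^sub>L T i" using T by (simp add: commuting_tuple_def)
  from arg_cong[OF this, of "\<lambda>A. blinfun_apply A x"] show ?thesis by simp
qed

private lemma adj_commute: "adj (T i) (adj (T j) x) = adj (T j) (adj (T i) x)"
  by (rule cinner_ext) (simp add: cinner_adj[OF clD, symmetric] TT[of i j])

private lemma norm_id: "norm (id_blinfun :: 'a \<Rightarrow>\<^sub>L 'a) = 1"
proof (rule antisym[OF norm_blinfun_id_le])
  obtain u :: 'a where "u \<noteq> 0" using nontrivial by blast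
  then show "1 \<le> norm (id_blinfun :: 'a \<Rightarrow>\<^sub>L 'a)" using norm_blinfun[of id_blinfun u] by simp
qed

private lemma cbl_L: "left_scale.complex_bounded_linear (L i)"
  unfolding left_scale.complex_bounded_linear_def
proof (intro conjI allI)
  show "bounded_linear (L i)"
    unfolding L_def by (rule bounded_bilinear.bounded_linear_right[OF bounded_bilinear_blinfun_compose])
  show "L i (left_scale c X) = left_scale c (L i X)" for c X
    by (rule blinfun_eqI) (simp add: complex_linearD[OF complex_linear_adj[OF clD]])
qed

private lemma cbl_Q: "left_scale.complex_bounded_linear Q"
  unfolding left_scale.complex_bounded_linear_def
proof (intro conjI allI)
  have "bounded_linear (\<lambda>X. L i X o\<^sub>L T i)" for i
    using cbl_L[of i] unfolding left_scale.complex_bounded_linear_def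
    by (intro bounded_linear_compose[OF bounded_bilinear.bounded_linear_left[OF bounded_bilinear_blinfun_compose]]) auto
  then show "bounded_linear Q" unfolding Q_def by (intro bounded_linear_sum) auto
  show "Q (left_scale c X) = left_scale c (Q X)" for c X
    by (rule blinfun_eqI)
      (simp add: Q_apply complex_linearD[OF complex_linear_adj[OF clD]] complex_vector.scale_sum_right)
qed

private lemma L_commute: "L i (L j X) = L j (L i X)"
  by (rule blinfun_eqI) (simp add: adj_commute[of i j])

private lemma LQ_commute: "L i (Q X) = Q (L i X)"
  by (rule blinfun_eqI) (simp add: Q_apply blinfun.sum_right adj_commute[of i])

private lemma inner_Q: "inner (Q X u) v = (\<Sum>i\<in>UNIV. inner (X (T i u)) (T i v))"
  by (simp add: Q_apply inner_sum_left inner_adj_left[OF clD])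

text \<open>Each application of Q adds the same letter to both arguments of the form, and
  Cauchy-Schwarz in that letter separates u from v.\<close>

private lemma inner_Q_pow_le:
  "inner ((Q ^^ n) X u) v \<le> norm X * (word_norm T n u * word_norm T n v)"
proof (induction n arbitrary: u v)
  case 0
  have "inner (X u) v \<le> norm (X u) * norm v" by (rule norm_cauchy_schwarz)
  also have "\<dots> \<le> norm X * norm u * norm v" by (intro mult_right_mono norm_blinfun) auto
  finally show ?case by (simp add: word_norm_0 mult.assoc)
next
  case (Suc n)
  have "inner ((Q ^^ Suc n) X u) v = (\<Sum>i\<in>UNIV. inner ((Q ^^ n) X (T i u)) (T i v))"
    by (simp add: inner_Q)
  also have "\<dots> \<le> (\<Sum>i\<in>UNIV. norm X * (word_norm T n (T i u) * word_norm T n (T i v)))"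
    by (intro sum_mono Suc)
  also have "\<dots> = norm X * (\<Sum>i\<in>UNIV. \<bar>word_norm T n (T i u)\<bar> * \<bar>word_norm T n (T i v)\<bar>)"
    by (simp add: sum_distrib_left word_norm_nonneg)
  also have "\<dots> \<le> norm X * (word_norm T (Suc n) u * word_norm T (Suc n) v)"
    unfolding word_norm_Suc by (intro mult_left_mono L2_set_mult_ineq) simp
  finally show ?case .
qed

private lemma norm_Q_pow_le: "norm ((Q ^^ n) X) \<le> norm X * (pow_norm T n)\<^sup>2"
proof (rule norm_blinfun_bound)
  fix u
  let ?v = "(Q ^^ n) X u"
  have "norm ?v * norm ?v \<le> norm X * (word_norm T n u * word_norm T n ?v)"
    using inner_Q_pow_le[of n X u ?v] by (simp add: power2_norm_eq_inner[symmetric] power2_eq_square)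
  also have "\<dots> \<le> norm X * ((pow_norm T n * norm u) * (pow_norm T n * norm ?v))"
    by (intro mult_left_mono mult_mono word_norm_le mult_nonneg_nonneg pow_norm_nonneg word_norm_nonneg) auto
  finally have "norm ?v * norm ?v \<le> (norm X * (pow_norm T n)\<^sup>2 * norm u) * norm ?v"
    by (simp add: power2_eq_square mult_ac)
  then show "norm ?v \<le> norm X * (pow_norm T n)\<^sup>2 * norm u"
    by (cases "?v = 0") (auto simp: mult_le_cancel_right)
qed simp

private lemma inner_Q_pow_id: "inner ((Q ^^ n) id_blinfun u) u = (word_norm T n u)\<^sup>2"
proof (induction n arbitrary: u)
  case 0
  show ?case by (simp add: word_norm_0 power2_norm_eq_inner)
next
  case (Suc n)
  show ?case by (simp add: inner_Q Suc word_norm_Suc L2_set_def sum_nonneg)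
qed

text \<open>At the identity the quadratic form is exactly the squared word norm. Hence the upper
  bound on Q^n is attained and its growth rate is \<rho>^2.\<close>

private lemma norm_Q_pow_id: "(pow_norm T n)\<^sup>2 \<le> norm ((Q ^^ n) id_blinfun)"
proof -
  let ?A = "(Q ^^ n) id_blinfun"
  have "pow_norm T n \<le> sqrt (norm ?A)"
    unfolding pow_norm_def
  proof (rule col_norm_le)
    fix u
    have "(\<Sum>w\<in>words n. (norm (word_op T w u))\<^sup>2) = inner (?A u) u"
      unfolding inner_Q_pow_id by (simp add: word_norm_def L2_set_def sum_nonneg)
    also have "\<dots> \<le> norm (?A u) * norm u" by (rule norm_cauchy_schwarz)
    also have "\<dots> \<le> norm ?A * norm u * norm u" by (intro mult_right_mono norm_blinfun) auto
    also have "\<dots> = (sqrt (norm ?A))\<^sup>2 * (norm u)\<^sup>2" by (simp add: power2_eq_square)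
    finally show "(\<Sum>w\<in>words n. (norm (word_op T w u))\<^sup>2) \<le> (sqrt (norm ?A))\<^sup>2 * (norm u)\<^sup>2" .
  qed simp
  then have "(pow_norm T n)\<^sup>2 \<le> (sqrt (norm ?A))\<^sup>2" by (rule power_mono) (rule pow_norm_nonneg)
  then show ?thesis by simp
qed

private abbreviation \<rho> where "\<rho> \<equiv> growth_rate (pow_norm T)"

private lemma \<rho>_nonneg: "0 \<le> \<rho>"
  by (rule growth_rate_nonneg[OF pow_norm_nonneg])

private lemma pow_norm_growth: "\<rho> < R \<Longrightarrow> \<exists>C. \<forall>n. pow_norm T n \<le> C * R ^ n"
  by (rule growth_rate_bound[OF pow_norm_nonneg pow_norm_add_le])

private lemma Q_approx_eigenvalue:
  "\<exists>\<mu>. cmod \<mu> = \<rho>\<^sup>2 \<and> (\<forall>e>0. \<exists>W. norm W = 1 \<and> norm (Q W - left_scale \<mu> W) \<le> e)"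
proof -
  interpret approx_kernel left_scale Q "{}"
    by unfold_locales (use cbl_Q norm_id in auto)
  show ?thesis
  proof (rule approx_eigenvalue_on_circle)
    fix n
    have "(\<rho>\<^sup>2) ^ n \<le> norm ((Q ^^ n) id_blinfun)"
    proof (cases "n = 0")
      case False
      have "(\<rho>\<^sup>2) ^ n = (\<rho> ^ n)\<^sup>2" by (simp add: power_mult[symmetric] mult.commute)
      also have "\<dots> \<le> (pow_norm T n)\<^sup>2"
        using False \<rho>_nonneg by (intro power_mono growth_rate_power_le[OF pow_norm_nonneg]) auto
      finally show ?thesis using norm_Q_pow_id[of n] by linarith
    qed (simp add: norm_id)
    then show "\<exists>X. norm X \<le> 1 \<and> (\<rho>\<^sup>2) ^ n \<le> norm ((Q ^^ n) X)"
      using norm_id by (intro exI[of _ id_blinfun]) simp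
  next
    fix R assume R: "\<rho>\<^sup>2 < R"
    then have R0: "0 \<le> R" using zero_le_power2[of \<rho>] by linarith
    have "sqrt (\<rho>\<^sup>2) < sqrt R" using R by (rule real_sqrt_less_mono)
    then have "\<rho> < sqrt R" using \<rho>_nonneg by simp
    then obtain C where C: "\<And>n. pow_norm T n \<le> C * sqrt R ^ n" using pow_norm_growth by blast
    have "norm ((Q ^^ n) X) \<le> C\<^sup>2 * R ^ n * norm X" for n X
    proof -
      have "(pow_norm T n)\<^sup>2 \<le> (C * sqrt R ^ n)\<^sup>2" by (rule power_mono[OF C pow_norm_nonneg])
      also have "\<dots> = C\<^sup>2 * ((sqrt R)\<^sup>2) ^ n" by (simp only: power_mult_distrib power_mult[symmetric] mult.commute)
      also have "\<dots> = C\<^sup>2 * R ^ n" using R0 by simp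
      finally have "norm X * (pow_norm T n)\<^sup>2 \<le> norm X * (C\<^sup>2 * R ^ n)" by (rule mult_left_mono) simp
      then show ?thesis using norm_Q_pow_le[of n X] by (simp add: mult_ac)
    qed
    then show "\<exists>C. \<forall>n X. norm ((Q ^^ n) X) \<le> C * R ^ n * norm X" by blast
  qed auto
qed

text \<open>Induction on the index set: \<D> consists of Q - \<mu> and the L_i - b_i already
  obtained, and L_j commutes with all of them.\<close>

private lemma joint_approx_eigenvalue:
  assumes \<mu>: "\<And>e. 0 < e \<Longrightarrow> \<exists>W. norm W = 1 \<and> norm (Q W - left_scale \<mu> W) \<le> e"
    and "finite F"
  shows "\<exists>b. \<forall>e>0. \<exists>W. norm W = 1 \<and> norm (Q W - left_scale \<mu> W) \<le> e
    \<and> (\<forall>i\<in>F. norm (L i W - left_scale (b i) W) \<le> e)"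
  using \<open>finite F\<close>
proof (induction F rule: finite_induct)
  case empty
  then show ?case using \<mu> by simp
next
  case (insert j F)
  then obtain b where b: "\<And>e. 0 < e \<Longrightarrow> \<exists>W. norm W = 1 \<and> norm (Q W - left_scale \<mu> W) \<le> e
    \<and> (\<forall>i\<in>F. norm (L i W - left_scale (b i) W) \<le> e)" by blast
  define \<D> where "\<D> = insert (\<lambda>W. Q W - left_scale \<mu> W) ((\<lambda>i W. L i W - left_scale (b i) W) ` F)"
  have L_diff: "L j (X - Y) = L j X - L j Y" for X Y
    by (simp add: L_def bounded_bilinear.diff_right[OF bounded_bilinear_blinfun_compose])
  have L_scale: "L j (left_scale c X) = left_scale c (L j X)" for c X
    using cbl_L by (simp add: left_scale.complex_bounded_linear_def)
  interpret approx_kernel left_scale "L j" \<D>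
  proof
    show "left_scale.complex_bounded_linear (L j)" by (rule cbl_L)
    show "left_scale.complex_bounded_linear D" if "D \<in> \<D>" for D
      using that by (auto simp: \<D>_def intro!: left_scale.complex_bounded_linear_shift cbl_L cbl_Q)
    show "D (L j X) = L j (D X)" if "D \<in> \<D>" for D X
      using that by (auto simp: \<D>_def L_diff L_scale LQ_commute L_commute[of _ j])
    show "\<exists>X. norm X = 1 \<and> (\<forall>D\<in>\<D>. norm (D X) \<le> e)" if "0 < e" for e
      using b[OF that] by (auto simp: \<D>_def)
  qed
  obtain c where c: "\<And>e. 0 < e \<Longrightarrow> \<exists>W. norm W = 1 \<and> norm (L j W - left_scale c W) \<le> e \<and> (\<forall>D\<in>\<D>. norm (D W) \<le> e)"
    using approx_eigenvalue_exists by blast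
  show ?case
  proof (intro exI[of _ "b(j := c)"] allI impI)
    fix e :: real assume "0 < e"
    from c[OF this] obtain W where W: "norm W = 1" "norm (L j W - left_scale c W) \<le> e" "\<And>D. D \<in> \<D> \<Longrightarrow> norm (D W) \<le> e"
      by blast
    have "norm (Q W - left_scale \<mu> W) \<le> e" using W(3)[of "\<lambda>W. Q W - left_scale \<mu> W"] by (simp add: \<D>_def)
    moreover have "norm (L i W - left_scale (b i) W) \<le> e" if "i \<in> F" for i
      using W(3)[of "\<lambda>W. L i W - left_scale (b i) W"] that by (simp add: \<D>_def)
    ultimately show "\<exists>W. norm W = 1 \<and> norm (Q W - left_scale \<mu> W) \<le> e
        \<and> (\<forall>i\<in>insert j F. norm (L i W - left_scale ((b(j := c)) i) W) \<le> e)"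
      using W(1,2) by (intro exI[of _ W]) auto
  qed
qed

text \<open>On an approximate eigenvector \<open>W\<close>, the map \<open>Q\<close> acts as \<open>X \<mapsto> \<Sum>\<^sub>i b\<^sub>i X T\<^sub>i\<close>, whose
  \<open>k\<close>-th power has norm at most \<open>|b|\<^sup>k\<close> times \<open>pow_norm T k\<close>.\<close>

private lemma joint_eigenvalue_large:
  fixes b :: "complex ^ 'd::{finite,linorder}"
  assumes \<mu>: "cmod \<mu> = \<rho>\<^sup>2"
    and approx: "\<And>e. 0 < e \<Longrightarrow> \<exists>W. norm W = 1 \<and> norm (Q W - left_scale \<mu> W) \<le> e
      \<and> (\<forall>i. norm (L i W - left_scale (b $ i) W) \<le> e)"
  shows "\<rho> \<le> norm b"
proof (cases "\<rho> = 0")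
  case False
  then have \<rho>0: "0 < \<rho>" using \<rho>_nonneg by simp
  define K where "K W = (\<Sum>i\<in>UNIV. left_scale (b $ i) (W o\<^sub>L T i))" for W
  have K_apply: "K W u = (\<Sum>i\<in>UNIV. b $ i *\<^sub>C W (T i u))" for W u
    by (simp add: K_def blinfun.sum_left)
  have K_diff: "K (X - Y) = K X - K Y" for X Y
    by (rule blinfun_eqI)
      (simp add: K_apply blinfun.diff_left complex_vector.scale_right_diff_distrib sum_subtractf)
  have K_scale: "K (left_scale c X) = left_scale c (K X)" for c X
    by (rule blinfun_eqI) (simp add: K_apply complex_vector.scale_sum_right scaleC_scaleC mult.commute)
  define \<kappa> where "\<kappa> = (\<Sum>i\<in>UNIV. cmod (b $ i) * norm (T i))"
  have \<kappa>0: "0 \<le> \<kappa>" unfolding \<kappa>_def by (intro sum_nonneg) simp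
  have norm_K: "norm (K W) \<le> \<kappa> * norm W" for W
  proof -
    have "norm (K W) \<le> (\<Sum>i\<in>UNIV. cmod (b $ i) * norm (W o\<^sub>L T i))"
      unfolding K_def by (rule order_trans[OF norm_sum]) (simp add: left_scale.norm_sc)
    also have "\<dots> \<le> (\<Sum>i\<in>UNIV. cmod (b $ i) * (norm W * norm (T i)))"
      by (intro sum_mono mult_left_mono norm_blinfun_compose) simp
    finally show ?thesis by (simp add: \<kappa>_def sum_distrib_left mult_ac)
  qed
  have K_pow: "norm ((K ^^ k) W u) \<le> norm W * (norm b ^ k * word_norm T k u)" for k W u
  proof (induction k arbitrary: u)
    case 0
    show ?case using norm_blinfun[of W u] by (simp add: word_norm_0)
  next
    case (Suc k)
    have "norm ((K ^^ Suc k) W u) \<le> (\<Sum>i\<in>UNIV. cmod (b $ i) * norm ((K ^^ k) W (T i u)))"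
      by (simp add: K_apply) (rule order_trans[OF norm_sum], simp add: norm_scaleC)
    also have "\<dots> \<le> (\<Sum>i\<in>UNIV. cmod (b $ i) * (norm W * (norm b ^ k * word_norm T k (T i u))))"
      by (intro sum_mono mult_left_mono Suc) simp
    also have "\<dots> = norm W * norm b ^ k * (\<Sum>i\<in>UNIV. cmod (b $ i) * word_norm T k (T i u))"
      by (simp add: sum_distrib_left mult_ac)
    also have "\<dots> \<le> norm W * norm b ^ k * (norm b * word_norm T (Suc k) u)"
      by (intro mult_left_mono sum_word_norm_le) simp
    finally show ?case by (simp add: mult_ac)
  qed
  have K_pow': "norm ((K ^^ k) W) \<le> norm W * (norm b ^ k * pow_norm T k)" for k W
  proof (rule norm_blinfun_bound)
    fix u
    have "norm W * (norm b ^ k * word_norm T k u) \<le> norm W * (norm b ^ k * (pow_norm T k * norm u))"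
      by (intro mult_left_mono word_norm_le) auto
    then show "norm ((K ^^ k) W u) \<le> norm W * (norm b ^ k * pow_norm T k) * norm u"
      using K_pow[of k W u] by (simp add: mult_ac)
  qed (simp add: pow_norm_nonneg)
  \<comment> \<open>The constant may depend on k but not on W: for fixed k, a good enough W
    satisfies K^k W \<approx> \<mu>^k W.\<close>
  have K_pow_eig: "\<exists>c\<ge>0. \<forall>W. norm ((K ^^ k) W - left_scale (\<mu> ^ k) W) \<le> c * norm (K W - left_scale \<mu> W)" for k
  proof (induction k)
    case 0
    show ?case by (intro exI[of _ 0]) simp
  next
    case (Suc k)
    then obtain c where c: "0 \<le> c" "\<And>W. norm ((K ^^ k) W - left_scale (\<mu> ^ k) W) \<le> c * norm (K W - left_scale \<mu> W)"
      by blast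
    have "norm ((K ^^ Suc k) W - left_scale (\<mu> ^ Suc k) W) \<le> (\<kappa> * c + cmod \<mu> ^ k) * norm (K W - left_scale \<mu> W)" for W
    proof -
      have "left_scale c (X - Y) = left_scale c X - left_scale c Y" for c and X Y :: "'a \<Rightarrow>\<^sub>L 'a"
        using left_scale.sc_add_right[of c "X - Y" Y] by simp
      then have "(K ^^ Suc k) W - left_scale (\<mu> ^ Suc k) W
          = K ((K ^^ k) W - left_scale (\<mu> ^ k) W) + left_scale (\<mu> ^ k) (K W - left_scale \<mu> W)"
        by (simp add: K_diff K_scale left_scale.sc_sc mult.commute)
      also have "norm \<dots> \<le> norm (K ((K ^^ k) W - left_scale (\<mu> ^ k) W)) + norm (left_scale (\<mu> ^ k) (K W - left_scale \<mu> W))"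
        by (rule norm_triangle_ineq)
      also have "\<dots> \<le> \<kappa> * (c * norm (K W - left_scale \<mu> W)) + cmod \<mu> ^ k * norm (K W - left_scale \<mu> W)"
        using \<kappa>0 by (intro add_mono order_trans[OF norm_K] mult_left_mono c)
          (simp_all add: left_scale.norm_sc norm_power)
      finally show ?thesis by (simp add: algebra_simps)
    qed
    then show ?case using \<kappa>0 c(1) by (intro exI[of _ "\<kappa> * c + cmod \<mu> ^ k"]) auto
  qed
  \<comment> \<open>Replacing Q by K costs the tolerance times the sum of the norms; the summand 1
    pays for the error in Q W \<approx> \<mu> W.\<close>
  define \<tau> where "\<tau> = 1 + (\<Sum>i\<in>UNIV. norm (T i))"
  have \<tau>0: "0 < \<tau>" unfolding \<tau>_def by (intro add_pos_nonneg sum_nonneg) auto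
  have K_approx: "\<exists>W. norm W = 1 \<and> norm (K W - left_scale \<mu> W) \<le> e" if e: "0 < e" for e
  proof -
    have "0 < e / \<tau>" using e \<tau>0 by simp
    from approx[OF this] obtain W where W: "norm W = 1" "norm (Q W - left_scale \<mu> W) \<le> e / \<tau>"
      "\<And>i. norm (L i W - left_scale (b $ i) W) \<le> e / \<tau>" by blast
    have "Q W - K W = (\<Sum>i\<in>UNIV. (L i W - left_scale (b $ i) W) o\<^sub>L T i)"
      by (rule blinfun_eqI) (simp add: Q_apply K_apply blinfun.diff_left blinfun.sum_left sum_subtractf)
    also have "norm \<dots> \<le> (\<Sum>i\<in>UNIV. e / \<tau> * norm (T i))"
      by (intro order_trans[OF norm_sum] sum_mono order_trans[OF norm_blinfun_compose] mult_right_mono W) simp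
    finally have "norm (Q W - K W) \<le> e / \<tau> * (\<Sum>i\<in>UNIV. norm (T i))" by (simp add: sum_distrib_left)
    then have "norm (K W - left_scale \<mu> W) \<le> e / \<tau> * (\<Sum>i\<in>UNIV. norm (T i)) + e / \<tau>"
      using W(2) norm_triangle_ineq4[of "Q W - left_scale \<mu> W" "Q W - K W"] by simp
    also have "\<dots> = e / \<tau> * \<tau>" unfolding \<tau>_def by (simp add: algebra_simps add_divide_distrib)
    also have "\<dots> = e" using \<tau>0 by simp
    finally show ?thesis using W(1) by blast
  qed
  have main: "(\<rho>\<^sup>2) ^ k \<le> norm b ^ k * pow_norm T k" for k
  proof (rule field_le_epsilon)
    fix e :: real assume e: "0 < e"
    obtain c where c: "0 \<le> c" "\<And>W. norm ((K ^^ k) W - left_scale (\<mu> ^ k) W) \<le> c * norm (K W - left_scale \<mu> W)"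
      using K_pow_eig by blast
    have "0 < e / (c + 1)" using e c by simp
    then obtain W where W: "norm W = 1" "norm (K W - left_scale \<mu> W) \<le> e / (c + 1)"
      using K_approx by blast
    have "c * norm (K W - left_scale \<mu> W) \<le> (c + 1) * (e / (c + 1))"
      using W c e by (intro mult_mono) auto
    also have "\<dots> = e" using c by simp
    finally have "norm ((K ^^ k) W - left_scale (\<mu> ^ k) W) \<le> e" using c(2)[of W] by linarith
    moreover have "norm (left_scale (\<mu> ^ k) W) = (\<rho>\<^sup>2) ^ k"
      by (simp add: left_scale.norm_sc W norm_power \<mu>)
    ultimately show "(\<rho>\<^sup>2) ^ k \<le> norm b ^ k * pow_norm T k + e"
      using K_pow'[of k W] W(1) norm_triangle_sub[of "left_scale (\<mu> ^ k) W" "(K ^^ k) W"]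
      by (simp add: norm_minus_commute)
  qed
  \<comment> \<open>Large k eliminates the constant C; then R tends to \<rho>, and one factor \<rho>
    cancels.\<close>
  have "\<rho>\<^sup>2 \<le> norm b * R" if R: "\<rho> < R" for R
  proof -
    obtain C where C: "\<And>n. pow_norm T n \<le> C * R ^ n" using pow_norm_growth[OF R] by blast
    show ?thesis
    proof (rule power_le_const_mult_power)
      show "0 \<le> norm b * R" using R \<rho>0 by simp
      fix k
      have "(\<rho>\<^sup>2) ^ k \<le> norm b ^ k * (C * R ^ k)"
        by (rule order_trans[OF main]) (intro mult_left_mono C, simp)
      then show "(\<rho>\<^sup>2) ^ k \<le> C * (norm b * R) ^ k" by (simp add: power_mult_distrib mult_ac)
    qed
  qed
  then have "\<forall>\<^sub>F R in at_right \<rho>. \<rho>\<^sup>2 \<le> norm b * R" by (simp add: eventually_at_filter)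
  moreover have "((\<lambda>R. norm b * R) \<longlongrightarrow> norm b * \<rho>) (at_right \<rho>)" by (intro tendsto_intros)
  ultimately have "\<rho>\<^sup>2 \<le> norm b * \<rho>" by (intro tendsto_lowerbound[of _ _ "at_right \<rho>"]) auto
  then show ?thesis using \<rho>0 by (simp add: power2_eq_square)
qed simp

lemma taylor_spectrum_norm_attained: "\<exists>l\<in>taylor_spectrum T. \<rho> \<le> norm l"
proof -
  obtain \<mu> where \<mu>: "cmod \<mu> = \<rho>\<^sup>2" "\<And>e. 0 < e \<Longrightarrow> \<exists>W. norm W = 1 \<and> norm (Q W - left_scale \<mu> W) \<le> e"
    using Q_approx_eigenvalue by blast
  obtain b0 where b0: "\<And>e. 0 < e \<Longrightarrow> \<exists>W. norm W = 1 \<and> norm (Q W - left_scale \<mu> W) \<le> e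
    \<and> (\<forall>i\<in>UNIV. norm (L i W - left_scale (b0 i) W) \<le> e)"
    using joint_approx_eigenvalue[OF \<mu>(2) finite_class.finite_UNIV] by blast
  define b where "b = (\<chi> i. b0 i)"
  have b: "\<exists>W. norm W = 1 \<and> norm (Q W - left_scale \<mu> W) \<le> e
    \<and> (\<forall>i. norm (L i W - left_scale (b $ i) W) \<le> e)" if "0 < e" for e
    using b0[OF that] by (simp add: b_def)
  define l where "l = (\<chi> i. cnj (b $ i))"
  have "l \<in> taylor_spectrum T"
  proof (rule mem_taylor_spectrum_of_approx_eigenvector[OF cl])
    fix e :: real assume e: "0 < e"
    then obtain W where W: "norm W = 1" "\<And>i. norm (L i W - left_scale (b $ i) W) \<le> e / 2"
      using b[of "e / 2"] by auto
    \<comment> \<open>An approximate eigenoperator becomes an approximate eigenvector by evaluation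
      at a u where W attains at least half of its norm; normalising W u then at most doubles the
      error, which explains e / 2.\<close>
    have "\<exists>u. norm (W u) > 1 / 2 * norm u"
    proof (rule ccontr)
      assume "\<nexists>u. norm (W u) > 1 / 2 * norm u"
      then have "norm W \<le> 1 / 2" by (intro norm_blinfun_bound) (auto simp: not_less)
      then show False using W(1) by simp
    qed
    then obtain u where u: "norm (W u) > 1 / 2 * norm u" by blast
    then have Wu: "0 < norm (W u)" by (meson le_less_trans mult_nonneg_nonneg norm_ge_zero zero_le_divide_1_iff zero_le_numeral)
    define y where "y = (1 / norm (W u)) *\<^sub>R W u"
    have "norm (adj (T i) y - cnj (l $ i) *\<^sub>C y) \<le> e" for i
    proof -
      have "adj (T i) y - cnj (l $ i) *\<^sub>C y = (1 / norm (W u)) *\<^sub>R ((L i W - left_scale (b $ i) W) u)"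
        by (simp add: y_def l_def blinfun.scaleR_right blinfun.diff_left scaleC_scaleR scaleR_diff_right)
      then have "norm (adj (T i) y - cnj (l $ i) *\<^sub>C y) = norm ((L i W - left_scale (b $ i) W) u) / norm (W u)"
        by simp
      also have "\<dots> \<le> (e / 2 * norm u) / norm (W u)"
        by (intro divide_right_mono order_trans[OF norm_blinfun] mult_right_mono W) auto
      also have "\<dots> \<le> (e * norm (W u)) / norm (W u)"
        using u e by (intro divide_right_mono) (auto simp: mult.assoc[symmetric])
      finally show ?thesis using Wu by simp
    qed
    then show "\<exists>y. norm y = 1 \<and> (\<forall>i. norm (adj (T i) y - cnj (l $ i) *\<^sub>C y) \<le> e)"
      using Wu by (intro exI[of _ y]) (auto simp: y_def)
  qed
  moreover have "norm l = norm b" by (simp add: l_def norm_vec_def)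
  moreover have "\<rho> \<le> norm b" by (rule joint_eigenvalue_large[OF \<mu>(1) b])
  ultimately show ?thesis by (intro bexI[of _ l]) simp_all
qed

lemma joint_spectral_radius_eq_growth_rate: "joint_spectral_radius T = growth_rate (pow_norm T)"
proof -
  obtain l where l: "l \<in> taylor_spectrum T" "\<rho> \<le> norm l" using taylor_spectrum_norm_attained by blast
  then have "norm l = \<rho>" using taylor_spectrum_norm_le[OF T l(1)] by simp
  then show ?thesis
    unfolding joint_spectral_radius_def
    by (intro cSup_eq_maximum) (use imageI[OF l(1), of norm] taylor_spectrum_norm_le[OF T] in auto)
qed

end

theorem theorem1p8:
  fixes T :: "('a::chilbert_space, 'd::{finite,linorder}) op_tuple" and t :: real
  assumes "\<not> (\<exists>B :: 'a set. finite B \<and> cspan B = UNIV)"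
    and "commuting_tuple T"
    and "0 < t" and "t < 1"
  shows "(\<lambda>n. tuple_norm ((aluthge t ^^ n) T)) \<longlonglongrightarrow> joint_spectral_radius T"
proof -
  \<comment> \<open>A nonzero vector gives the identity norm 1, so that it can start the search for
    approximate eigenoperators of Q.\<close>
  have "\<exists>u :: 'a. u \<noteq> 0"
  proof (rule ccontr)
    assume "\<nexists>u :: 'a. u \<noteq> 0"
    then have "(u :: 'a) \<in> cspan {}" for u
      using complex_vector.span_zero[of "{} :: 'a set"] by simp
    then have "cspan ({} :: 'a set) = UNIV" by blast
    with assms(1) show False by blast
  qed
  then have "joint_spectral_radius T = growth_rate (pow_norm T)"
    by (rule joint_spectral_radius_eq_growth_rate[OF assms(2)])
  moreover have "complex_linear_tuple T"
    using assms(2) by (simp add: commuting_tuple_def complex_linear_tuple_def)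
  ultimately show ?thesis using tuple_norm_aluthge_tendsto assms(3,4) by metis
qed

end
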